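(* Let $\delta\ge0$ and let $D$ be a $\delta$-hyperbolic digraph that satisfies (B1) and (B2) for the function $f\colon\mathbb R\to\mathbb R$ and that has a finite base $S$. Let $\varepsilon>0$ be such that $e^{2\varepsilon(6\delta+2\delta f(\delta+1))}<\sqrt2$. Then the following hold for $D\cup\partial D$ equipped with $d_{S,\varepsilon}$. (i) If every vertex of $D$ has finite out-degree, then $D\cup\partial D$ is sequentially f-compact. (ii) If every vertex of $D$ has finite in-degree, then $D\cup\partial D$ is sequentially b-compact.
   Context: Digraphs may have loops, parallel edges and oppositely oriented edges. A directed path in $D$ is a sequence $x_0\ldots x_n$ of vertices with every $x_ix_{i+1}$ an edge; its length $\ell$ is $n$. $d(x,y)$ is the length of a shortest directed path from $x$ to $y$, or $\infty$ if there is none. $D$ is regarded as the space $X=V(D)$ with the (non-symmetric) distance $d$ and these directed paths; a directed path from $x$ to $y$ is a geodesic if its length is $d(x,y)$. The out-degree (in-degree) of $x$ is the number of $y$ with $d(x,y)=1$ ($d(y,x)=1$). $\mathcal B^+_r(x)=\{y: d(x,y)\le r\}$, $\mathcal B^-_r(x)=\{y:d(y,x)\le r\}$, and $\mathcal B^\pm_r(Y)=\bigcup_{y\in Y}\mathcal B^\pm_r(y)$. A geodesic triangle consists of three points and three geodesics (its sides), one between every two of these points (in one of the two directions). It is $\delta$-thin if for every labelling $P,Q,R$ of its sides such that the starting point of $P$ is the starting or the end point of $Q$ and the end point of $P$ is the starting or the end point of $R$, we have $P\subseteq\mathcal B^+_\delta(Q)\cup\mathcal B^-_\delta(R)$. $D$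 is $\delta$-hyperbolic if all geodesic triangles are $\delta$-thin. (B1) for $f$: for all $x$, $r\ge0$ and $y,z\in\mathcal B^+_r(x)$, $d(y,z)$ is either $\infty$ or at most $f(r)$. (B2) for $f$: the same with $\mathcal B^-_r(x)$ in place of $\mathcal B^+_r(x)$. A ray is a sequence $R=x_0x_1\ldots$ of distinct vertices with edges $x_ix_{i+1}$; an anti-ray is such a sequence with edges $x_{i+1}x_i$; in both cases $R(i)=x_i$. A directed path $P$ is a $(\gamma,c)$-quasi-geodesic if $\ell(uPv)\le\gamma d(u,v)+c$ for every directed subpath $uPv$ of $P$; a (anti-)ray is quasi-geodesic if for some $\gamma\ge1,c\ge0$ all its finite directed subpaths are $(\gamma,c)$-quasi-geodesics. For quasi-geodesic rays or anti-rays write $R_1\le R_2$ if there is $M\ge0$ such that for every $r\ge0$ and every $x$ there is a directed path from $R_1$ to $R_2$ of length at most $M$ outside of $\mathcal B^+_r(x)\cup\mathcal B^-_r(x)$; $R_1\approx R_2$ means $R_1\le R_2\le R_1$, an equivalence relation under the hypotheses. The quasi-geodesic boundary $\partial D$ is the set of its classes; $D\cup\partial D$ means $V(D)\cup\partial D$. Let $d^{\leftrightarrow}(x,y)=\min\{d(x,y),d(y,x)\}$ and $d^{\leftrightarrow}(s,P)=\min_{p\text{ on }P}d^{\leftrightarrow}(s,p)$. $S\subseteq V(D)$ is a base if for every vertex $x$ there is $s\in S$ with $d^{\leftrightarrow}(x,s)<\infty$. Let $\varepsilon>0$, $s\in S$, $\eta,\mu\in V(D)\cup\partial D$. If $\eta\in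 V(D)$, let its only representative be the constant map $R(i)=\eta$; if $\eta\in\partial D$, its representatives are its elements. For representatives $R$ of $\eta$ and $Q$ of $\mu$ let $L_s(R,Q)=\liminf_{i,j\to\infty}\{d^{\leftrightarrow}(s,P): P\text{ an }R(i)\text{-}Q(j)\text{ geodesic}\}=\sup_n\inf\{d^{\leftrightarrow}(s,P): i,j\ge n,\ P\text{ an }R(i)\text{-}Q(j)\text{ geodesic}\}$, with $L_s(R,Q)=-\infty$ if for some $n$ there is no such geodesic with $i,j\ge n$. Put $\rho^\varepsilon_s(\eta,\mu)=\inf_{R,Q}e^{-\varepsilon L_s(R,Q)}$ (with $e^{-\infty}=0,e^\infty=\infty$), with $\rho_s^\varepsilon(x,x)=0$ for $x\in V(D)$; $\rho^\varepsilon_S=\max_{s\in S}\rho^\varepsilon_s$; and $$d_{S,\varepsilon}(\eta,\mu)=\inf\Big\{\sum_{i=0}^{n-1}\rho^\varepsilon_S(\eta_i,\eta_{i+1}) : n\in\mathbb N,\ \eta=\eta_0,\ldots,\eta_n=\mu\in V(D)\cup\partial D\Big\}.$$ Under the hypotheses $d_{S,\varepsilon}$ is a pseudo-semimetric, i.e. it vanishes on the diagonal and satisfies the triangle inequality. For a pseudo-semimetric space $(Y,\rho)$, the forward topology is generated by the open out-balls $\{y:\rho(x,y)<r\}$ and the backward topology by the open in-balls $\{y:\rho(y,x)<r\}$; a sequence f-converges (b-converges) to a point if it converges in the forward (backward) topology. $Y$ is sequentially f-compact if every sequence $(x_i)_{i\in\mathbb N}$ with $\rho(x_i,x_j)<\infty$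 for all $i<j$ has a b-convergent subsequence, and sequentially b-compact if every sequence with $\rho(x_j,x_i)<\infty$ for all $i<j$ has an f-convergent subsequence. *)

theory Defs
  imports "HOL-Analysis.Analysis" "Graph_Theory.Graph_Theory"
begin

section \<open>Directed paths and the directed distance\<close>

text \<open>
  Digraphs are \<^locale>\<open>wf_digraph\<close>s: loops, parallel arcs and infinitely many vertices and arcs
  are allowed. A directed path is a sequence of vertices in which consecutive
  vertices are joined by an edge (vertices may repeat), i.e. a \<^const>\<open>vwalk\<close>; its length is
  \<^const>\<open>vwalk_length\<close>.
\<close>

definition dpath :: "('a,'b) pre_digraph \<Rightarrow> 'a \<Rightarrow> 'a list \<Rightarrow> 'a \<Rightarrow> bool" where
  "dpath G x p y \<longleftrightarrow> vwalk p G \<and> hd p = x \<and> last p = y"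

definition ddist :: "('a,'b) pre_digraph \<Rightarrow> 'a \<Rightarrow> 'a \<Rightarrow> ereal" where
  "ddist G x y = (INF p\<in>{p. dpath G x p y}. ereal (real (vwalk_length p)))"

definition geodesic :: "('a,'b) pre_digraph \<Rightarrow> 'a \<Rightarrow> 'a list \<Rightarrow> 'a \<Rightarrow> bool" where
  "geodesic G x p y \<longleftrightarrow> dpath G x p y \<and> ereal (real (vwalk_length p)) = ddist G x y"

text \<open>
  Degrees count neighbours at distance 1, not arcs, so parallel arcs and loops are irrelevant
  (unlike for \<^const>\<open>out_degree\<close> and \<^const>\<open>in_degree\<close>).
\<close>

definition finite_out_degree :: "('a,'b) pre_digraph \<Rightarrow> 'a \<Rightarrow> bool" where
  "finite_out_degree G x \<longleftrightarrow> finite {y \<in> verts G. ddist G x y = 1}"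

definition finite_in_degree :: "('a,'b) pre_digraph \<Rightarrow> 'a \<Rightarrow> bool" where
  "finite_in_degree G x \<longleftrightarrow> finite {y \<in> verts G. ddist G y x = 1}"

definition out_ball :: "('a,'b) pre_digraph \<Rightarrow> real \<Rightarrow> 'a \<Rightarrow> 'a set" where
  "out_ball G r x = {y \<in> verts G. ddist G x y \<le> ereal r}"

definition in_ball :: "('a,'b) pre_digraph \<Rightarrow> real \<Rightarrow> 'a \<Rightarrow> 'a set" where
  "in_ball G r x = {y \<in> verts G. ddist G y x \<le> ereal r}"


section \<open>Hyperbolicity and the conditions (B1), (B2)\<close>

definition geodesic_between :: "('a,'b) pre_digraph \<Rightarrow> 'a \<Rightarrow> 'a list \<Rightarrow> 'a \<Rightarrow> bool" where
  "geodesic_between G x p y \<longleftrightarrow> geodesic G x p y \<or> geodesic G y p x"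

text \<open>The three corners are not required to be distinct.\<close>

definition geodesic_triangle ::
    "('a,'b) pre_digraph \<Rightarrow> 'a list \<Rightarrow> 'a list \<Rightarrow> 'a list \<Rightarrow> bool" where
  "geodesic_triangle G A B C \<longleftrightarrow>
     (\<exists>x\<in>verts G. \<exists>y\<in>verts G. \<exists>z\<in>verts G.
        geodesic_between G x A y \<and> geodesic_between G y B z \<and> geodesic_between G z C x)"

text \<open>Equality of the multisets says that \<open>P, Q, R\<close> is a labelling of the three sides.\<close>

definition thin_triangle ::
    "('a,'b) pre_digraph \<Rightarrow> real \<Rightarrow> 'a list \<Rightarrow> 'a list \<Rightarrow> 'a list \<Rightarrow> bool" where
  "thin_triangle G \<delta> A B C \<longleftrightarrow>
     (\<forall>P Q R. {#P, Q, R#} = {#A, B, C#} \<and> hd P \<in> {hd Q, last Q} \<and> last P \<in> {hd R, last R} \<longrightarrow>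
        set P \<subseteq> (\<Union>q\<in>set Q. out_ball G \<delta> q) \<union> (\<Union>r\<in>set R. in_ball G \<delta> r))"

definition hyperbolic_digraph :: "('a,'b) pre_digraph \<Rightarrow> real \<Rightarrow> bool" where
  "hyperbolic_digraph G \<delta> \<longleftrightarrow>
     (\<forall>A B C. geodesic_triangle G A B C \<longrightarrow> thin_triangle G \<delta> A B C)"

definition cond_B1 :: "('a,'b) pre_digraph \<Rightarrow> (real \<Rightarrow> real) \<Rightarrow> bool" where
  "cond_B1 G f \<longleftrightarrow> (\<forall>x\<in>verts G. \<forall>r\<ge>0. \<forall>y\<in>out_ball G r x. \<forall>z\<in>out_ball G r x.
     ddist G y z = \<infinity> \<or> ddist G y z \<le> ereal (f r))"

definition cond_B2 :: "('a,'b) pre_digraph \<Rightarrow> (real \<Rightarrow> real) \<Rightarrow> bool" where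
  "cond_B2 G f \<longleftrightarrow> (\<forall>x\<in>verts G. \<forall>r\<ge>0. \<forall>y\<in>in_ball G r x. \<forall>z\<in>in_ball G r x.
     ddist G y z = \<infinity> \<or> ddist G y z \<le> ereal (f r))"


section \<open>The quasi-geodesic boundary\<close>

definition ray :: "('a,'b) pre_digraph \<Rightarrow> (nat \<Rightarrow> 'a) \<Rightarrow> bool" where
  "ray G R \<longleftrightarrow> inj R \<and> range R \<subseteq> verts G \<and> (\<forall>i. (R i, R (Suc i)) \<in> arcs_ends G)"

definition anti_ray :: "('a,'b) pre_digraph \<Rightarrow> (nat \<Rightarrow> 'a) \<Rightarrow> bool" where
  "anti_ray G R \<longleftrightarrow> inj R \<and> range R \<subseteq> verts G \<and> (\<forall>i. (R (Suc i), R i) \<in> arcs_ends G)"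

text \<open>The directed subpath of \<open>p\<close> from position \<open>i\<close> to position \<open>j\<close> has length \<open>j - i\<close>.\<close>

definition quasi_geodesic :: "('a,'b) pre_digraph \<Rightarrow> real \<Rightarrow> real \<Rightarrow> 'a list \<Rightarrow> bool" where
  "quasi_geodesic G \<gamma> c p \<longleftrightarrow> vwalk p G \<and>
     (\<forall>i j. i \<le> j \<and> j < length p \<longrightarrow>
        ereal (real (j - i)) \<le> ereal \<gamma> * ddist G (p ! i) (p ! j) + ereal c)"

definition qg_ray :: "('a,'b) pre_digraph \<Rightarrow> (nat \<Rightarrow> 'a) \<Rightarrow> bool" where
  "qg_ray G R \<longleftrightarrow> ray G R \<and>
     (\<exists>\<gamma>\<ge>1. \<exists>c\<ge>0. \<forall>m n. m \<le> n \<longrightarrow> quasi_geodesic G \<gamma> c (map R [m..<Suc n]))"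

definition qg_anti_ray :: "('a,'b) pre_digraph \<Rightarrow> (nat \<Rightarrow> 'a) \<Rightarrow> bool" where
  "qg_anti_ray G R \<longleftrightarrow> anti_ray G R \<and>
     (\<exists>\<gamma>\<ge>1. \<exists>c\<ge>0. \<forall>m n. m \<le> n \<longrightarrow> quasi_geodesic G \<gamma> c (rev (map R [m..<Suc n])))"

definition qg_rays :: "('a,'b) pre_digraph \<Rightarrow> (nat \<Rightarrow> 'a) set" where
  "qg_rays G = {R. qg_ray G R \<or> qg_anti_ray G R}"

definition ray_le :: "('a,'b) pre_digraph \<Rightarrow> (nat \<Rightarrow> 'a) \<Rightarrow> (nat \<Rightarrow> 'a) \<Rightarrow> bool" where
  "ray_le G R1 R2 \<longleftrightarrow> (\<exists>M\<ge>0::real. \<forall>r\<ge>0. \<forall>x\<in>verts G. \<exists>u\<in>range R1. \<exists>v\<in>range R2. \<exists>p.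
     dpath G u p v \<and> real (vwalk_length p) \<le> M \<and> set p \<inter> (out_ball G r x \<union> in_ball G r x) = {})"

definition ray_equiv :: "('a,'b) pre_digraph \<Rightarrow> ((nat \<Rightarrow> 'a) \<times> (nat \<Rightarrow> 'a)) set" where
  "ray_equiv G = {(R1, R2). R1 \<in> qg_rays G \<and> R2 \<in> qg_rays G \<and> ray_le G R1 R2 \<and> ray_le G R2 R1}"

definition qg_boundary :: "('a,'b) pre_digraph \<Rightarrow> (nat \<Rightarrow> 'a) set set" where
  "qg_boundary G = qg_rays G // ray_equiv G"

text \<open>The space \<open>D \<union> \<partial>D\<close>: vertices are tagged \<^const>\<open>Inl\<close>, boundary points \<^const>\<open>Inr\<close>.\<close>

type_synonym 'a bpoint = "'a + (nat \<Rightarrow> 'a) set"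

definition bd_completion :: "('a,'b) pre_digraph \<Rightarrow> 'a bpoint set" where
  "bd_completion G = verts G <+> qg_boundary G"

fun reps :: "'a bpoint \<Rightarrow> (nat \<Rightarrow> 'a) set" where
  "reps (Inl x) = {\<lambda>_. x}"
| "reps (Inr C) = C"


section \<open>The visual pseudo-semimetric\<close>

definition dist_sym :: "('a,'b) pre_digraph \<Rightarrow> 'a \<Rightarrow> 'a \<Rightarrow> ereal" where
  "dist_sym G x y = min (ddist G x y) (ddist G y x)"

definition dist_sym_path :: "('a,'b) pre_digraph \<Rightarrow> 'a \<Rightarrow> 'a list \<Rightarrow> ereal" where
  "dist_sym_path G s P = Min (dist_sym G s ` set P)"

definition is_base :: "('a,'b) pre_digraph \<Rightarrow> 'a set \<Rightarrow> bool" where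
  "is_base G S \<longleftrightarrow> S \<subseteq> verts G \<and> (\<forall>x\<in>verts G. \<exists>s\<in>S. dist_sym G x s < \<infinity>)"

definition tail_geodesics ::
    "('a,'b) pre_digraph \<Rightarrow> (nat \<Rightarrow> 'a) \<Rightarrow> (nat \<Rightarrow> 'a) \<Rightarrow> nat \<Rightarrow> 'a list set" where
  "tail_geodesics G R Q n = {P. \<exists>i\<ge>n. \<exists>j\<ge>n. geodesic G (R i) P (Q j)}"

definition geodesic_liminf ::
    "('a,'b) pre_digraph \<Rightarrow> 'a \<Rightarrow> (nat \<Rightarrow> 'a) \<Rightarrow> (nat \<Rightarrow> 'a) \<Rightarrow> ereal" where
  "geodesic_liminf G s R Q =
     (if \<exists>n. tail_geodesics G R Q n = {} then - \<infinity>
      else (SUP n. INF P\<in>tail_geodesics G R Q n. dist_sym_path G s P))"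

definition ereal_exp :: "ereal \<Rightarrow> ennreal" where
  "ereal_exp a = (if a = \<infinity> then \<infinity> else if a = - \<infinity> then 0 else ennreal (exp (real_of_ereal a)))"

definition rho ::
    "('a,'b) pre_digraph \<Rightarrow> real \<Rightarrow> 'a \<Rightarrow> 'a bpoint \<Rightarrow> 'a bpoint \<Rightarrow> ennreal" where
  "rho G \<epsilon> s \<eta> \<mu> =
     (if \<eta> = \<mu> \<and> \<eta> \<in> Inl ` verts G then 0
      else (INF R\<in>reps \<eta>. INF Q\<in>reps \<mu>. ereal_exp (- (ereal \<epsilon> * geodesic_liminf G s R Q))))"

definition rho_base ::
    "('a,'b) pre_digraph \<Rightarrow> real \<Rightarrow> 'a set \<Rightarrow> 'a bpoint \<Rightarrow> 'a bpoint \<Rightarrow> ennreal" where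
  "rho_base G \<epsilon> S \<eta> \<mu> = Max ((\<lambda>s. rho G \<epsilon> s \<eta> \<mu>) ` S)"

text \<open>Chains with \<open>n = 0\<close> are allowed, so the distance of a point to itself is 0.\<close>

definition visual_dist ::
    "('a,'b) pre_digraph \<Rightarrow> 'a set \<Rightarrow> real \<Rightarrow> 'a bpoint \<Rightarrow> 'a bpoint \<Rightarrow> ennreal" where
  "visual_dist G S \<epsilon> \<eta> \<mu> =
     Inf {\<Sum>i<n. rho_base G \<epsilon> S (h i) (h (Suc i)) | n h.
            h 0 = \<eta> \<and> h n = \<mu> \<and> (\<forall>i\<le>n. h i \<in> bd_completion G)}"


section \<open>Sequential compactness in pseudo-semimetric spaces\<close>

definition forward_topology :: "'p set \<Rightarrow> ('p \<Rightarrow> 'p \<Rightarrow> ennreal) \<Rightarrow> 'p topology" where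
  "forward_topology Y \<rho> =
     topology_generated_by {{y\<in>Y. \<rho> x y < ennreal r} | x r. x \<in> Y \<and> 0 < r}"

definition backward_topology :: "'p set \<Rightarrow> ('p \<Rightarrow> 'p \<Rightarrow> ennreal) \<Rightarrow> 'p topology" where
  "backward_topology Y \<rho> =
     topology_generated_by {{y\<in>Y. \<rho> y x < ennreal r} | x r. x \<in> Y \<and> 0 < r}"

definition seq_f_compact :: "'p set \<Rightarrow> ('p \<Rightarrow> 'p \<Rightarrow> ennreal) \<Rightarrow> bool" where
  "seq_f_compact Y \<rho> \<longleftrightarrow>
     (\<forall>x::nat \<Rightarrow> 'p. range x \<subseteq> Y \<and> (\<forall>i j. i < j \<longrightarrow> \<rho> (x i) (x j) < \<infinity>) \<longrightarrow>
        (\<exists>k l. strict_mono k \<and> limitin (backward_topology Y \<rho>) (x \<circ> k) l sequentially))"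

definition seq_b_compact :: "'p set \<Rightarrow> ('p \<Rightarrow> 'p \<Rightarrow> ennreal) \<Rightarrow> bool" where
  "seq_b_compact Y \<rho> \<longleftrightarrow>
     (\<forall>x::nat \<Rightarrow> 'p. range x \<subseteq> Y \<and> (\<forall>i j. i < j \<longrightarrow> \<rho> (x j) (x i) < \<infinity>) \<longrightarrow>
        (\<exists>k l. strict_mono k \<and> limitin (forward_topology Y \<rho>) (x \<circ> k) l sequentially))"

end

theory Submission
  imports Defs "HOL-Real_Asymp.Real_Asymp"
begin

text \<open>
  Finiteness of the distance between two points \<open>\<eta>\<close> and \<open>\<mu>\<close> of the completion only says something
  about reachability: some, equivalently all, representatives \<open>R\<close> and \<open>Q\<close> are linked, i.e. \<open>R n\<close>
  reaches \<open>Q m\<close> for arbitrarily large \<open>n\<close> and \<open>m\<close> (\<open>visual_dist_finite_imp_linked\<close>). Conversely the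
  visual distance is at most \<^const>\<open>rho_base\<close>, so for convergence to \<open>l\<close> it suffices that the geodesics
  from far members of representatives of the sequence to far members of a representative of \<open>l\<close>
  leave every ball around each base vertex. Reversing all arcs exchanges the two claims, so only
  finite out-degrees have to be considered.

  So let \<open>R i\<close> represent the \<open>i\<close>-th point of the sequence, with \<open>R i\<close> linked to \<open>R j\<close> for \<open>i < j\<close>.

  Suppose first that a vertex \<open>x0\<close> reaches members of all \<open>R j\<close>, and that far members of each \<open>R i\<close>
  reach members of all later \<open>R j\<close>. By finite out-degrees and (B2), only finitely many vertices reached
  from \<open>x0\<close> lie near a given vertex. Koenig's lemma yields a geodesic ray \<open>G\<close> from \<open>x0\<close> whose initial
  segments are shared, for infinitely many \<open>j\<close> and \<open>m\<close>, by geodesics from \<open>x0\<close> to \<open>R j m\<close>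
  (\<open>exists_common_prefix\<close>), unless the sequence has a constant subsequence. The class of \<open>G\<close> is the
  limit: by thin triangles \<open>R j m\<close> reaches \<open>G\<close> (\<open>reaches_limit_ray\<close>), and if a geodesic from \<open>R j m\<close> to
  \<open>G n\<close> came near a base vertex, then a fixed finite set would contain a vertex on a geodesic beyond
  the shared segment (\<open>geodesics_to_limit_far\<close>).

  If that assumption fails, then from some \<open>i\<close> on all representatives are anti-rays, and no single
  member of \<open>R i\<close> reaches all members of a later \<open>R j\<close> (\<open>reaches_tail_or_anti_rays\<close>). In this case
  hyperbolicity forces \<open>R j\<close> to reach back to all members of \<open>R i\<close> (\<open>anti_ray_reached_back\<close>), and the
  geodesics from \<open>R j\<close> to \<open>R i\<close> leave all balls (\<open>anti_ray_pair_geodesics_escape\<close>). Hence the \<open>j\<close>-th point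
  has distance 0 to the \<open>i\<close>-th one, which is the limit.

  Quasi-geodesics are controlled by a weak form of stability: by repeated subdivision, a geodesic
  between two members of a quasi-geodesic anti-ray is reached from a member \<open>R h\<close> within a distance
  logarithmic in \<open>h\<close> (\<open>near_descending_sequence_dyadic\<close>), whereas the distance from \<open>R h\<close> to a fixed
  vertex grows linearly (\<open>qg_anti_ray_diverges\<close>).
\<close>

section \<open>Directed paths and distances\<close>

text \<open>
  Bounds on the distance are kept as a relation with a real radius, so that chains of estimates are
  additions of reals and never involve \<open>\<infinity>\<close>.
\<close>

definition near :: "('a,'b) pre_digraph \<Rightarrow> real \<Rightarrow> 'a \<Rightarrow> 'a \<Rightarrow> bool" where
  "near G r x y \<longleftrightarrow> ddist G x y \<le> ereal r"

definition conn :: "('a,'b) pre_digraph \<Rightarrow> 'a \<Rightarrow> 'a \<Rightarrow> bool" where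
  "conn G x y \<longleftrightarrow> ddist G x y < \<infinity>"

lemma vwalk_arcs_eq_zip: "vwalk_arcs p = zip p (tl p)"
  by (induction p rule: vwalk_arcs.induct) auto

lemma set_vwalk_arcs_nth: "set (vwalk_arcs p) = {(p ! i, p ! Suc i) |i. Suc i < length p}"
  unfolding vwalk_arcs_eq_zip set_zip by (auto simp: nth_tl)

lemma vwalk_iff_nth:
  "vwalk p G \<longleftrightarrow> p \<noteq> [] \<and> set p \<subseteq> verts G \<and>
     (\<forall>i. Suc i < length p \<longrightarrow> (p ! i, p ! Suc i) \<in> arcs_ends G)"
  unfolding vwalk_def set_vwalk_arcs_nth by auto

lemma dpath_subpath:
  assumes "vwalk p G" "i \<le> j" "j < length p"
  shows "dpath G (p ! i) (take (Suc j - i) (drop i p)) (p ! j)"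
proof -
  let ?q = "take (Suc j - i) (drop i p)"
  have len: "length ?q = Suc j - i" using assms by auto
  have ne: "?q \<noteq> []" using assms by auto
  have "hd ?q = p ! i" using ne assms by (simp add: hd_conv_nth)
  moreover have "last ?q = p ! j" using ne assms len by (simp add: last_conv_nth)
  moreover have "vwalk ?q G"
    unfolding vwalk_iff_nth
  proof (intro conjI allI impI)
    show "set ?q \<subseteq> verts G"
      using assms(1) unfolding vwalk_def by (meson in_set_takeD in_set_dropD subset_iff)
    fix k assume "Suc k < length ?q"
    then have k: "Suc (i + k) < length p" "k < Suc j - i" "Suc k < Suc j - i"
      using assms(2,3) len by linarith+
    then have "(p ! (i + k), p ! Suc (i + k)) \<in> arcs_ends G"
      using assms(1) unfolding vwalk_iff_nth by blast
    then show "(?q ! k, ?q ! Suc k) \<in> arcs_ends G"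
      using k assms(2,3) by simp
  qed (rule ne)
  ultimately show ?thesis unfolding dpath_def by (intro conjI)
qed

lemma ddist_le_walk: "dpath G x p y \<Longrightarrow> ddist G x y \<le> ereal (real (length p - 1))"
  unfolding ddist_def by (rule INF_lower2[of p]) auto

lemma ddist_nonneg: "0 \<le> ddist G x y"
  unfolding ddist_def by (rule INF_greatest) auto

lemma geodesic_exists:
  assumes "conn G x y" obtains P where "geodesic G x P y"
proof -
  have "{p. dpath G x p y} \<noteq> {}"
  proof
    assume e: "{p. dpath G x p y} = {}"
    have "ddist G x y = \<infinity>" unfolding ddist_def e by (simp add: top_ereal_def)
    with assms show False unfolding conn_def by simp
  qed
  then obtain p0 where "dpath G x p0 y" by blast
  then obtain p where p: "dpath G x p y" and
    mn: "\<And>q. dpath G x q y \<Longrightarrow> vwalk_length p \<le> vwalk_length q"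
    using ex_has_least_nat[of "\<lambda>p. dpath G x p y" p0 vwalk_length] by blast
  have "ddist G x y = ereal (real (vwalk_length p))"
    unfolding ddist_def
  proof (rule antisym)
    show "(INF p\<in>{p. dpath G x p y}. ereal (real (vwalk_length p))) \<le> ereal (real (vwalk_length p))"
      using p by (intro INF_lower) auto
    show "ereal (real (vwalk_length p)) \<le> (INF p\<in>{p. dpath G x p y}. ereal (real (vwalk_length p)))"
      by (rule INF_greatest) (use mn in auto)
  qed
  with p that show ?thesis unfolding geodesic_def by auto
qed

lemma dpath_append:
  assumes "dpath G x p y" "dpath G y q z"
  shows "dpath G x (p @ tl q) z" "length (p @ tl q) - 1 = (length p - 1) + (length q - 1)"
proof -
  have ne: "p \<noteq> []" "q \<noteq> []" using assms unfolding dpath_def by auto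
  then obtain q' where q: "q = y # q'" using assms(2) unfolding dpath_def by (cases q) auto
  have l: "last p = y" using assms(1) unfolding dpath_def by simp
  show "length (p @ tl q) - 1 = (length p - 1) + (length q - 1)" using ne by (cases p) auto
  have "vwalk (p @ q') G"
    unfolding vwalk_iff_nth
  proof (intro conjI allI impI)
    show "set (p @ q') \<subseteq> verts G" using assms q unfolding dpath_def vwalk_def by auto
    fix i assume i: "Suc i < length (p @ q')"
    consider "Suc i < length p" | "Suc i = length p" | "length p \<le> i" by linarith
    then show "((p @ q') ! i, (p @ q') ! Suc i) \<in> arcs_ends G"
    proof cases
      case 1 then show ?thesis using assms(1) unfolding dpath_def vwalk_iff_nth
        by (auto simp: nth_append)
    next
      case 2
      then have "p ! i = y" using l ne by (metis diff_Suc_1 last_conv_nth)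
      moreover have "(q ! 0, q ! Suc 0) \<in> arcs_ends G"
        using assms(2) i 2 q unfolding dpath_def vwalk_iff_nth by auto
      ultimately show ?thesis using 2 q by (auto simp: nth_append)
    next
      case 3
      then obtain k where k: "i = length p + k" using le_Suc_ex by blast
      then have "(q ! Suc k, q ! Suc (Suc k)) \<in> arcs_ends G"
        using assms(2) i q unfolding dpath_def vwalk_iff_nth by auto
      then show ?thesis using k q by (simp add: nth_append flip: add_Suc_right)
    qed
  qed (use ne in auto)
  then show "dpath G x (p @ tl q) z" using assms l ne q unfolding dpath_def
    by (cases q') auto
qed

lemma ddist_triangle: "ddist G x z \<le> ddist G x y + ddist G y z"
proof (cases "conn G x y \<and> conn G y z")
  case True
  then obtain P Q where P: "geodesic G x P y" and Q: "geodesic G y Q z"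
    by (meson geodesic_exists)
  have d: "dpath G x P y" "dpath G y Q z" using P Q unfolding geodesic_def by auto
  have "ddist G x z \<le> ereal (real (length (P @ tl Q) - 1))"
    by (rule ddist_le_walk[OF dpath_append(1)[OF d]])
  also have "\<dots> = ddist G x y + ddist G y z"
    unfolding dpath_append(2)[OF d] using P Q unfolding geodesic_def
    by (metis of_nat_add plus_ereal.simps(1) vwalk_length_simp)
  finally show ?thesis .
next
  case False
  then show ?thesis using ddist_nonneg[of G x y] ddist_nonneg[of G y z]
    unfolding conn_def by (auto simp: not_less)
qed

lemma near_trans: "near G r x y \<Longrightarrow> near G s y z \<Longrightarrow> near G (r + s) x z"
  unfolding near_def plus_ereal.simps(1)[symmetric]
  by (rule order_trans[OF ddist_triangle add_mono])

lemma near_mono: "near G r x y \<Longrightarrow> r \<le> s \<Longrightarrow> near G s x y"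
  unfolding near_def by (erule order_trans) simp

lemma near_trans_le: "near G r x y \<Longrightarrow> near G s y z \<Longrightarrow> r + s \<le> t \<Longrightarrow> near G t x z"
  by (rule near_mono[OF near_trans])

lemma near_nonneg: "near G r x y \<Longrightarrow> 0 \<le> r"
  unfolding near_def using order_trans[OF ddist_nonneg[of G x y]] by (metis ereal_less_eq(5))

lemma near_conn: "near G r x y \<Longrightarrow> conn G x y"
  unfolding near_def conn_def by (erule le_less_trans) simp

lemma conn_near: assumes "conn G x y" obtains r where "near G r x y" "0 \<le> r"
proof (cases "ddist G x y")
  case (real r)
  then have "near G r x y" unfolding near_def by simp
  then show ?thesis using near_nonneg[of G r x y] that[of r] by simp
qed (use assms ddist_nonneg[of G x y] in \<open>auto simp: conn_def\<close>)

lemma conn_trans: "conn G x y \<Longrightarrow> conn G y z \<Longrightarrow> conn G x z"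
  by (erule conn_near, erule conn_near) (rule near_conn[OF near_trans])

lemma near_refl: "x \<in> verts G \<Longrightarrow> 0 \<le> r \<Longrightarrow> near G r x x"
proof -
  assume "x \<in> verts G" "0 \<le> r"
  then have "dpath G x [x] x" unfolding dpath_def vwalk_iff_nth by auto
  from ddist_le_walk[OF this] have "ddist G x x \<le> 0" by (simp add: zero_ereal_def)
  then show "near G r x x" unfolding near_def by (rule order_trans) (simp add: \<open>0 \<le> r\<close>)
qed

lemma conn_refl: "x \<in> verts G \<Longrightarrow> conn G x x"
  using near_refl near_conn by fastforce

lemma conn_verts: "conn G x y \<Longrightarrow> x \<in> verts G \<and> y \<in> verts G"
proof -
  assume "conn G x y"
  then obtain P where "geodesic G x P y" by (rule geodesic_exists)
  then show ?thesis unfolding geodesic_def dpath_def vwalk_def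
    by (metis hd_in_set last_in_set subset_iff)
qed

lemma near_edge: "(x, y) \<in> arcs_ends G \<Longrightarrow> x \<in> verts G \<Longrightarrow> y \<in> verts G \<Longrightarrow> near G 1 x y"
proof -
  assume "(x, y) \<in> arcs_ends G" "x \<in> verts G" "y \<in> verts G"
  then have "dpath G x [x,y] y" unfolding dpath_def vwalk_def by auto
  from ddist_le_walk[OF this] show ?thesis unfolding near_def by simp
qed

lemma geodesic_basic:
  assumes "geodesic G x P y"
  shows "P \<noteq> []" "0 < length P" "P ! 0 = x" "P ! (length P - 1) = y" "set P \<subseteq> verts G"
    "vwalk P G" "x \<in> set P" "y \<in> set P" "hd P = x" "last P = y"
proof -
  have v: "vwalk P G" and h: "hd P = x" and l: "last P = y"
    using assms unfolding geodesic_def dpath_def by blast+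
  then have ne: "P \<noteq> []" unfolding vwalk_def by blast
  show "P \<noteq> []" "hd P = x" "last P = y" "vwalk P G" by fact+
  show "0 < length P" using ne by simp
  show "P ! 0 = x" using hd_conv_nth[OF ne] h by simp
  show "P ! (length P - 1) = y" using last_conv_nth[OF ne] l by simp
  show "set P \<subseteq> verts G" using v unfolding vwalk_def by blast
  show "x \<in> set P" using hd_in_set[OF ne] h by simp
  show "y \<in> set P" using last_in_set[OF ne] l by simp
qed

lemma ddist_subwalk:
  assumes "vwalk p G" "i \<le> j" "j < length p"
  shows "near G (real j - real i) (p ! i) (p ! j)"
proof -
  have "length (take (Suc j - i) (drop i p)) - 1 = j - i" using assms by auto
  with ddist_le_walk[OF dpath_subpath[OF assms]] show ?thesis
    unfolding near_def using assms by (simp add: of_nat_diff)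
qed

lemma geodesic_near:
  assumes "geodesic G x P y" "i \<le> j" "j < length P"
  shows "near G (real j - real i) (P ! i) (P ! j)"
  by (rule ddist_subwalk[OF geodesic_basic(6)[OF assms(1)] assms(2,3)])

lemma geodesic_minimal:
  assumes P: "geodesic G x P y" and ij: "i \<le> j" "j < length P" and w: "near G r (P ! i) (P ! j)"
  shows "real j - real i \<le> r"
proof -
  have a: "near G (real i) x (P ! i)"
    using geodesic_near[OF P, of 0 i] ij geodesic_basic(3)[OF P] by simp
  have b: "near G (real (length P - 1) - real j) (P ! j) y"
    using geodesic_near[OF P, of j "length P - 1"] ij geodesic_basic(4)[OF P] by simp
  have "near G (real i + r + (real (length P - 1) - real j)) x y"
    by (rule near_trans[OF near_trans[OF a w] b])
  moreover have "ddist G x y = ereal (real (length P - 1))"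
    using P unfolding geodesic_def by simp
  ultimately have "real (length P - 1) \<le> real i + r + (real (length P - 1) - real j)"
    unfolding near_def by simp
  then show ?thesis by simp
qed

lemma geodesic_conn: "geodesic G x P y \<Longrightarrow> i \<le> j \<Longrightarrow> j < length P \<Longrightarrow> conn G (P ! i) (P ! j)"
  by (rule near_conn[OF geodesic_near])

lemma geodesic_subpath:
  assumes P: "geodesic G x P y" and ij: "i \<le> j" "j < length P"
  shows "geodesic G (P ! i) (take (Suc j - i) (drop i P)) (P ! j)"
proof -
  let ?Q = "take (Suc j - i) (drop i P)"
  have d: "dpath G (P ! i) ?Q (P ! j)" by (rule dpath_subpath[OF geodesic_basic(6)[OF P] ij])
  have len: "length ?Q - 1 = j - i" using ij by auto
  obtain r where r: "ddist G (P ! i) (P ! j) = ereal r"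
  proof -
    have "conn G (P ! i) (P ! j)" using geodesic_conn[OF P ij] .
    then show ?thesis using that ddist_nonneg[of G "P ! i" "P ! j"] unfolding conn_def
      by (cases "ddist G (P ! i) (P ! j)") auto
  qed
  then have "real j - real i \<le> r" using geodesic_minimal[OF P ij] unfolding near_def by simp
  moreover have "r \<le> real j - real i" using geodesic_near[OF P ij] r unfolding near_def by simp
  ultimately show ?thesis using d r len ij unfolding geodesic_def by (simp add: of_nat_diff)
qed

lemma geodesic_drop:
  assumes P: "geodesic G x P y" and i: "i < length P"
  shows "geodesic G (P ! i) (drop i P) y"
  using geodesic_subpath[OF P, of i "length P - 1"] i geodesic_basic(4)[OF P] by simp

lemma geodesic_imp_conn: "geodesic G x P y \<Longrightarrow> conn G x y"
  using geodesic_conn[of G x P y 0 "length P - 1"] geodesic_basic[of G x P y] by simp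

lemma geodesic_mem:
  assumes P: "geodesic G x P y" and w: "w \<in> set P"
  shows "conn G x w" "conn G w y" "w \<in> verts G"
proof -
  obtain i where i: "i < length P" "w = P ! i" using w by (metis in_set_conv_nth)
  show "conn G x w" "conn G w y"
    using i geodesic_conn[OF P, of 0 i] geodesic_conn[OF P, of i "length P - 1"]
      geodesic_basic[OF P] by auto
  from conn_verts[OF this(1)] show "w \<in> verts G" by (rule conjunct2)
qed

lemma geodesic_mem_near:
  assumes P: "geodesic G x P y" and w: "w \<in> set P" and r: "near G r x y"
  shows "near G r x w" "near G r w y"
proof -
  obtain i where i: "i < length P" "w = P ! i" using w by (metis in_set_conv_nth)
  have len: "real (length P - 1) \<le> r"
    using geodesic_minimal[OF P, of 0 "length P - 1" r] geodesic_basic(2-4)[OF P] r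
    by (simp add: of_nat_diff Suc_leI)
  have a: "near G (real i) x w"
    using i geodesic_near[OF P, of 0 i] geodesic_basic(3)[OF P] by simp
  have b: "near G (real (length P - 1) - real i) w y"
    using i geodesic_near[OF P, of i "length P - 1"] geodesic_basic(4)[OF P] by simp
  have "real i \<le> real (length P - 1)" using i by linarith
  then show "near G r x w" by (intro near_mono[OF a] order_trans[OF _ len])
  show "near G r w y" by (rule near_mono[OF b]) (use len in linarith)
qed

lemma geodesic_length_le:
  "geodesic G x P y \<Longrightarrow> near G r x y \<Longrightarrow> real (length P) \<le> r + 1"
  using geodesic_minimal[of G x P y 0 "length P - 1" r] geodesic_basic(2-4)[of G x P y]
  by (simp add: of_nat_diff Suc_leI)

lemma geodesic_length_near:
  "geodesic G x P y \<Longrightarrow> near G (real (length P) - 1) x y"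
  using geodesic_near[of G x P y 0 "length P - 1"] geodesic_basic(2-4)[of G x P y]
  by (simp add: of_nat_diff Suc_leI)

section \<open>Thin triangles\<close>

locale thin_digraph = wf_digraph D for D :: "('a,'b) pre_digraph" +
  fixes \<delta> :: real and f :: "real \<Rightarrow> real"
  assumes delta_nonneg: "0 \<le> \<delta>"
    and hyperbolic: "hyperbolic_digraph D \<delta>"
    and B1: "cond_B1 D f" and B2: "cond_B2 D f"
begin

lemma geodesic_betweenI1: "geodesic D x P y \<Longrightarrow> geodesic_between D x P y"
  and geodesic_betweenI2: "geodesic D y P x \<Longrightarrow> geodesic_between D x P y"
  unfolding geodesic_between_def by blast+

lemma thin_triangle_point:
  assumes P: "geodesic D x P y" and Q: "geodesic_between D x Q z"
    and R: "geodesic_between D y R z" and p: "p \<in> set P"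
  shows "(\<exists>q\<in>set Q. near D \<delta> q p) \<or> (\<exists>r\<in>set R. near D \<delta> p r)"
proof -
  have v: "x \<in> verts D" "y \<in> verts D" using conn_verts[OF geodesic_imp_conn[OF P]] by blast+
  have z: "z \<in> verts D"
    using Q conn_verts geodesic_imp_conn unfolding geodesic_between_def by metis
  have tri: "geodesic_triangle D P R Q"
    unfolding geodesic_triangle_def
    by (rule bexI[OF _ v(1)], rule bexI[OF _ v(2)], rule bexI[OF _ z])
       (use P Q R in \<open>auto simp: geodesic_between_def\<close>)
  then have th: "thin_triangle D \<delta> P R Q" using hyperbolic unfolding hyperbolic_digraph_def by blast
  have "hd P \<in> {hd Q, last Q}" "last P \<in> {hd R, last R}"
    using geodesic_basic(9,10)[OF P] Q R geodesic_basic(9,10) unfolding geodesic_between_def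
    by (metis insert_iff)+
  moreover have "{#P, Q, R#} = {#P, R, Q#}" by (simp add: add_mset_commute)
  ultimately have "set P \<subseteq> (\<Union>q\<in>set Q. out_ball D \<delta> q) \<union> (\<Union>r\<in>set R. in_ball D \<delta> r)"
    using th unfolding thin_triangle_def by blast
  with p show ?thesis by (auto simp: out_ball_def in_ball_def near_def)
qed

lemma near_of_common_source: assumes "near D r x y" "near D r x z" "conn D y z" shows "near D (f r) y z"
proof -
  have v: "x \<in> verts D" "y \<in> verts D" "z \<in> verts D"
    using conn_verts[OF near_conn[OF assms(1)]] conn_verts[OF assms(3)] by blast+
  have "ddist D y z = \<infinity> \<or> ddist D y z \<le> ereal (f r)"
    using B1 v assms(1,2) near_nonneg[OF assms(1)] unfolding cond_B1_def out_ball_def near_def by blast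
  then show ?thesis using assms(3) unfolding conn_def near_def by auto
qed

lemma near_of_common_target: assumes "near D r y x" "near D r z x" "conn D y z" shows "near D (f r) y z"
proof -
  have v: "x \<in> verts D" "y \<in> verts D" "z \<in> verts D"
    using conn_verts[OF near_conn[OF assms(1)]] conn_verts[OF assms(3)] by blast+
  have "ddist D y z = \<infinity> \<or> ddist D y z \<le> ereal (f r)"
    using B2 v assms(1,2) near_nonneg[OF assms(1)] unfolding cond_B2_def in_ball_def near_def by blast
  then show ?thesis using assms(3) unfolding conn_def near_def by auto
qed

text \<open>
  Walking along the side \<open>P\<close>, the points within \<open>\<delta>\<close> after \<open>Q\<close> include the first one. At the last such
  point before position \<open>k\<close> the next vertex must be controlled by the third side. This turns the
  two one-sided alternatives of a thin triangle into a single vertex near both other sides, which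
  moreover comes before the given one.
\<close>

lemma last_point_near:
  assumes P: "geodesic D x P y" and Q: "geodesic_between D x Q z"
    and R: "geodesic_between D y R z" and k: "k < length P"
  obtains i q where "i \<le> k" "q \<in> set Q" "near D \<delta> q (P ! i)"
    "i = k \<or> (\<exists>r\<in>set R. near D (\<delta> + 1) (P ! i) r)"
proof -
  let ?A = "{i. i \<le> k \<and> (\<exists>q\<in>set Q. near D \<delta> q (P ! i))}"
  have x: "x \<in> set Q" using Q geodesic_basic(7,8) unfolding geodesic_between_def by metis
  have "near D \<delta> x (P ! 0)"
    using near_refl[OF conjunct1[OF conn_verts[OF geodesic_imp_conn[OF P]]] delta_nonneg]
      geodesic_basic(3)[OF P] by simp
  then have "0 \<in> ?A" using x by auto
  moreover have fin: "finite ?A" by simp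
  ultimately have m: "Max ?A \<in> ?A" using Max_in by blast
  define i where "i = Max ?A"
  from m obtain q where q: "i \<le> k" "q \<in> set Q" "near D \<delta> q (P ! i)" unfolding i_def by auto
  have "i = k \<or> (\<exists>r\<in>set R. near D (\<delta> + 1) (P ! i) r)"
  proof (cases "i = k")
    case False
    then have ik: "Suc i \<le> k" "Suc i < length P" using q(1) k by linarith+
    have nA: "Suc i \<notin> ?A" using Max_ge[OF fin, of "Suc i"] unfolding i_def by linarith
    have "P ! Suc i \<in> set P" using ik by simp
    from thin_triangle_point[OF P Q R this] have "\<exists>r\<in>set R. near D \<delta> (P ! Suc i) r"
      using nA ik by auto
    then obtain r where r: "r \<in> set R" "near D \<delta> (P ! Suc i) r" by blast
    have "near D 1 (P ! i) (P ! Suc i)" using geodesic_near[OF P, of i "Suc i"] ik by simp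
    from near_trans_le[OF this r(2)] have "near D (\<delta> + 1) (P ! i) r" by simp
    with r(1) show ?thesis by blast
  qed simp
  with q show ?thesis by (rule that)
qed

text \<open>
  Besides \<open>\<delta>\<close> the constant contains \<open>f (\<delta> + 1)\<close>: this is how far apart two points of a geodesic can be
  that are reached within \<open>\<delta>\<close> from two consecutive vertices of another side.
\<close>

definition \<kappa> :: real where "\<kappa> = 4 * \<delta> + 2 + max 0 (f (\<delta> + 1))"

lemma kappa_bounds: "3 * \<delta> + 1 \<le> \<kappa>" "4 * \<delta> + 2 \<le> \<kappa>" "\<delta> + f (\<delta> + 1) \<le> \<kappa>" "\<delta> \<le> \<kappa>" "0 \<le> \<kappa>"
  using delta_nonneg unfolding \<kappa>_def by auto

text \<open>
  Thinness only says that a point of \<open>P\<close> is reached from \<open>Q\<close> or reaches \<open>R\<close>; here both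
  alternatives take the first form. Let \<open>s\<close> be the last \<open>Q\<close>-controlled point before \<open>p\<close>; it lies
  near a vertex \<open>r\<close> of \<open>R\<close>. In the triangle of \<open>s\<close>, \<open>r\<close> and the end of \<open>P\<close>, the vertices of \<open>R\<close> after
  \<open>r\<close> that are not close to \<open>s\<close> reach points of \<open>P\<close>, the last of them the end of \<open>P\<close>. So, unless \<open>p\<close> is
  close to \<open>s\<close>, two consecutive vertices of \<open>R\<close> reach \<open>P\<close> before and after \<open>p\<close>, and (B1) bounds the gap. A one-directional statement can be
  iterated, which the alternative cannot.
\<close>

lemma side_reached_from_other_sides:
  assumes P: "geodesic D x P y" and Q: "geodesic D x Q z" and R: "geodesic D z R y" and p: "p \<in> set P"
  obtains q where "q \<in> set Q \<union> set R" "near D \<kappa> q p"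
proof -
  note goal = that
  obtain k where k: "k < length P" "p = P ! k" using p by (metis in_set_conv_nth)
  obtain i q where i: "i \<le> k" "q \<in> set Q" "near D \<delta> q (P ! i)"
    "i = k \<or> (\<exists>r\<in>set R. near D (\<delta> + 1) (P ! i) r)"
    using last_point_near[OF P geodesic_betweenI1[OF Q] geodesic_betweenI2[OF R] k(1)] by blast
  define s where "s = P ! i"
  have il: "i < length P" using i k by simp
  \<comment> \<open>A geodesic point at most \<open>t\<close> steps after the last \<open>Q\<close>-controlled point is still controlled by \<open>Q\<close>.\<close>
  have close: ?thesis if "real k - real i \<le> t" "t + \<delta> \<le> \<kappa>" for t
  proof -
    have "near D (real k - real i) (P ! i) p" using geodesic_near[OF P i(1) k(1)] k by simp
    from near_trans_le[OF i(3) this] that(1,2) have "near D \<kappa> q p" by simp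
    then show ?thesis using goal[of q] i(2) by simp
  qed
  show ?thesis
  proof (cases "i = k")
    case True then show ?thesis using close[of 0] kappa_bounds by simp
  next
    case False
    with i(4) obtain r where r: "r \<in> set R" "near D (\<delta> + 1) s r" unfolding s_def by blast
    then obtain j0 where j0: "j0 < length R" "r = R ! j0" by (metis in_set_conv_nth)
    obtain T where T: "geodesic D s T r" using geodesic_exists[OF near_conn[OF r(2)]] .
    have R': "geodesic D r (drop j0 R) y" using geodesic_drop[OF R j0(1)] j0(2) by simp
    have P': "geodesic D s (drop i P) y" using geodesic_drop[OF P il] unfolding s_def .
    \<comment> \<open>\<open>?E j\<close>: the \<open>j\<close>-th vertex of \<open>R\<close> reaches \<open>P\<close> at or after \<open>p\<close>.\<close>
    let ?E = "\<lambda>j. j0 \<le> j \<and> j < length R \<and> (\<exists>l. k \<le> l \<and> l < length P \<and> near D \<delta> (R ! j) (P ! l))"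
    have "?E (length R - 1)"
    proof (intro conjI exI)
      show "near D \<delta> (R ! (length R - 1)) (P ! (length P - 1))"
        using geodesic_basic(4)[OF P] geodesic_basic(4)[OF R]
          near_refl[OF conjunct2[OF conn_verts[OF geodesic_imp_conn[OF P]]] delta_nonneg] by simp
    qed (use j0 k in auto)
    define j where "j = (LEAST j. ?E j)"
    have Ej: "?E j" unfolding j_def by (rule LeastI) fact
    have nE: "\<not> ?E j'" if "j' < j" for j' using not_less_Least that unfolding j_def by blast
    from Ej obtain l where l: "k \<le> l" "l < length P" "near D \<delta> (R ! j) (P ! l)" by blast
    have il': "i \<le> l" using i l by simp
    show ?thesis
    proof (cases "j = j0")
      case True
      have "near D \<delta> r (P ! l)" using l(3) j0 True by simp
      from near_trans[OF r(2) this] have "near D ((\<delta> + 1) + \<delta>) s (P ! l)" .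
      then have "real l - real i \<le> 2 * \<delta> + 1"
        using geodesic_minimal[OF P il' l(2)] unfolding s_def by fastforce
      then show ?thesis using close[of "2 * \<delta> + 1"] l(1) kappa_bounds by simp
    next
      case False
      define j' where "j' = j - 1"
      have j': "j0 \<le> j'" "j' < j" "j = Suc j'" "j' < length R" using False Ej unfolding j'_def by auto
      have step: "near D 1 (R ! j') (R ! j)" using geodesic_near[OF R, of j' j] j' Ej by simp
      have "R ! j' = drop j0 R ! (j' - j0)" "j' - j0 < length (drop j0 R)" using j' by auto
      then have "R ! j' \<in> set (drop j0 R)" by (metis nth_mem)
      from thin_triangle_point[OF R' geodesic_betweenI2[OF T] geodesic_betweenI2[OF P'] this]
      consider (left) t where "t \<in> set T" "near D \<delta> t (R ! j')"
        | (right) u where "u \<in> set (drop i P)" "near D \<delta> (R ! j') u" by blast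
      then show ?thesis
      proof cases
        case (left t)
        have "near D (\<delta> + 1) s t" using geodesic_mem_near(1)[OF T left(1) r(2)] .
        from near_trans[OF near_trans[OF near_trans[OF this left(2)] step] l(3)]
        have "near D (\<delta> + 1 + \<delta> + 1 + \<delta>) (P ! i) (P ! l)" by (simp only: s_def)
        from geodesic_minimal[OF P il' l(2) this] show ?thesis
          using close[of "3 * \<delta> + 2"] l(1) kappa_bounds by simp
      next
        case (right u)
        then obtain m where m: "m < length P" "u = P ! m" "i \<le> m"
          by (auto simp: in_set_conv_nth) (metis add.commute le_add1 less_diff_conv)
        have "\<not> k \<le> m" using nE[OF j'(2)] j' m(1) right(2)[unfolded m(2)] by blast
        then have "m < k" by simp
        have "near D (\<delta> + 1) (R ! j') (P ! m)" using near_mono[OF right(2)] m(2) by simp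
        moreover have "near D (\<delta> + 1) (R ! j') (P ! l)" using near_trans[OF step l(3)] by (simp add: add.commute)
        moreover have "conn D (P ! m) (P ! l)" using geodesic_conn[OF P _ l(2)] \<open>m < k\<close> l(1) by simp
        ultimately have "near D (f (\<delta> + 1)) (P ! m) (P ! l)" by (rule near_of_common_source)
        then have "real l - real m \<le> f (\<delta> + 1)"
          using geodesic_minimal[OF P _ l(2)] \<open>m < k\<close> l(1) by simp
        moreover have "near D (real k - real m) (P ! m) p" using geodesic_near[OF P _ k(1)] \<open>m < k\<close> k by simp
        moreover have "near D \<delta> (R ! j') (P ! m)" using right(2) m(2) by simp
        ultimately have "near D \<kappa> (R ! j') p"
          using near_trans_le[of D \<delta> "R ! j'" "P ! m" "real k - real m" p \<kappa>] l(1) kappa_bounds(3) by simp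
        moreover have "R ! j' \<in> set R" using j'(4) by simp
        ultimately show ?thesis using goal[of "R ! j'"] by simp
      qed
    qed
  qed
qed

text \<open>
  A substitute for the missing reverse triangle inequality: the constant depends on \<open>z\<close> and \<open>s\<close>
  only, not on \<open>y\<close>. The side from \<open>y\<close> to \<open>z\<close> follows the side to \<open>s\<close> up to a vertex near \<open>s\<close>, and by
  (B2) this vertex has bounded distance to \<open>z\<close>.
\<close>

lemma detour_bounded:
  assumes zs: "near D K z s"
  shows "\<exists>C. \<forall>y r. near D r y s \<longrightarrow> conn D y z \<longrightarrow> near D (r + C) y z"
proof -
  define C where "C = \<delta> + max 0 (f (\<delta> + 1 + K))"
  have main: "near D (r + C) y z" if ys: "near D r y s" and yz: "conn D y z" for y r
  proof -
  have K: "0 \<le> K" using near_nonneg[OF zs] .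
  obtain P where P: "geodesic D y P z" using geodesic_exists[OF yz] .
  obtain Q where Q: "geodesic D y Q s" using geodesic_exists[OF near_conn[OF ys]] .
  obtain R where R: "geodesic D z R s" using geodesic_exists[OF near_conn[OF zs]] .
  have len: "length P - 1 < length P" using geodesic_basic(2)[OF P] by simp
  obtain i q where i: "i \<le> length P - 1" "q \<in> set Q" "near D \<delta> q (P ! i)"
    "i = length P - 1 \<or> (\<exists>r\<in>set R. near D (\<delta> + 1) (P ! i) r)"
    using last_point_near[OF P geodesic_betweenI1[OF Q] geodesic_betweenI1[OF R] len] .
  have yi: "near D (r + \<delta>) y (P ! i)" by (rule near_trans[OF geodesic_mem_near(1)[OF Q i(2) ys] i(3)])
  from i(4) show "near D (r + C) y z"
  proof
    assume "i = length P - 1"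
    then show ?thesis using near_mono[OF yi, of "r + C"] geodesic_basic(4)[OF P] unfolding C_def by simp
  next
    assume "\<exists>r\<in>set R. near D (\<delta> + 1) (P ! i) r"
    then obtain u where u: "u \<in> set R" "near D (\<delta> + 1) (P ! i) u" by blast
    have "near D (\<delta> + 1 + K) (P ! i) s" by (rule near_trans[OF u(2) geodesic_mem_near(2)[OF R u(1) zs]])
    moreover have "near D (\<delta> + 1 + K) z s" by (rule near_mono[OF zs]) (use delta_nonneg in simp)
    moreover have "conn D (P ! i) z"
      using geodesic_conn[OF P i(1) len] geodesic_basic(4)[OF P] by simp
    ultimately have "near D (f (\<delta> + 1 + K)) (P ! i) z" by (rule near_of_common_target)
    from near_trans_le[OF yi this] show ?thesis unfolding C_def by simp
  qed
  qed
  show ?thesis by (intro exI[of _ C] allI impI main)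
qed

end

section \<open>Geodesics between points of a quasi-geodesic anti-ray\<close>

lemma eventually_log_less_linear:
  fixes \<alpha> \<beta> :: real
  assumes "0 \<le> \<alpha>"
  shows "\<exists>M::nat. \<forall>h n. M \<le> h \<longrightarrow> 2 ^ n \<le> h \<longrightarrow> \<alpha> * real n + \<beta> < real h"
proof -
  have "filterlim (\<lambda>x::real. x - \<alpha> * log 2 x) at_top at_top" by real_asymp
  then have "eventually (\<lambda>x::real. \<beta> < x - \<alpha> * log 2 x) at_top"
    by (rule filterlim_at_top_dense[THEN iffD1, rule_format])
  then obtain X where X: "\<And>x::real. X \<le> x \<Longrightarrow> \<beta> < x - \<alpha> * log 2 x"
    unfolding eventually_at_top_linorder by blast
  show ?thesis
  proof (intro exI[of _ "max 1 (nat \<lceil>X\<rceil>)"] allI impI)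
    fix h n :: nat assume h: "max 1 (nat \<lceil>X\<rceil>) \<le> h" and n: "2 ^ n \<le> h"
    have "X \<le> real h" using h by linarith
    from X[OF this] have "\<alpha> * log 2 (real h) + \<beta> < real h" by simp
    moreover have "real n \<le> log 2 (real h)" using n h
      by (metis le_log_of_power of_nat_le_iff of_nat_numeral of_nat_power one_less_numeral_iff semiring_norm(76))
    ultimately show "\<alpha> * real n + \<beta> < real h"
      using mult_left_mono[OF _ assms, of "real n" "log 2 (real h)"] by linarith
  qed
qed

lemma qg_anti_rayD:
  assumes "qg_anti_ray D R"
  shows "R i \<in> verts D" "near D 1 (R (Suc i)) (R i)" "inj R"
  using assms near_edge[of "R (Suc i)" "R i" D] unfolding qg_anti_ray_def anti_ray_def by auto

lemma qg_anti_ray_conn: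
  assumes "qg_anti_ray D R" "i \<le> j" shows "conn D (R j) (R i)"
  using assms(2)
proof (induction j rule: dec_induct)
  case base show ?case by (rule conn_refl[OF qg_anti_rayD(1)[OF assms(1)]])
next
  case (step j)
  show ?case by (rule conn_trans[OF near_conn[OF qg_anti_rayD(2)[OF assms(1)]] step.IH])
qed

lemma quasi_geodesic_ends:
  assumes "quasi_geodesic D \<gamma> c p" "near D r (p ! 0) (p ! (length p - 1))" "1 \<le> \<gamma>"
  shows "real (length p - 1) \<le> \<gamma> * r + c"
proof -
  have "length p - 1 < length p" using assms(1) unfolding quasi_geodesic_def vwalk_def by simp
  then have "ereal (real (length p - 1)) \<le> ereal \<gamma> * ddist D (p ! 0) (p ! (length p - 1)) + ereal c"
    using assms(1) unfolding quasi_geodesic_def by (metis le0 diff_zero)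
  also have "\<dots> \<le> ereal \<gamma> * ereal r + ereal c"
    using assms(2,3) unfolding near_def by (intro add_right_mono ereal_mult_left_mono) auto
  finally show ?thesis by simp
qed

lemma qg_anti_ray_linear:
  assumes "qg_anti_ray D R"
  shows "\<exists>\<gamma> c. 1 \<le> \<gamma> \<and> 0 \<le> c \<and>
    (\<forall>i j r. i \<le> j \<longrightarrow> near D r (R j) (R i) \<longrightarrow> real j - real i \<le> \<gamma> * r + c)"
proof -
  obtain \<gamma> c where g: "1 \<le> \<gamma>" "0 \<le> c"
    and q: "\<And>m n. m \<le> n \<Longrightarrow> quasi_geodesic D \<gamma> c (rev (map R [m..<Suc n]))"
    using assms unfolding qg_anti_ray_def by blast
  have "real j - real i \<le> \<gamma> * r + c" if "i \<le> j" "near D r (R j) (R i)" for i j r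
  proof -
    let ?p = "rev (map R [i..<Suc j])"
    have l: "length ?p = Suc j - i" by (simp del: upt_Suc)
    have "?p ! 0 = R j" using that(1) by (simp add: rev_nth del: upt_Suc)
    moreover have "?p ! (length ?p - 1) = R i" using that(1) by (simp add: rev_nth del: upt_Suc)
    ultimately have "real (length ?p - 1) \<le> \<gamma> * r + c"
      using quasi_geodesic_ends[OF q[OF that(1)], of r] that(2) g(1) by simp
    then show ?thesis using l that(1) by (simp add: of_nat_diff)
  qed
  with g show ?thesis by (intro exI[of _ \<gamma>] exI[of _ c] conjI allI impI)
qed

context thin_digraph
begin

text \<open>
  Bisecting the sequence \<open>n\<close> times costs \<open>\<kappa>\<close> each time, so the distance is logarithmic in the length.
\<close>

lemma near_descending_sequence_balanced:
  assumes R: "\<And>i. near D 1 (R (Suc i)) (R i)"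
    and "a \<le> b" "b - a \<le> 2 ^ n" "geodesic D (R b) W (R a)" "w \<in> set W"
  shows "\<exists>h. a \<le> h \<and> h \<le> b \<and> near D (\<kappa> * real n + 1) (R h) w"
  using assms(2-)
proof (induction n arbitrary: a b W w)
  case 0
  have "near D 1 (R b) (R a)"
  proof (cases "a = b")
    case True
    then show ?thesis using near_refl[OF conjunct1[OF conn_verts[OF geodesic_imp_conn[OF 0(3)]]]] by simp
  next
    case False
    then have "b = Suc a" using 0 by simp
    then show ?thesis using R by simp
  qed
  from geodesic_mem_near(1)[OF 0(3,4) this] show ?case using 0(1) by auto
next
  case (Suc n)
  have conn: "conn D (R j) (R i)" if "i \<le> j" "a \<le> i" for i j
    using that(1)
  proof (induction j rule: dec_induct)
    case base show ?case using conn_verts[OF near_conn[OF R[of i]]] conn_refl by auto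
  next
    case (step j)
    show ?case by (rule conn_trans[OF near_conn[OF R] step.IH])
  qed
  show ?case
  proof (cases "b - a \<le> 2 ^ n")
    case True
    from Suc.IH[OF Suc(2) True Suc(4,5)] obtain h where
      h: "a \<le> h" "h \<le> b" "near D (\<kappa> * real n + 1) (R h) w" by blast
    from near_mono[OF h(3)] have "near D (\<kappa> * real (Suc n) + 1) (R h) w"
      using kappa_bounds(5) by (simp add: algebra_simps)
    with h show ?thesis by blast
  next
    case False
    define m where "m = a + 2 ^ n"
    have m: "a \<le> m" "m \<le> b" "m - a \<le> 2 ^ n" "b - m \<le> 2 ^ n" using False Suc(3) unfolding m_def by auto
    obtain Q where Q: "geodesic D (R b) Q (R m)" using geodesic_exists[OF conn[OF m(2,1)]] .
    obtain T where T: "geodesic D (R m) T (R a)" using geodesic_exists[OF conn[OF m(1) order_refl]] .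
    obtain q where q: "q \<in> set Q \<union> set T" "near D \<kappa> q w" using side_reached_from_other_sides[OF Suc(4) Q T Suc(5)] .
    have "\<exists>h. a \<le> h \<and> h \<le> b \<and> near D (\<kappa> * real n + 1) (R h) q"
      using q(1) Suc.IH[OF m(2,4) Q] Suc.IH[OF m(1,3) T] m(1,2) order_trans by (metis UnE)
    then obtain h where h: "a \<le> h" "h \<le> b" "near D (\<kappa> * real n + 1) (R h) q" by blast
    from near_trans_le[OF h(3) q(2)] have "near D (\<kappa> * real (Suc n) + 1) (R h) w" by (simp add: algebra_simps)
    with h show ?thesis by blast
  qed
qed

text \<open>
  The bound has to be logarithmic in the index \<open>h\<close> of the point found, not in the length of the
  whole segment. Hence the pieces between consecutive powers of two are split off starting with
  the lowest one; inside a piece the sequence is bisected.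
\<close>

lemma near_descending_sequence_dyadic:
  assumes R: "\<And>i. near D 1 (R (Suc i)) (R i)"
    and "2 ^ p \<le> a" "a \<le> b" "geodesic D (R b) W (R a)" "w \<in> set W"
  shows "\<exists>h n. a \<le> h \<and> p \<le> n \<and> 2 ^ n \<le> h \<and> near D (\<kappa> * (2 * real n - real p + 1) + 1) (R h) w"
  using assms(2-)
proof (induction "b - 2 ^ p" arbitrary: a b p W w rule: less_induct)
  case less
  have conn: "conn D (R j) (R i)" if "i \<le> j" for i j
    using that
  proof (induction j rule: dec_induct)
    case base show ?case using conn_verts[OF near_conn[OF R[of i]]] conn_refl by auto
  next
    case (step j)
    show ?case by (rule conn_trans[OF near_conn[OF R] step.IH])
  qed
  show ?case
  proof (cases "2 ^ Suc p \<le> b")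
    case False
    then have "b - a \<le> 2 ^ p" using less(2,3) by simp
    from near_descending_sequence_balanced[OF R less(3) this less(4,5)] obtain h where
      h: "a \<le> h" "near D (\<kappa> * real p + 1) (R h) w" by blast
    have "near D (\<kappa> * (2 * real p - real p + 1) + 1) (R h) w"
      by (rule near_mono[OF h(2)]) (use kappa_bounds(5) in \<open>simp add: algebra_simps\<close>)
    moreover have "2 ^ p \<le> h" using less(2) h(1) by simp
    ultimately show ?thesis using h(1) by blast
  next
    case True
    have dec: "b - 2 ^ Suc p < b - 2 ^ p" using True power_strict_increasing[of p "Suc p" "2::nat"] by linarith
    have shift: "near D (\<kappa> * (2 * real n - real p + 1) + 1) (R h) w"
      if "near D (\<kappa> * (2 * real n - real (Suc p) + 1) + 1) (R h) q" "near D \<kappa> q w" for h n q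
      using near_trans_le[OF that] by (simp add: algebra_simps)
    show ?thesis
    proof (cases "2 ^ Suc p \<le> a")
      case True
      from less(1)[OF dec True less(3,4,5)] obtain h n where
        h: "a \<le> h" "Suc p \<le> n" "2 ^ n \<le> h" "near D (\<kappa> * (2 * real n - real (Suc p) + 1) + 1) (R h) w" by blast
      from h(4) have "near D (\<kappa> * (2 * real n - real p + 1) + 1) (R h) w"
        by (rule near_mono) (use kappa_bounds(5) in \<open>simp add: algebra_simps\<close>)
      with h show ?thesis by (meson Suc_leD)
    next
      case False
      define m :: nat where "m = 2 ^ Suc p"
      have m: "a \<le> m" "m \<le> b" "m - a \<le> 2 ^ p" using False True less(2) unfolding m_def by auto
      obtain Q where Q: "geodesic D (R b) Q (R m)" using geodesic_exists[OF conn[OF m(2)]] .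
      obtain T where T: "geodesic D (R m) T (R a)" using geodesic_exists[OF conn[OF m(1)]] .
      obtain q where q: "q \<in> set Q \<union> set T" "near D \<kappa> q w" using side_reached_from_other_sides[OF less(4) Q T less(5)] .
      from q(1) show ?thesis
      proof
        assume "q \<in> set Q"
        from less(1)[OF dec _ m(2) Q this] obtain h n where
          h: "m \<le> h" "Suc p \<le> n" "2 ^ n \<le> h" "near D (\<kappa> * (2 * real n - real (Suc p) + 1) + 1) (R h) q"
          unfolding m_def by blast
        from shift[OF h(4) q(2)] show ?thesis using h(1-3) m(1) by (meson Suc_leD order_trans)
      next
        assume "q \<in> set T"
        from near_descending_sequence_balanced[OF R m(1,3) T this] obtain h where
          h: "a \<le> h" "near D (\<kappa> * real p + 1) (R h) q" by blast
        have "near D (\<kappa> * (2 * real p - real p + 1) + 1) (R h) w"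
          using near_trans_le[OF h(2) q(2)] by (simp add: algebra_simps)
        moreover have "2 ^ p \<le> h" using less(2) h(1) by simp
        ultimately show ?thesis using h(1) by blast
      qed
    qed
  qed
qed

text \<open>
  Used for \<open>2 ^ n \<le> h\<close>, where it is at most logarithmic in the index \<open>h\<close>.
\<close>

definition log_bound :: "nat \<Rightarrow> real" where
  "log_bound n = \<kappa> * (2 * real n + 1) + 1"

lemma near_qg_anti_ray:
  assumes R: "qg_anti_ray D R" and "1 \<le> a" "a \<le> b" "geodesic D (R b) W (R a)" "w \<in> set W"
  obtains h n where "a \<le> h" "2 ^ n \<le> h" "near D (log_bound n) (R h) w"
  using near_descending_sequence_dyadic[of R 0 a b W w, OF qg_anti_rayD(2)[OF R]] assms(2-)
  unfolding log_bound_def by auto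

text \<open>
  The distance from \<open>R h\<close> to the fixed vertex \<open>R h0\<close> is at least linear in \<open>h\<close> since \<open>R\<close> is
  quasi-geodesic; replacing \<open>R h0\<close> by another vertex \<open>v\<close> reached from it changes this only by a
  constant.
\<close>

lemma qg_anti_ray_diverges:
  assumes R: "qg_anti_ray D R"
  shows "\<exists>M. \<forall>h n. M \<le> h \<longrightarrow> 2 ^ n \<le> h \<longrightarrow> \<not> near D (log_bound n + C) (R h) v"
proof (cases "\<exists>h. conn D (R h) v")
  case False
  then have "\<not> near D r (R h) v" for r h using near_conn[of D r "R h" v] by auto
  then show ?thesis by simp
next
  case True
  then obtain h0 where "conn D (R h0) v" by blast
  then obtain K where K: "near D K (R h0) v" by (rule conn_near)
  obtain C' where C': "\<forall>y r. near D r y v \<longrightarrow> conn D y (R h0) \<longrightarrow> near D (r + C') y (R h0)"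
    using detour_bounded[OF K] ..
  obtain \<gamma> c where g: "1 \<le> \<gamma>" "0 \<le> c"
    and lin: "\<forall>i j r. i \<le> j \<longrightarrow> near D r (R j) (R i) \<longrightarrow> real j - real i \<le> \<gamma> * r + c"
    using qg_anti_ray_linear[OF R] by (elim exE conjE) (rule that)
  have "0 \<le> \<gamma> * (2 * \<kappa>)" using g(1) kappa_bounds(5) by simp
  from eventually_log_less_linear[OF this, of "\<gamma> * (\<kappa> + 1 + C + C') + c + real h0"]
  obtain M0 where M0: "\<forall>h n :: nat. M0 \<le> h \<longrightarrow> 2 ^ n \<le> h \<longrightarrow>
      \<gamma> * (2 * \<kappa>) * real n + (\<gamma> * (\<kappa> + 1 + C + C') + c + real h0) < real h" ..
  show ?thesis
  proof (intro exI[of _ "max M0 h0"] allI impI)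
    fix h n assume h: "max M0 h0 \<le> h" and n: "2 ^ n \<le> h"
    show "\<not> near D (log_bound n + C) (R h) v"
    proof
      assume "near D (log_bound n + C) (R h) v"
      from C'[rule_format, OF this qg_anti_ray_conn[OF R]]
      have "near D (log_bound n + C + C') (R h) (R h0)" using h by simp
      from lin[rule_format, OF _ this] have "real h \<le> \<gamma> * (log_bound n + C + C') + c + real h0" using h by simp
      with M0[rule_format, OF _ n] h show False unfolding log_bound_def by (simp add: algebra_simps)
    qed
  qed
qed

text \<open>
  A weak substitute for the stability of quasi-geodesics. Such a geodesic is reached from \<open>R\<close> within
  logarithmic distance, while \<open>R\<close> leaves every vertex linearly.
\<close>

lemma anti_ray_geodesics_escape:
  assumes R: "qg_anti_ray D R"
  shows "\<exists>M. \<forall>m n W w. M \<le> m \<longrightarrow> m \<le> n \<longrightarrow> geodesic D (R n) W (R m) \<longrightarrow> w \<in> set W \<longrightarrow> \<not> near D C w v"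
proof -
  obtain M where M: "\<forall>h n. M \<le> h \<longrightarrow> 2 ^ n \<le> h \<longrightarrow> \<not> near D (log_bound n + C) (R h) v"
    using qg_anti_ray_diverges[OF R] ..
  show ?thesis
  proof (intro exI[of _ "max 1 M"] allI impI notI)
    fix m n W w assume a: "max 1 M \<le> m" "m \<le> n" "geodesic D (R n) W (R m)" "w \<in> set W" "near D C w v"
    obtain h k where h: "m \<le> h" "2 ^ k \<le> h" "near D (log_bound k) (R h) w"
      using near_qg_anti_ray[OF R _ a(2-4)] a(1) by auto
    have "M \<le> h" using h(1) a(1) by simp
    from M[rule_format, OF this h(2)] near_trans[OF h(3) a(5)] show False by (rule notE)
  qed
qed

text \<open>
  In-balls may be infinite, so a bounded distance from \<open>a\<close> to \<open>v\<close> leaves infinitely many candidates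
  for \<open>a\<close>. Still one vertex \<open>R H\<close> reaches all those that can be reached from \<open>R\<close> at all: going
  back from \<open>a\<close> along geodesics from \<open>R n\<close> leads to a geodesic between members of \<open>R\<close>, still at bounded
  distance from \<open>v\<close>, and this point is reached from a member of \<open>R\<close> whose index is bounded since \<open>R\<close> diverges
  from \<open>v\<close>.
\<close>

lemma anti_ray_reaches_near_points:
  assumes R: "qg_anti_ray D R"
  shows "\<exists>H. \<forall>a n. conn D (R n) a \<longrightarrow> near D C a v \<longrightarrow> conn D (R H) a"
proof (cases "\<exists>n. conn D (R n) v")
  case False
  have "\<not> near D C a v" if "conn D (R n) a" for a n
  proof
    assume "near D C a v"
    from conn_trans[OF that near_conn[OF this]] False show False by simp
  qed
  then show ?thesis by auto
next
  case True
  then obtain n1 where "conn D (R n1) v" by blast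
  then have "conn D (R (Suc n1)) v" using conn_trans[OF qg_anti_ray_conn[OF R, of n1 "Suc n1"]] by simp
  then obtain K where K: "near D K (R (Suc n1)) v" by (rule conn_near)
  have K0: "0 \<le> K" using near_nonneg[OF K] .
  define C' where "C' = 3 * \<delta> + 2 + C + K"
  obtain M where M: "\<forall>h n. M \<le> h \<longrightarrow> 2 ^ n \<le> h \<longrightarrow> \<not> near D (log_bound n + C') (R h) v"
    using qg_anti_ray_diverges[OF R] ..
  show ?thesis
  proof (intro exI[of _ "max M (Suc n1)"] allI impI)
    fix a n assume na: "conn D (R n) a" and av: "near D C a v"
    have C0: "0 \<le> C" using near_nonneg[OF av] .
    have "\<exists>h \<le> max M (Suc n1). conn D (R h) a"
    proof (cases "n \<le> Suc n1")
      case True then show ?thesis using na by (meson max.coboundedI2)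
    next
      case False
      define z where "z = R (Suc n1)"
      have Rz: "conn D (R n) z" unfolding z_def using qg_anti_ray_conn[OF R] False by simp
      obtain P where P: "geodesic D (R n) P a" using geodesic_exists[OF na] .
      obtain Q where Q: "geodesic D (R n) Q v" using geodesic_exists[OF conn_trans[OF na near_conn[OF av]]] .
      obtain T where T: "geodesic D a T v" using geodesic_exists[OF near_conn[OF av]] .
      obtain G where G: "geodesic D (R n) G z" using geodesic_exists[OF Rz] .
      obtain B where B: "geodesic D z B v" using geodesic_exists[OF near_conn[OF K]] unfolding z_def .
      \<comment> \<open>From \<open>a\<close> step back to a point \<open>q\<close> on the geodesic to \<open>v\<close> ...\<close>
      obtain q where q: "q \<in> set Q" "conn D q a" "near D (2 * \<delta> + 1 + C) q v"
      proof -
        have l: "length P - 1 < length P" using geodesic_basic(2)[OF P] by simp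
        obtain i q where i: "i \<le> length P - 1" "q \<in> set Q" "near D \<delta> q (P ! i)"
          "i = length P - 1 \<or> (\<exists>r\<in>set T. near D (\<delta> + 1) (P ! i) r)"
          using last_point_near[OF P geodesic_betweenI1[OF Q] geodesic_betweenI1[OF T] l] .
        have "conn D (P ! i) a" using geodesic_conn[OF P i(1) l] geodesic_basic(4)[OF P] by simp
        then have c: "conn D q a" by (rule conn_trans[OF near_conn[OF i(3)]])
        from i(4) have "near D (\<delta> + 1 + C) (P ! i) v"
        proof
          assume "i = length P - 1"
          then show ?thesis using near_mono[OF av, of "\<delta> + 1 + C"] geodesic_basic(4)[OF P] delta_nonneg by simp
        next
          assume "\<exists>r\<in>set T. near D (\<delta> + 1) (P ! i) r"
          then obtain r where r: "r \<in> set T" "near D (\<delta> + 1) (P ! i) r" by blast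
          show ?thesis by (rule near_trans[OF r(2) geodesic_mem_near(2)[OF T r(1) av]])
        qed
        from near_trans_le[OF i(3) this] have "near D (2 * \<delta> + 1 + C) q v" by simp
        with i(2) c show ?thesis by (rule that)
      qed
      \<comment> \<open>... and from \<open>q\<close> to a point \<open>e\<close> on a geodesic between points of \<open>R\<close>.\<close>
      obtain e where e: "e \<in> set G" "conn D e q" "near D C' e v"
      proof -
        obtain k where k: "k < length Q" "q = Q ! k" using q(1) by (metis in_set_conv_nth)
        obtain i e where i: "i \<le> k" "e \<in> set G" "near D \<delta> e (Q ! i)"
          "i = k \<or> (\<exists>r\<in>set B. near D (\<delta> + 1) (Q ! i) r)"
          using last_point_near[OF Q geodesic_betweenI1[OF G] geodesic_betweenI2[OF B] k(1)] .
        have "conn D (Q ! i) q" using geodesic_conn[OF Q i(1) k(1)] k(2) by simp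
        then have c: "conn D e q" by (rule conn_trans[OF near_conn[OF i(3)]])
        from i(4) have "near D (2 * \<delta> + 1 + C + K) (Q ! i) v"
        proof
          assume "i = k"
          then show ?thesis using near_mono[OF q(3), of "2 * \<delta> + 1 + C + K"] k(2) K0 by simp
        next
          assume "\<exists>r\<in>set B. near D (\<delta> + 1) (Q ! i) r"
          then obtain r where r: "r \<in> set B" "near D (\<delta> + 1) (Q ! i) r" by blast
          have "near D K r v" by (rule geodesic_mem_near(2)[OF B r(1)]) (use K in \<open>simp add: z_def\<close>)
          from near_trans_le[OF r(2) this] show ?thesis using C0 delta_nonneg by simp
        qed
        from near_trans_le[OF i(3) this] have "near D C' e v" unfolding C'_def by simp
        with i(2) c show ?thesis by (rule that)
      qed
      have 1: "1 \<le> Suc n1" "Suc n1 \<le> n" using False by auto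
      obtain h k where h: "Suc n1 \<le> h" "2 ^ k \<le> h" "near D (log_bound k) (R h) e"
        using near_qg_anti_ray[OF R 1 G[unfolded z_def] e(1)] .
      have "\<not> M \<le> h" using M[rule_format, OF _ h(2)] near_trans[OF h(3) e(3)] by auto
      moreover have "conn D (R h) a"
        by (rule conn_trans[OF near_conn[OF h(3)] conn_trans[OF e(2) q(2)]])
      ultimately show ?thesis by (meson max.coboundedI1 nat_le_linear)
    qed
    then obtain h where h: "h \<le> max M (Suc n1)" "conn D (R h) a" by blast
    show "conn D (R (max M (Suc n1))) a" by (rule conn_trans[OF qg_anti_ray_conn[OF R h(1)] h(2)])
  qed
qed

end

section \<open>Pairs of anti-rays\<close>

context thin_digraph
begin

text \<open>
  If no vertex of \<open>R0\<close> reaches all of \<open>R1\<close>, then a geodesic \<open>A\<close> from \<open>R0 n\<close> to \<open>R1 m\<close> with \<open>m\<close> large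
  stays far from \<open>R1 0\<close>, by \<open>anti_ray_reaches_near_points\<close>. So in the triangle with corners \<open>R0 n\<close>, \<open>R1 m\<close>,
  \<open>R1 0\<close> the geodesics from \<open>R0 n\<close> and from \<open>R1 m\<close> to \<open>R1 0\<close> come close to each other far from
  \<open>R1 0\<close>, and from there one can cross over from the side of \<open>R1\<close> to the side of \<open>R0\<close>.
\<close>

lemma anti_ray_reached_back:
  assumes R0: "qg_anti_ray D R0" and R1: "qg_anti_ray D R1"
    and link: "\<And>N m. \<exists>n\<ge>N. conn D (R0 n) (R1 m)"
    and no: "\<And>h. \<exists>m. \<not> conn D (R0 h) (R1 m)"
  shows "\<exists>m. conn D (R1 m) (R0 N)"
proof -
  define o' where "o' = R1 0"
  obtain N' where N': "N' \<ge> N" "conn D (R0 N') o'" using link[of N 0] unfolding o'_def by blast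
  define z where "z = R0 N'"
  obtain K where K: "near D K z o'" using N'(2) unfolding z_def by (rule conn_near)
  have K0: "0 \<le> K" using near_nonneg[OF K] .
  \<comment> \<open>\<open>t\<close> is a number of steps that overtakes every point within \<open>4\<delta> + 2\<close> of the start, up to \<open>\<delta>\<close>;
     \<open>C2\<close> and \<open>C\<close> are so large that all points considered below are still far from \<open>o'\<close>.\<close>
  define t where "t = nat \<lceil>5 * \<delta> + 3\<rceil>"
  have t: "5 * \<delta> + 3 \<le> real t" unfolding t_def by linarith
  define C2 where "C2 = real t + \<delta> + K + 3 * \<delta> + 1"
  define C where "C = 2 * \<delta> + K + max 0 (f C2)"
  have C2: "\<delta> \<le> C2" "3 * \<delta> + 1 \<le> C2" "real t + K \<le> C2" "real t + (\<delta> + K) \<le> C2"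
    using K0 delta_nonneg unfolding C2_def by auto
  have C: "\<delta> \<le> C" "\<delta> + K + \<delta> \<le> C" "\<delta> + f C2 \<le> C" using K0 delta_nonneg unfolding C_def by auto
  obtain H where H: "\<forall>a n. conn D (R0 n) a \<longrightarrow> near D C a o' \<longrightarrow> conn D (R0 H) a"
    using anti_ray_reaches_near_points[OF R0] ..
  obtain m where m: "\<not> conn D (R0 H) (R1 m)" using no by blast
  obtain n where n: "n \<ge> N'" "conn D (R0 n) (R1 m)" using link by blast
  have xz: "conn D (R0 n) z" unfolding z_def by (rule qg_anti_ray_conn[OF R0 n(1)])
  obtain P where P: "geodesic D (R0 n) P o'" using geodesic_exists[OF conn_trans[OF xz near_conn[OF K]]] .
  obtain A where A: "geodesic D (R0 n) A (R1 m)" using geodesic_exists[OF n(2)] .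
  obtain S where S: "geodesic D (R1 m) S o'"
    using geodesic_exists[OF qg_anti_ray_conn[OF R1, of 0 m]] unfolding o'_def by auto
  obtain G where G: "geodesic D (R0 n) G z" using geodesic_exists[OF xz] .
  obtain B where B: "geodesic D z B o'" using geodesic_exists[OF near_conn[OF K]] .
  have far: "\<not> near D C a o'" if "a \<in> set A" for a
  proof
    assume "near D C a o'"
    with H geodesic_mem(1)[OF A that] have "conn D (R0 H) a" by blast
    from conn_trans[OF this geodesic_mem(2)[OF A that]] m show False by simp
  qed
  have len: "length P - 1 < length P" using geodesic_basic(2)[OF P] by simp
  obtain i a where i: "i \<le> length P - 1" "a \<in> set A" "near D \<delta> a (P ! i)"
    "i = length P - 1 \<or> (\<exists>g\<in>set S. near D (\<delta> + 1) (P ! i) g)"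
    using last_point_near[OF P geodesic_betweenI1[OF A] geodesic_betweenI2[OF S] len] .
  define p where "p = P ! i"
  have p: "p \<in> set P" using i(1) len unfolding p_def by simp
  have pfar: "\<not> near D r p o'" if "\<delta> + r \<le> C" for r
    using far[OF i(2)] near_trans_le[OF i(3)] that unfolding p_def by blast
  have "i \<noteq> length P - 1"
  proof
    assume "i = length P - 1"
    then have "near D \<delta> a o'" using i(3) geodesic_basic(4)[OF P] by simp
    from near_mono[OF this C(1)] far[OF i(2)] show False by simp
  qed
  with i(4) obtain g where g: "g \<in> set S" "near D (\<delta> + 1) p g" unfolding p_def by blast
  obtain e where e: "e \<in> set G" "near D \<delta> e p"
  proof -
    from thin_triangle_point[OF P geodesic_betweenI1[OF G] geodesic_betweenI2[OF B] p] show ?thesis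
    proof (elim disjE bexE)
      fix r assume r: "r \<in> set B" "near D \<delta> p r"
      have "near D (\<delta> + K) p o'" by (rule near_trans[OF r(2) geodesic_mem_near(2)[OF B r(1) K]])
      then show ?thesis using pfar[of "\<delta> + K"] C(2) by simp
    qed (rule that)
  qed
  have eg: "near D (2 * \<delta> + 1) e g" using near_trans[OF e(2) g(2)] by (simp add: add.commute)
  have eo: "conn D e o'" by (rule conn_trans[OF near_conn[OF e(2)] geodesic_mem(2)[OF P p]])
  have efar: "\<not> near D r e o'" if "r \<le> C2" for r
  proof
    assume "near D r e o'"
    from near_of_common_source[OF near_mono[OF e(2) C2(1)] near_mono[OF this that] geodesic_mem(2)[OF P p]]
    show False using pfar[of "f C2"] C(3) by simp
  qed
  have ez: "conn D e z" by (rule geodesic_mem(2)[OF G e(1)])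
  have go: "conn D g o'" by (rule geodesic_mem(2)[OF S g(1)])
  obtain V where V: "geodesic D e V o'" using geodesic_exists[OF eo] .
  obtain G' where G': "geodesic D e G' z" using geodesic_exists[OF ez] .
  obtain S' where S': "geodesic D g S' o'" using geodesic_exists[OF go] .
  obtain T where T: "geodesic D e T g" using geodesic_exists[OF near_conn[OF eg]] .
  \<comment> \<open>Cross over from the geodesic through \<open>g\<close> to the geodesic \<open>V\<close>, soon after \<open>e\<close>; then \<open>V\<close> reaches
     the \<open>t\<close>-th vertex of \<open>G'\<close> at a later position.\<close>
  obtain l where l: "l < length V" "real l \<le> 4 * \<delta> + 2" "conn D g (V ! l)"
  proof -
    have len': "length S' - 1 < length S'" using geodesic_basic(2)[OF S'] by simp
    obtain j u where j: "j \<le> length S' - 1" "u \<in> set T" "near D \<delta> u (S' ! j)"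
      "j = length S' - 1 \<or> (\<exists>v\<in>set V. near D (\<delta> + 1) (S' ! j) v)"
      using last_point_near[OF S' geodesic_betweenI2[OF T] geodesic_betweenI2[OF V] len'] .
    have ej: "near D (3 * \<delta> + 1) e (S' ! j)"
      using near_trans_le[OF geodesic_mem_near(1)[OF T j(2) eg] j(3)] by simp
    have "j \<noteq> length S' - 1"
      using ej efar[OF C2(2)] geodesic_basic(4)[OF S'] by auto
    with j(4) obtain v where v: "v \<in> set V" "near D (\<delta> + 1) (S' ! j) v" by blast
    obtain l where l: "l < length V" "v = V ! l" using v(1) by (metis in_set_conv_nth)
    have "near D (4 * \<delta> + 2) (V ! 0) (V ! l)"
      using near_trans_le[OF ej v(2)] l(2) geodesic_basic(3)[OF V] by simp
    from geodesic_minimal[OF V _ l(1) this] have "real l \<le> 4 * \<delta> + 2" by simp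
    moreover have "conn D g (S' ! j)"
      using geodesic_conn[OF S', of 0 j] j(1) len' geodesic_basic(3)[OF S'] by simp
    ultimately show ?thesis using that[OF l(1)] conn_trans[OF _ near_conn[OF v(2)]] l(2) by simp
  qed
  have tl: "t < length G'"
  proof (rule ccontr)
    assume "\<not> t < length G'"
    then have "near D (real t) e z"
      using near_mono[OF geodesic_length_near[OF G'], of "real t"] by simp
    from near_trans[OF this K] efar[OF C2(3)] show False by simp
  qed
  have et: "near D (real t) e (G' ! t)"
    using geodesic_near[OF G', of 0 t] tl geodesic_basic(3)[OF G'] by simp
  have "G' ! t \<in> set G'" using tl by simp
  from thin_triangle_point[OF G' geodesic_betweenI1[OF V] geodesic_betweenI1[OF B] this]
  have "conn D (V ! l) (G' ! t)"
  proof (elim disjE bexE)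
    fix r assume r: "r \<in> set B" "near D \<delta> (G' ! t) r"
    have "near D (real t + (\<delta> + K)) e o'"
      by (rule near_trans[OF et near_trans[OF r(2) geodesic_mem_near(2)[OF B r(1) K]]])
    with efar[OF C2(4)] show ?thesis by simp
  next
    fix v assume v: "v \<in> set V" "near D \<delta> v (G' ! t)"
    obtain l' where l': "l' < length V" "v = V ! l'" using v(1) by (metis in_set_conv_nth)
    have "near D (real l') e (V ! l')"
      using geodesic_near[OF V, of 0 l'] l'(1) geodesic_basic(3)[OF V] by simp
    from near_trans[OF this] v(2) l'(2) have "near D (real l' + \<delta>) (G' ! 0) (G' ! t)"
      using geodesic_basic(3)[OF G'] by simp
    from geodesic_minimal[OF G' _ tl this] have "real t \<le> real l' + \<delta>" by simp
    then have "l \<le> l'" using l(2) t by linarith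
    from conn_trans[OF geodesic_conn[OF V this l'(1)]] near_conn[OF v(2)] l'(2) show ?thesis by simp
  qed
  then have "conn D g (G' ! t)" by (rule conn_trans[OF l(3)])
  from conn_trans[OF this geodesic_mem(2)[OF G' \<open>G' ! t \<in> set G'\<close>]] have "conn D g z" .
  from conn_trans[OF geodesic_mem(1)[OF S g(1)] this] have "conn D (R1 m) z" .
  from conn_trans[OF this] have "conn D (R1 m) (R0 N)"
    using qg_anti_ray_conn[OF R0 N'(1)] unfolding z_def by simp
  then show ?thesis ..
qed

text \<open>
  Compare with a geodesic from a point \<open>R0 n'\<close> further out. A point near \<open>v\<close> on the geodesic from
  \<open>R1 n\<close> to \<open>R0 m\<close> would be close to a geodesic between points of \<open>R0\<close>, which escape, or to one from
  \<open>R0 n'\<close> to \<open>R1 n\<close>; in the latter case a fixed vertex of \<open>R0\<close> would reach \<open>R1 n\<close>.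
\<close>

lemma anti_ray_pair_geodesics_escape:
  assumes R0: "qg_anti_ray D R0" and R1: "qg_anti_ray D R1"
    and link: "\<And>N m. \<exists>n\<ge>N. conn D (R0 n) (R1 m)"
    and no: "\<And>h. \<exists>m. \<not> conn D (R0 h) (R1 m)"
  shows "\<exists>M. \<forall>n m W w. M \<le> n \<longrightarrow> M \<le> m \<longrightarrow> geodesic D (R1 n) W (R0 m) \<longrightarrow> w \<in> set W \<longrightarrow> \<not> near D C w v"
proof (cases "\<exists>n. conn D (R1 n) v")
  case False
  have "\<not> near D C w v" if "geodesic D (R1 n) W (R0 m)" "w \<in> set W" for n m W w
  proof
    assume "near D C w v"
    from conn_trans[OF geodesic_mem(1)[OF that] near_conn[OF this]] False show False by blast
  qed
  then show ?thesis by blast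
next
  case True
  then obtain n1 where n1: "conn D (R1 n1) v" by blast
  obtain n2 where n2: "conn D (R0 n2) (R1 n1)" using link by blast
  obtain H where H: "\<forall>a n. conn D (R0 n) a \<longrightarrow> near D (\<delta> + C) a v \<longrightarrow> conn D (R0 H) a"
    using anti_ray_reaches_near_points[OF R0] ..
  obtain mH where mH: "\<not> conn D (R0 H) (R1 mH)" using no by blast
  obtain M1 where M1: "\<forall>m n W w. M1 \<le> m \<longrightarrow> m \<le> n \<longrightarrow> geodesic D (R0 n) W (R0 m) \<longrightarrow> w \<in> set W \<longrightarrow>
      \<not> near D (f (max \<delta> C)) w v"
    using anti_ray_geodesics_escape[OF R0] ..
  show ?thesis
  proof (intro exI[of _ "max n2 (max mH M1)"] allI impI notI)
    fix n m W w
    assume nm: "max n2 (max mH M1) \<le> n" "max n2 (max mH M1) \<le> m"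
      and W: "geodesic D (R1 n) W (R0 m)" and w: "w \<in> set W" and wv: "near D C w v"
    have C0: "0 \<le> C" using near_nonneg[OF wv] .
    obtain n' where n': "n' \<ge> m" "conn D (R0 n') (R1 n)" using link by blast
    obtain A where A: "geodesic D (R0 n') A (R1 n)" using geodesic_exists[OF n'(2)] .
    obtain G where G: "geodesic D (R0 n') G (R0 m)" using geodesic_exists[OF qg_anti_ray_conn[OF R0 n'(1)]] .
    from thin_triangle_point[OF W geodesic_betweenI2[OF A] geodesic_betweenI2[OF G] w] show False
    proof (elim disjE bexE)
      fix a assume a: "a \<in> set A" "near D \<delta> a w"
      have "conn D (R0 H) a"
        using H geodesic_mem(1)[OF A a(1)] near_trans[OF a(2) wv] by blast
      from conn_trans[OF this geodesic_mem(2)[OF A a(1)]] have "conn D (R0 H) (R1 n)" .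
      from conn_trans[OF this qg_anti_ray_conn[OF R1]] mH nm(1) show False by simp
    next
      fix g assume g: "g \<in> set G" "near D \<delta> w g"
      have "conn D (R0 m) v"
        using conn_trans[OF qg_anti_ray_conn[OF R0, of n2 m] conn_trans[OF n2 n1]] nm(2) by simp
      from conn_trans[OF geodesic_mem(2)[OF G g(1)] this] have gv: "conn D g v" .
      have "near D (f (max \<delta> C)) g v"
        by (rule near_of_common_source[OF near_mono[OF g(2)] near_mono[OF wv] gv]) auto
      moreover have "\<not> near D (f (max \<delta> C)) g v"
        using M1[rule_format, OF _ n'(1) G g(1)] nm(2) by simp
      ultimately show False by simp
    qed
  qed
qed

end

section \<open>Reversal of a digraph\<close>

text \<open>
  Reversing all arcs exchanges out- and in-degrees, (B1) and (B2), rays and anti-rays, and the two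
  arguments of every distance. Hyperbolicity is preserved because thinness is required for all
  labellings: the roles of \<open>Q\<close> and \<open>R\<close> are swapped.
\<close>

definition reversal :: "('a,'b) pre_digraph \<Rightarrow> ('a,'b) pre_digraph" where
  "reversal G = \<lparr>verts = verts G, arcs = arcs G, tail = head G, head = tail G\<rparr>"

lemma verts_reversal [simp]: "verts (reversal G) = verts G"
  unfolding reversal_def by simp

lemma reversal_reversal [simp]: "reversal (reversal G) = G"
  unfolding reversal_def by simp

lemma arcs_ends_reversal: "(x, y) \<in> arcs_ends (reversal G) \<longleftrightarrow> (y, x) \<in> arcs_ends G"
  unfolding arcs_ends_conv reversal_def by auto

lemma wf_digraph_reversal: "wf_digraph G \<Longrightarrow> wf_digraph (reversal G)"
  unfolding wf_digraph_def reversal_def by simp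

lemma vwalk_reversal_imp: "vwalk p G \<Longrightarrow> vwalk (rev p) (reversal G)"
  unfolding vwalk_iff_nth
proof (elim conjE, intro conjI allI impI)
  fix i assume p: "\<forall>i. Suc i < length p \<longrightarrow> (p ! i, p ! Suc i) \<in> arcs_ends G" and i: "Suc i < length (rev p)"
  define j where "j = length p - Suc (Suc i)"
  have j: "Suc j < length p" "Suc j = length p - Suc i" using i unfolding j_def by auto
  with p have "(p ! j, p ! Suc j) \<in> arcs_ends G" by blast
  moreover have "rev p ! i = p ! Suc j" "rev p ! Suc i = p ! j"
    using i j(2) by (simp_all add: rev_nth j_def)
  ultimately show "(rev p ! i, rev p ! Suc i) \<in> arcs_ends (reversal G)"
    unfolding arcs_ends_reversal by simp
qed auto

lemma vwalk_reversal: "vwalk p (reversal G) \<longleftrightarrow> vwalk (rev p) G"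
  using vwalk_reversal_imp[of p "reversal G"] vwalk_reversal_imp[of "rev p" G] by auto

lemma dpath_reversal: "dpath (reversal G) x p y \<longleftrightarrow> dpath G y (rev p) x"
  unfolding dpath_def vwalk_reversal by (auto simp: hd_rev last_rev)

lemma ddist_reversal: "ddist (reversal G) x y = ddist G y x"
proof -
  have "{p. dpath (reversal G) x p y} = rev ` {p. dpath G y p x}"
    unfolding dpath_reversal by (auto simp: image_iff) (metis rev_rev_ident)
  then show ?thesis unfolding ddist_def by (simp add: image_comp)
qed

lemma geodesic_reversal: "geodesic (reversal G) x p y \<longleftrightarrow> geodesic G y (rev p) x"
  unfolding geodesic_def dpath_reversal ddist_reversal by simp

lemma near_reversal: "near (reversal G) r x y \<longleftrightarrow> near G r y x"
  unfolding near_def ddist_reversal ..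

lemma conn_reversal: "conn (reversal G) x y \<longleftrightarrow> conn G y x"
  unfolding conn_def ddist_reversal ..

lemma out_ball_reversal: "out_ball (reversal G) r x = in_ball G r x"
  and in_ball_reversal: "in_ball (reversal G) r x = out_ball G r x"
  unfolding out_ball_def in_ball_def ddist_reversal by simp_all

lemma finite_out_degree_reversal: "finite_out_degree (reversal G) x \<longleftrightarrow> finite_in_degree G x"
  unfolding finite_out_degree_def finite_in_degree_def ddist_reversal by simp

lemma cond_B1_reversal: "cond_B1 (reversal G) f \<longleftrightarrow> cond_B2 G f"
  and cond_B2_reversal: "cond_B2 (reversal G) f \<longleftrightarrow> cond_B1 G f"
  unfolding cond_B1_def cond_B2_def out_ball_reversal in_ball_reversal ddist_reversal by auto

lemma geodesic_between_reversal:
  "geodesic_between (reversal G) x p y \<longleftrightarrow> geodesic_between G x (rev p) y"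
  unfolding geodesic_between_def geodesic_reversal by blast

lemma hyperbolic_digraph_reversal:
  assumes "hyperbolic_digraph G \<delta>" shows "hyperbolic_digraph (reversal G) \<delta>"
  unfolding hyperbolic_digraph_def
proof (intro allI impI)
  fix A B C assume "geodesic_triangle (reversal G) A B C"
  then have "geodesic_triangle G (rev A) (rev B) (rev C)"
    unfolding geodesic_triangle_def geodesic_between_reversal by simp
  then have th: "thin_triangle G \<delta> (rev A) (rev B) (rev C)"
    using assms unfolding hyperbolic_digraph_def by blast
  show "thin_triangle (reversal G) \<delta> A B C"
    unfolding thin_triangle_def out_ball_reversal in_ball_reversal
  proof (intro allI impI, elim conjE)
    fix P Q R assume m: "{#P, Q, R#} = {#A, B, C#}"
      and h: "hd P \<in> {hd Q, last Q}" and l: "last P \<in> {hd R, last R}"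
    have "image_mset rev {#P, Q, R#} = image_mset rev {#A, B, C#}" using m by simp
    then have "{#rev P, rev R, rev Q#} = {#rev A, rev B, rev C#}" by (simp add: add_mset_commute)
    moreover have "hd (rev P) \<in> {hd (rev R), last (rev R)}" "last (rev P) \<in> {hd (rev Q), last (rev Q)}"
      using h l by (auto simp: hd_rev last_rev)
    ultimately have "set (rev P) \<subseteq> (\<Union>q\<in>set (rev R). out_ball G \<delta> q) \<union> (\<Union>r\<in>set (rev Q). in_ball G \<delta> r)"
      using th unfolding thin_triangle_def by blast
    then show "set P \<subseteq> (\<Union>q\<in>set Q. in_ball G \<delta> q) \<union> (\<Union>r\<in>set R. out_ball G \<delta> r)"
      by (simp add: Un_commute)
  qed
qed

lemma quasi_geodesic_reversal_imp:
  assumes "quasi_geodesic G \<gamma> c p" shows "quasi_geodesic (reversal G) \<gamma> c (rev p)"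
  unfolding quasi_geodesic_def
proof (intro conjI allI impI)
  show "vwalk (rev p) (reversal G)" using assms vwalk_reversal_imp unfolding quasi_geodesic_def by blast
  fix i j assume ij: "i \<le> j \<and> j < length (rev p)"
  define i' where "i' = length p - Suc j"
  define j' where "j' = length p - Suc i"
  have e: "i' \<le> j'" "j' < length p" "j' - i' = j - i" "rev p ! i = p ! j'" "rev p ! j = p ! i'"
    using ij unfolding i'_def j'_def by (auto simp: rev_nth)
  show "ereal (real (j - i)) \<le> ereal \<gamma> * ddist (reversal G) (rev p ! i) (rev p ! j) + ereal c"
    using assms e unfolding quasi_geodesic_def ddist_reversal by metis
qed

lemma quasi_geodesic_reversal: "quasi_geodesic (reversal G) \<gamma> c p \<longleftrightarrow> quasi_geodesic G \<gamma> c (rev p)"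
  using quasi_geodesic_reversal_imp[of "reversal G" \<gamma> c p] quasi_geodesic_reversal_imp[of G \<gamma> c "rev p"] by auto

lemma qg_ray_reversal: "qg_ray (reversal G) R \<longleftrightarrow> qg_anti_ray G R"
  and qg_anti_ray_reversal: "qg_anti_ray (reversal G) R \<longleftrightarrow> qg_ray G R"
  unfolding qg_ray_def qg_anti_ray_def ray_def anti_ray_def arcs_ends_reversal quasi_geodesic_reversal
  by simp_all

lemma qg_rays_reversal: "qg_rays (reversal G) = qg_rays G"
  unfolding qg_rays_def qg_ray_reversal qg_anti_ray_reversal by blast

lemma ray_le_reversal_imp: assumes "ray_le G R1 R2" shows "ray_le (reversal G) R2 R1"
proof -
  obtain M :: real where "0 \<le> M" and M: "\<And>r x. 0 \<le> r \<Longrightarrow> x \<in> verts G \<Longrightarrow> \<exists>u\<in>range R1. \<exists>v\<in>range R2. \<exists>p.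
     dpath G u p v \<and> real (vwalk_length p) \<le> M \<and> set p \<inter> (out_ball G r x \<union> in_ball G r x) = {}"
    using assms unfolding ray_le_def by blast
  show ?thesis
    unfolding ray_le_def out_ball_reversal in_ball_reversal dpath_reversal verts_reversal
  proof (intro exI[of _ M] conjI allI impI ballI \<open>0 \<le> M\<close>)
    fix r :: real and x assume "0 \<le> r" "x \<in> verts G"
    from M[OF this] obtain u v p where p: "u \<in> range R1" "v \<in> range R2" "dpath G u p v"
      "real (vwalk_length p) \<le> M" "set p \<inter> (out_ball G r x \<union> in_ball G r x) = {}" by blast
    show "\<exists>u\<in>range R2. \<exists>v\<in>range R1. \<exists>p. dpath G v (rev p) u \<and> real (vwalk_length p) \<le> M \<and>
        set p \<inter> (in_ball G r x \<union> out_ball G r x) = {}"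
      by (rule bexI[OF _ p(2)], rule bexI[OF _ p(1)], rule exI[of _ "rev p"])
         (use p(3-5) in \<open>auto simp: Un_commute\<close>)
  qed
qed

lemma ray_le_reversal: "ray_le (reversal G) R1 R2 \<longleftrightarrow> ray_le G R2 R1"
  using ray_le_reversal_imp[of G R2 R1] ray_le_reversal_imp[of "reversal G" R1 R2] by auto

lemma bd_completion_reversal: "bd_completion (reversal G) = bd_completion G"
proof -
  have "ray_equiv (reversal G) = ray_equiv G"
    unfolding ray_equiv_def ray_le_reversal qg_rays_reversal by blast
  then show ?thesis unfolding bd_completion_def qg_boundary_def qg_rays_reversal by simp
qed

lemma dist_sym_path_reversal: "dist_sym_path (reversal G) s p = dist_sym_path G s (rev p)"
  unfolding dist_sym_path_def dist_sym_def ddist_reversal by (simp add: min.commute)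

lemma is_base_reversal: "is_base (reversal G) S \<longleftrightarrow> is_base G S"
  unfolding is_base_def dist_sym_def ddist_reversal by (simp add: min.commute)

lemma tail_geodesics_reversal: "tail_geodesics (reversal G) R Q n = rev ` tail_geodesics G Q R n"
  unfolding tail_geodesics_def geodesic_reversal by (auto simp: image_iff) (metis rev_rev_ident)+

lemma geodesic_liminf_reversal: "geodesic_liminf (reversal G) s R Q = geodesic_liminf G s Q R"
  unfolding geodesic_liminf_def tail_geodesics_reversal dist_sym_path_reversal
  by (simp add: image_comp)

lemma rho_reversal: "rho (reversal G) \<epsilon> s \<eta> \<mu> = rho G \<epsilon> s \<mu> \<eta>"
  unfolding rho_def geodesic_liminf_reversal
  by (auto simp: INF_commute[of "\<lambda>R Q. ereal_exp (- (ereal \<epsilon> * geodesic_liminf G s Q R))"])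

lemma rho_base_reversal: "rho_base (reversal G) \<epsilon> S \<eta> \<mu> = rho_base G \<epsilon> S \<mu> \<eta>"
  unfolding rho_base_def rho_reversal ..

lemma visual_dist_reversal_le: "visual_dist (reversal G) S \<epsilon> \<eta> \<mu> \<le> visual_dist G S \<epsilon> \<mu> \<eta>"
  unfolding visual_dist_def[of G]
proof (rule Inf_greatest, clarify)
  fix n :: nat and h :: "nat \<Rightarrow> 'a bpoint"
  assume h: "\<forall>i\<le>n. h i \<in> bd_completion G"
  define g where "g i = h (n - i)" for i
  have "(\<Sum>i<n. rho_base (reversal G) \<epsilon> S (g i) (g (Suc i)))
      = (\<Sum>i<n. rho_base G \<epsilon> S (h (n - Suc i)) (h (Suc (n - Suc i))))"
    unfolding g_def rho_base_reversal by (intro sum.cong refl) (simp add: Suc_diff_Suc)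
  also have "\<dots> = (\<Sum>i<n. rho_base G \<epsilon> S (h i) (h (Suc i)))"
    by (rule sum.nat_diff_reindex)
  finally have s: "(\<Sum>i<n. rho_base G \<epsilon> S (h i) (h (Suc i)))
      = (\<Sum>i<n. rho_base (reversal G) \<epsilon> S (g i) (g (Suc i)))" ..
  show "visual_dist (reversal G) S \<epsilon> (h n) (h 0) \<le> (\<Sum>i<n. rho_base G \<epsilon> S (h i) (h (Suc i)))"
    unfolding visual_dist_def s
    by (rule Inf_lower) (use h in \<open>auto simp: g_def bd_completion_reversal intro!: exI[of _ n] exI[of _ g]\<close>)
qed

lemma visual_dist_reversal: "visual_dist (reversal G) S \<epsilon> \<eta> \<mu> = visual_dist G S \<epsilon> \<mu> \<eta>"
  using visual_dist_reversal_le[of G S \<epsilon> \<eta> \<mu>] visual_dist_reversal_le[of "reversal G" S \<epsilon> \<mu> \<eta>]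
  by simp

lemma seq_f_compact_reversal:
  "seq_f_compact (bd_completion (reversal G)) (visual_dist (reversal G) S \<epsilon>)
    \<longleftrightarrow> seq_b_compact (bd_completion G) (visual_dist G S \<epsilon>)"
  unfolding seq_f_compact_def seq_b_compact_def backward_topology_def forward_topology_def
    visual_dist_reversal bd_completion_reversal ..

context thin_digraph
begin

lemma thin_digraph_reversal: "thin_digraph (reversal D) \<delta> f"
  by (intro thin_digraph.intro wf_digraph_reversal wf_digraph_axioms thin_digraph_axioms.intro)
     (use delta_nonneg hyperbolic_digraph_reversal[OF hyperbolic] B1 B2
       in \<open>auto simp: cond_B1_reversal cond_B2_reversal\<close>)

lemma ray_geodesics_escape:
  assumes "qg_ray D R"
  shows "\<exists>M. \<forall>m n W w. M \<le> m \<longrightarrow> m \<le> n \<longrightarrow> geodesic D (R m) W (R n) \<longrightarrow> w \<in> set W \<longrightarrow> \<not> near D C v w"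
proof -
  have "qg_anti_ray (reversal D) R" using assms unfolding qg_anti_ray_reversal .
  from thin_digraph.anti_ray_geodesics_escape[OF thin_digraph_reversal this, of C v]
  obtain M where M: "\<forall>m n W w. M \<le> m \<longrightarrow> m \<le> n \<longrightarrow> geodesic D (R m) (rev W) (R n) \<longrightarrow> w \<in> set W \<longrightarrow> \<not> near D C v w"
    unfolding geodesic_reversal near_reversal ..
  show ?thesis
    using M[rule_format, where W = "rev _"] by (auto intro!: exI[of _ M])
qed

end

section \<open>The visual distance and its convergence\<close>

lemma visual_dist_le_rho_base:
  assumes "\<eta> \<in> bd_completion G" "\<mu> \<in> bd_completion G"
  shows "visual_dist G S \<epsilon> \<eta> \<mu> \<le> rho_base G \<epsilon> S \<eta> \<mu>"
  unfolding visual_dist_def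
proof (rule Inf_lower, clarify, intro exI conjI)
  let ?h = "\<lambda>i::nat. if i = 0 then \<eta> else \<mu>"
  show "rho_base G \<epsilon> S \<eta> \<mu> = (\<Sum>i<1. rho_base G \<epsilon> S (?h i) (?h (Suc i)))" by simp
qed (use assms in auto)

lemma visual_dist_refl: "\<eta> \<in> bd_completion G \<Longrightarrow> visual_dist G S \<epsilon> \<eta> \<eta> = 0"
proof -
  assume e: "\<eta> \<in> bd_completion G"
  have "visual_dist G S \<epsilon> \<eta> \<eta> \<le> 0"
    unfolding visual_dist_def
  proof (rule Inf_lower, clarify, intro exI conjI)
    show "0 = (\<Sum>i<0. rho_base G \<epsilon> S ((\<lambda>_. \<eta>) i) ((\<lambda>_. \<eta>) (Suc i)))" by simp
  qed (use e in auto)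
  then show ?thesis by simp
qed

lemma le_Inf_add_Inf:
  fixes x :: ennreal
  assumes "\<And>a b. a \<in> A \<Longrightarrow> b \<in> B \<Longrightarrow> x \<le> a + b"
  shows "x \<le> Inf A + Inf B"
proof (rule ennreal_le_epsilon)
  fix e :: real assume fin: "Inf A + Inf B < top" and e: "0 < e"
  have less: "c < c + ennreal (e / 2)" if "c < top" for c :: ennreal
    using ennreal_add_left_cancel_less[of c 0 "ennreal (e / 2)"] that e by simp
  have "Inf A < Inf A + ennreal (e / 2)" "Inf B < Inf B + ennreal (e / 2)"
    using fin less unfolding ennreal_add_less_top by (blast, blast)
  then obtain a b where ab: "a \<in> A" "a < Inf A + ennreal (e / 2)" "b \<in> B" "b < Inf B + ennreal (e / 2)"
    unfolding Inf_less_iff by blast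
  have "x \<le> a + b" using assms ab by blast
  also have "\<dots> \<le> (Inf A + ennreal (e / 2)) + (Inf B + ennreal (e / 2))"
    using ab by (intro add_mono) auto
  also have "\<dots> = Inf A + Inf B + (ennreal (e / 2) + ennreal (e / 2))" by (simp add: ac_simps)
  also have "ennreal (e / 2) + ennreal (e / 2) = ennreal e" using e by (simp flip: ennreal_plus)
  finally show "x \<le> Inf A + Inf B + ennreal e" .
qed

lemma visual_dist_triangle:
  "visual_dist G S \<epsilon> \<eta> \<nu> \<le> visual_dist G S \<epsilon> \<eta> \<mu> + visual_dist G S \<epsilon> \<mu> \<nu>"
proof -
  define A where "A \<eta> \<mu> = {\<Sum>i<n. rho_base G \<epsilon> S (h i) (h (Suc i)) | n h.
            h 0 = \<eta> \<and> h n = \<mu> \<and> (\<forall>i\<le>n. h i \<in> bd_completion G)}" for \<eta> \<mu>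
  have le: "visual_dist G S \<epsilon> \<eta> \<nu> \<le> a + b" if "a \<in> A \<eta> \<mu>" "b \<in> A \<mu> \<nu>" for a b
  proof -
    obtain n h where h: "a = (\<Sum>i<n. rho_base G \<epsilon> S (h i) (h (Suc i)))" "h 0 = \<eta>" "h n = \<mu>"
      "\<forall>i\<le>n. h i \<in> bd_completion G" using \<open>a \<in> A \<eta> \<mu>\<close> unfolding A_def by blast
    obtain m g where g: "b = (\<Sum>i<m. rho_base G \<epsilon> S (g i) (g (Suc i)))" "g 0 = \<mu>" "g m = \<nu>"
      "\<forall>i\<le>m. g i \<in> bd_completion G" using \<open>b \<in> A \<mu> \<nu>\<close> unfolding A_def by blast
    define k where "k i = (if i \<le> n then h i else g (i - n))" for i
    have "(\<Sum>i<n + m. rho_base G \<epsilon> S (k i) (k (Suc i)))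
        = (\<Sum>i<n. rho_base G \<epsilon> S (k i) (k (Suc i))) + (\<Sum>i<m. rho_base G \<epsilon> S (k (n + i)) (k (Suc (n + i))))"
      by (induction m) (auto simp: add.assoc)
    also have "(\<Sum>i<n. rho_base G \<epsilon> S (k i) (k (Suc i))) = a"
      unfolding h(1) k_def by (intro sum.cong) auto
    also have "(\<Sum>i<m. rho_base G \<epsilon> S (k (n + i)) (k (Suc (n + i)))) = b"
    proof -
      have "k (n + i) = g i" for i using h(3) g(2) unfolding k_def by (cases i) auto
      moreover from this[of "Suc i" for i] have "k (Suc (n + i)) = g (Suc i)" for i by simp
      ultimately show ?thesis unfolding g(1) by simp
    qed
    finally have s: "a + b = (\<Sum>i<n + m. rho_base G \<epsilon> S (k i) (k (Suc i)))" ..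
    have "k 0 = \<eta>" "\<forall>i\<le>n + m. k i \<in> bd_completion G" using h g unfolding k_def by auto
    moreover have "k (n + m) = \<nu>" using h(3) g(2,3) unfolding k_def by (cases m) auto
    ultimately show ?thesis unfolding s visual_dist_def by (intro Inf_lower) blast
  qed
  show ?thesis
    unfolding visual_dist_def[of G S \<epsilon> \<eta> \<mu>] visual_dist_def[of G S \<epsilon> \<mu> \<nu>] A_def[symmetric]
    by (rule le_Inf_add_Inf) (rule le)
qed

text \<open>
  By the triangle inequality, an in-ball around any point \<open>z\<close> that contains \<open>l\<close> also contains all \<open>y\<close>
  for which \<open>\<rho> y l\<close> is small enough.
\<close>

lemma limitin_backward_topology:
  assumes tri: "\<And>a b c. \<rho> a c \<le> \<rho> a b + \<rho> b c" and refl: "\<rho> l l = 0"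
    and x: "\<And>k. x k \<in> Y" and l: "l \<in> Y"
    and lim: "\<And>e. 0 < e \<Longrightarrow> eventually (\<lambda>k. \<rho> (x k) l < ennreal e) sequentially"
  shows "limitin (backward_topology Y \<rho>) x l sequentially"
proof -
  let ?B = "{{y\<in>Y. \<rho> y z < ennreal r} |z r. z \<in> Y \<and> 0 < r}"
  have base: "eventually (\<lambda>k. x k \<in> U) sequentially" if "generate_topology_on ?B U" "l \<in> U" for U
    using that
  proof (induction rule: generate_topology_on.induct)
    case Empty then show ?case by simp
  next
    case (Int a b) then show ?case by (simp add: eventually_conj)
  next
    case (UN K)
    then obtain k where "k \<in> K" "l \<in> k" by blast
    with UN.IH[OF this] show ?case by (auto elim: eventually_mono)
  next
    case (Basis s)
    then obtain z r where s: "s = {y\<in>Y. \<rho> y z < ennreal r}" and lz: "\<rho> l z < ennreal r" by blast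
    obtain t where t: "\<rho> l z = ennreal t" "0 \<le> t" "t < r"
      using lz by (cases "\<rho> l z") (auto simp: ennreal_less_iff)
    have "eventually (\<lambda>k. \<rho> (x k) l < ennreal (r - t)) sequentially" using lim t(3) by simp
    then show ?case
    proof eventually_elim
      case (elim k)
      have "\<rho> (x k) z \<le> \<rho> (x k) l + ennreal t" using tri[of "x k" z l] t(1) by simp
      also have "\<dots> < ennreal (r - t) + ennreal t"
        using elim ennreal_add_left_cancel_less[of "ennreal t" "\<rho> (x k) l" "ennreal (r - t)"]
        by (simp add: add.commute)
      also have "\<dots> = ennreal r" using t by (simp flip: ennreal_plus)
      finally show ?case using x s by simp
    qed
  qed
  have "{y\<in>Y. \<rho> y l < ennreal 1} \<in> ?B"
    by (rule CollectI, rule exI[of _ l], rule exI[of _ 1]) (use l in simp)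
  moreover have "l \<in> {y\<in>Y. \<rho> y l < ennreal 1}" using l refl by simp
  ultimately have "l \<in> topspace (backward_topology Y \<rho>)"
    unfolding backward_topology_def topology_generated_by_topspace by (rule UnionI)
  then show ?thesis
    unfolding limitin_def
    by (intro conjI allI impI base)
       (auto simp: backward_topology_def openin_topology_generated_by_iff)
qed

lemma ereal_exp_le: "a \<le> ereal b \<Longrightarrow> ereal_exp a \<le> ennreal (exp b)"
  unfolding ereal_exp_def by (cases a) (auto intro: ennreal_leI)

lemma rho_le:
  assumes "R \<in> reps \<eta>" "Q \<in> reps \<mu>" "ereal C \<le> geodesic_liminf G s R Q" "0 < \<epsilon>"
  shows "rho G \<epsilon> s \<eta> \<mu> \<le> ennreal (exp (- (\<epsilon> * C)))"
proof -
  have "ereal \<epsilon> * ereal C \<le> ereal \<epsilon> * geodesic_liminf G s R Q"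
    using assms(3,4) by (intro ereal_mult_left_mono) auto
  then have "- (ereal \<epsilon> * geodesic_liminf G s R Q) \<le> - (ereal \<epsilon> * ereal C)"
    by (simp only: ereal_minus_le_minus)
  then have "- (ereal \<epsilon> * geodesic_liminf G s R Q) \<le> ereal (- (\<epsilon> * C))" by simp
  then have "ereal_exp (- (ereal \<epsilon> * geodesic_liminf G s R Q)) \<le> ennreal (exp (- (\<epsilon> * C)))"
    by (rule ereal_exp_le)
  moreover have "(INF R\<in>reps \<eta>. INF Q\<in>reps \<mu>. ereal_exp (- (ereal \<epsilon> * geodesic_liminf G s R Q)))
      \<le> ereal_exp (- (ereal \<epsilon> * geodesic_liminf G s R Q))"
    using assms(1,2) by (intro INF_lower2[OF assms(1)] INF_lower)
  ultimately show ?thesis unfolding rho_def by auto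
qed

lemma geodesic_liminf_ge:
  assumes "\<And>N. \<exists>n\<ge>N. \<exists>m\<ge>N. conn G (R n) (Q m)"
    and "\<exists>M. \<forall>n m W w. M \<le> n \<longrightarrow> M \<le> m \<longrightarrow> geodesic G (R n) W (Q m) \<longrightarrow> w \<in> set W
            \<longrightarrow> \<not> near G C s w \<and> \<not> near G C w s"
  shows "ereal C \<le> geodesic_liminf G s R Q"
proof -
  have ne: "tail_geodesics G R Q n \<noteq> {}" for n
  proof -
    obtain i j where "i \<ge> n" "j \<ge> n" "conn G (R i) (Q j)" using assms(1)[of n] by blast
    moreover from this(3) obtain P where "geodesic G (R i) P (Q j)" by (rule geodesic_exists)
    ultimately have "P \<in> tail_geodesics G R Q n" unfolding tail_geodesics_def by blast
    then show ?thesis by blast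
  qed
  obtain M where M: "\<forall>n m W w. M \<le> n \<longrightarrow> M \<le> m \<longrightarrow> geodesic G (R n) W (Q m) \<longrightarrow> w \<in> set W
            \<longrightarrow> \<not> near G C s w \<and> \<not> near G C w s" using assms(2) ..
  have "ereal C \<le> (INF P\<in>tail_geodesics G R Q M. dist_sym_path G s P)"
  proof (rule INF_greatest)
    fix P assume "P \<in> tail_geodesics G R Q M"
    then obtain i j where P: "i \<ge> M" "j \<ge> M" "geodesic G (R i) P (Q j)"
      unfolding tail_geodesics_def by blast
    have "ereal C \<le> dist_sym G s w" if "w \<in> set P" for w
      using M[rule_format, OF P that] unfolding near_def dist_sym_def by (auto simp: not_le intro: less_imp_le)
    then show "ereal C \<le> dist_sym_path G s P"
      unfolding dist_sym_path_def using geodesic_basic(1)[OF P(3)] by simp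
  qed
  also have "\<dots> \<le> (SUP n. INF P\<in>tail_geodesics G R Q n. dist_sym_path G s P)" by (rule SUP_upper) simp
  finally show ?thesis using ne unfolding geodesic_liminf_def by simp
qed

text \<open>
  Finiteness of \<^const>\<open>rho\<close> between two points amounts to this for some of their representatives,
  whatever the base vertex. A constant sequence in the first argument expresses that a vertex reaches infinitely many
  members of the second sequence.
\<close>

definition linked :: "('a,'b) pre_digraph \<Rightarrow> (nat \<Rightarrow> 'a) \<Rightarrow> (nat \<Rightarrow> 'a) \<Rightarrow> bool" where
  "linked G R Q \<longleftrightarrow> (\<forall>N. \<exists>n\<ge>N. \<exists>m\<ge>N. conn G (R n) (Q m))"

lemma rho_finite_imp_linked:
  assumes "rho G \<epsilon> s \<eta> \<mu> < \<infinity>" "0 < \<epsilon>"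
  shows "\<exists>R\<in>reps \<eta>. \<exists>Q\<in>reps \<mu>. linked G R Q"
proof (cases "\<eta> = \<mu> \<and> \<eta> \<in> Inl ` verts G")
  case True
  then obtain x where "\<eta> = Inl x" "\<mu> = Inl x" "x \<in> verts G" by blast
  then show ?thesis using conn_refl unfolding linked_def by auto
next
  case False
  then obtain R Q where RQ: "R \<in> reps \<eta>" "Q \<in> reps \<mu>"
    and fin: "ereal_exp (- (ereal \<epsilon> * geodesic_liminf G s R Q)) < \<infinity>"
    using assms(1) unfolding rho_def if_not_P[OF False] INF_less_iff by blast
  have "geodesic_liminf G s R Q \<noteq> - \<infinity>" using fin assms(2) unfolding ereal_exp_def by auto
  then have "tail_geodesics G R Q n \<noteq> {}" for n
    unfolding geodesic_liminf_def by (simp split: if_splits)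
  have "\<exists>i\<ge>n. \<exists>j\<ge>n. conn G (R i) (Q j)" for n
  proof -
    obtain P i j where "i \<ge> n" "j \<ge> n" "geodesic G (R i) P (Q j)"
      using \<open>\<And>n. tail_geodesics G R Q n \<noteq> {}\<close>[of n] unfolding tail_geodesics_def by blast
    with geodesic_imp_conn[OF this(3)] show ?thesis by blast
  qed
  then have "linked G R Q" unfolding linked_def by simp
  with RQ show ?thesis by blast
qed

section \<open>Reachability between points of the completion\<close>

definition ascending :: "('a,'b) pre_digraph \<Rightarrow> (nat \<Rightarrow> 'a) \<Rightarrow> bool" where
  "ascending G R \<longleftrightarrow> (\<forall>i j. i \<le> j \<longrightarrow> conn G (R i) (R j))"

definition descending :: "('a,'b) pre_digraph \<Rightarrow> (nat \<Rightarrow> 'a) \<Rightarrow> bool" where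
  "descending G R \<longleftrightarrow> (\<forall>i j. i \<le> j \<longrightarrow> conn G (R j) (R i))"

text \<open>
  The two witnesses on \<open>Q\<close> need not coincide, but since \<open>Q\<close> is monotone for reachability the second
  one can be chosen after the first, or the first one before the second.
\<close>

lemma linked_trans:
  assumes RQ: "linked G R Q" and QT: "linked G Q T" and Q: "ascending G Q \<or> descending G Q"
  shows "linked G R T"
  unfolding linked_def
proof
  fix N
  from Q show "\<exists>n\<ge>N. \<exists>m\<ge>N. conn G (R n) (T m)"
  proof
    assume asc: "ascending G Q"
    obtain n a where 1: "N \<le> n" "conn G (R n) (Q a)" using RQ unfolding linked_def by blast
    obtain b m where 2: "max N a \<le> b" "max N a \<le> m" "conn G (Q b) (T m)" using QT unfolding linked_def by blast
    have "conn G (Q a) (Q b)" using asc 2(1) unfolding ascending_def by simp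
    from conn_trans[OF 1(2) conn_trans[OF this 2(3)]] 1(1) 2(2) show ?thesis
      by (intro exI[of _ n] exI[of _ m] conjI) auto
  next
    assume desc: "descending G Q"
    obtain b m where 2: "N \<le> m" "conn G (Q b) (T m)" using QT unfolding linked_def by blast
    obtain n a where 1: "max N b \<le> n" "max N b \<le> a" "conn G (R n) (Q a)" using RQ unfolding linked_def by blast
    have "conn G (Q a) (Q b)" using desc 1(2) unfolding descending_def by simp
    from conn_trans[OF 1(3) conn_trans[OF this 2(2)]] 1(1) 2(1) show ?thesis
      by (intro exI[of _ n] exI[of _ m] conjI) auto
  qed
qed

lemma descending_qg_anti_ray: "qg_anti_ray G R \<Longrightarrow> descending G R"
  unfolding descending_def by (intro allI impI qg_anti_ray_conn)

lemma ascending_qg_ray: "qg_ray G R \<Longrightarrow> ascending G R"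
  using descending_qg_anti_ray[of "reversal G" R]
  unfolding qg_anti_ray_reversal ascending_def descending_def conn_reversal by simp

lemma ascending_const: "x \<in> verts G \<Longrightarrow> ascending G (\<lambda>_. x)"
  unfolding ascending_def by (simp add: conn_refl)

lemma bd_completion_repsE:
  assumes "\<eta> \<in> bd_completion G" "R \<in> reps \<eta>"
  obtains (vertex) x where "x \<in> verts G" "R = (\<lambda>_. x)" "\<eta> = Inl x"
    | (ray) "qg_ray G R" | (anti_ray) "qg_anti_ray G R"
proof (cases \<eta>)
  case (Inl x)
  then show ?thesis using assms that(1)[of x] unfolding bd_completion_def by auto
next
  case (Inr C)
  then have "C \<in> qg_rays G // ray_equiv G" "R \<in> C"
    using assms unfolding bd_completion_def qg_boundary_def by auto
  then have "R \<in> qg_rays G" unfolding quotient_def ray_equiv_def by auto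
  then show ?thesis using that(2,3) unfolding qg_rays_def by auto
qed

lemma reps_monotone:
  assumes "\<eta> \<in> bd_completion G" "R \<in> reps \<eta>" shows "ascending G R \<or> descending G R"
  using assms
  by (cases rule: bd_completion_repsE) (auto simp: ascending_const ascending_qg_ray descending_qg_anti_ray)

lemma reps_in_verts:
  assumes "\<eta> \<in> bd_completion G" "R \<in> reps \<eta>" shows "R i \<in> verts G"
  using reps_monotone[OF assms] conn_verts[of G "R i" "R i"] unfolding ascending_def descending_def by auto

context thin_digraph
begin

text \<open>
  Two members of \<open>R\<close> in the same ball have bounded distance by (B1) or (B2), hence bounded difference
  of indices.
\<close>

lemma finite_near_anti_ray:
  assumes R: "qg_anti_ray D R"
  shows "finite {i. near D r x (R i)}" "finite {i. near D r (R i) x}"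
proof -
  obtain \<gamma> c where lin: "\<forall>i j r. i \<le> j \<longrightarrow> near D r (R j) (R i) \<longrightarrow> real j - real i \<le> \<gamma> * r + c"
    using qg_anti_ray_linear[OF R] by (elim exE conjE) (rule that)
  have fin: "finite I" if I: "\<And>i j. i \<in> I \<Longrightarrow> j \<in> I \<Longrightarrow> conn D (R j) (R i) \<Longrightarrow> near D (f r) (R j) (R i)" for I
  proof (cases "I = {}")
    case False
    then obtain i0 where i0: "i0 \<in> I" by blast
    have "j \<le> max i0 (nat \<lceil>real i0 + \<gamma> * f r + c\<rceil>)" if "j \<in> I" for j
    proof (cases "j \<le> i0")
      case nle: False
      then have "near D (f r) (R j) (R i0)" by (intro I i0 that qg_anti_ray_conn[OF R]) simp
      from lin[rule_format, OF _ this] nle have "real j \<le> real i0 + \<gamma> * f r + c" by simp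
      then show ?thesis by linarith
    qed simp
    then show ?thesis using finite_subset[of I "{..max i0 (nat \<lceil>real i0 + \<gamma> * f r + c\<rceil>)}"] by auto
  qed simp
  show "finite {i. near D r x (R i)}" by (rule fin, rule near_of_common_source[of r x]) auto
  show "finite {i. near D r (R i) x}" by (rule fin, rule near_of_common_target[of r _ x]) auto
qed

lemma finite_near_qg_rays:
  assumes R: "R \<in> qg_rays D"
  shows "finite {i. near D r x (R i)}" "finite {i. near D r (R i) x}"
proof -
  have "finite {i. near D r x (R i)} \<and> finite {i. near D r (R i) x}"
  proof (cases "qg_anti_ray D R")
    case True then show ?thesis using finite_near_anti_ray by blast
  next
    case False
    then have "qg_anti_ray (reversal D) R" using R unfolding qg_rays_def qg_anti_ray_reversal by blast
    from thin_digraph.finite_near_anti_ray[OF thin_digraph_reversal this]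
    show ?thesis unfolding near_reversal by blast
  qed
  then show "finite {i. near D r x (R i)}" "finite {i. near D r (R i) x}" by auto
qed

lemma qg_rays_in_verts: "R \<in> qg_rays D \<Longrightarrow> R i \<in> verts D"
  unfolding qg_rays_def qg_ray_def qg_anti_ray_def ray_def anti_ray_def by auto

lemma ray_le_refl:
  assumes R: "R \<in> qg_rays D" shows "ray_le D R R"
  unfolding ray_le_def
proof (intro exI[of _ 0] conjI allI impI ballI)
  fix r :: real and x
  have "finite ({i. near D r x (R i)} \<union> {i. near D r (R i) x})" using finite_near_qg_rays[OF R] by blast
  then obtain i where "i \<notin> {i. near D r x (R i)} \<union> {i. near D r (R i) x}"
    using ex_new_if_finite[OF infinite_UNIV_nat] by blast
  then have "{R i} \<inter> (out_ball D r x \<union> in_ball D r x) = {}"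
    unfolding near_def out_ball_def in_ball_def by auto
  moreover have "dpath D (R i) [R i] (R i)"
    using qg_rays_in_verts[OF R] unfolding dpath_def vwalk_def by simp
  ultimately show "\<exists>u\<in>range R. \<exists>v\<in>range R. \<exists>p. dpath D u p v \<and> real (vwalk_length p) \<le> 0 \<and>
      set p \<inter> (out_ball D r x \<union> in_ball D r x) = {}"
    by (intro bexI[of _ "R i"] exI[of _ "[R i]"]) auto
qed simp

lemma qg_rays_monotone: "R \<in> qg_rays D \<Longrightarrow> ascending D R \<or> descending D R"
  unfolding qg_rays_def using ascending_qg_ray descending_qg_anti_ray by blast

lemma ray_le_imp_linked:
  assumes R: "R \<in> qg_rays D" and Q: "Q \<in> qg_rays D" and le: "ray_le D R Q"
  shows "linked D R Q"
  unfolding linked_def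
proof
  fix N
  obtain M :: real where M: "\<And>r x. 0 \<le> r \<Longrightarrow> x \<in> verts D \<Longrightarrow> \<exists>u\<in>range R. \<exists>v\<in>range Q. \<exists>p.
     dpath D u p v \<and> real (vwalk_length p) \<le> M \<and> set p \<inter> (out_ball D r x \<union> in_ball D r x) = {}"
    using le unfolding ray_le_def by blast
  \<comment> \<open>A short path that starts outside a large ball around \<open>R 0\<close> avoids both an initial segment of \<open>R\<close>
     and all points of \<open>R\<close> from which an initial segment of \<open>Q\<close> can be reached quickly.\<close>
  define I where "I = {..<N} \<union> (\<Union>m<N. {n. near D M (R n) (Q m)})"
  have "finite I" unfolding I_def using finite_near_qg_rays[OF R] by auto
  moreover have "\<exists>r. near D r (R 0) (R n) \<or> near D r (R n) (R 0)" for n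
  proof -
    from qg_rays_monotone[OF R] have "conn D (R 0) (R n) \<or> conn D (R n) (R 0)"
      unfolding ascending_def descending_def by auto
    then show ?thesis
    proof
      assume "conn D (R 0) (R n)" then show ?thesis by (rule conn_near) (intro exI disjI1)
    next
      assume "conn D (R n) (R 0)" then show ?thesis by (rule conn_near) (intro exI disjI2)
    qed
  qed
  then obtain r where r: "near D (r n) (R 0) (R n) \<or> near D (r n) (R n) (R 0)" for n by metis
  ultimately have fin: "finite (r ` I)" by simp
  define r0 where "r0 = Max (insert 0 (r ` I))"
  have r0: "0 \<le> r0" "n \<in> I \<Longrightarrow> r n \<le> r0" for n unfolding r0_def using fin by auto
  obtain n m p where p: "dpath D (R n) p (Q m)" "real (vwalk_length p) \<le> M"
    "set p \<inter> (out_ball D r0 (R 0) \<union> in_ball D r0 (R 0)) = {}"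
    using M[OF r0(1) qg_rays_in_verts[OF R, of 0]] by blast
  have "R n \<in> set p" using p(1) hd_in_set[of p] unfolding dpath_def vwalk_def by simp
  with p(3) have "\<not> near D r0 (R 0) (R n) \<and> \<not> near D r0 (R n) (R 0)"
    using qg_rays_in_verts[OF R, of n] unfolding out_ball_def in_ball_def near_def by auto
  then have "n \<notin> I"
    using r[of n] r0(2)[of n] near_mono[of D "r n" "R 0" "R n" r0] near_mono[of D "r n" "R n" "R 0" r0] by auto
  moreover have nm: "near D M (R n) (Q m)"
    unfolding near_def using order_trans[OF ddist_le_walk[OF p(1)]] p(2) by simp
  ultimately have "N \<le> n" "N \<le> m" unfolding I_def by auto
  with near_conn[OF nm] show "\<exists>n\<ge>N. \<exists>m\<ge>N. conn D (R n) (Q m)"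
    by (intro exI[of _ n] exI[of _ m] conjI)
qed

lemma reps_linked:
  assumes e: "\<eta> \<in> bd_completion D" and R: "R \<in> reps \<eta>" and Q: "Q \<in> reps \<eta>"
  shows "linked D R Q"
proof (cases \<eta>)
  case (Inl x)
  then have "R = (\<lambda>_. x)" "Q = (\<lambda>_. x)" using R Q by auto
  moreover have "x \<in> verts D" using e Inl unfolding bd_completion_def by auto
  ultimately show ?thesis unfolding linked_def using conn_refl[of x D] by auto
next
  case (Inr C)
  then have "C \<in> qg_rays D // ray_equiv D" using e unfolding bd_completion_def qg_boundary_def by auto
  then obtain T where C: "C = ray_equiv D `` {T}" unfolding quotient_def by blast
  have T: "T \<in> qg_rays D" "R \<in> qg_rays D" "Q \<in> qg_rays D" "ray_le D R T" "ray_le D T Q"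
    using R Q Inr C unfolding ray_equiv_def by auto
  show ?thesis
    by (rule linked_trans[OF ray_le_imp_linked[OF T(2,1,4)] ray_le_imp_linked[OF T(1,3,5)] qg_rays_monotone[OF T(1)]])
qed

lemma class_in_completion:
  assumes R: "R \<in> qg_rays D"
  shows "Inr (ray_equiv D `` {R}) \<in> bd_completion D" "R \<in> reps (Inr (ray_equiv D `` {R}))"
proof -
  have "ray_equiv D `` {R} \<in> qg_boundary D" unfolding qg_boundary_def by (rule quotientI[OF R])
  then show "Inr (ray_equiv D `` {R}) \<in> bd_completion D" unfolding bd_completion_def by (rule InrI)
  show "R \<in> reps (Inr (ray_equiv D `` {R}))" using R ray_le_refl[OF R] unfolding ray_equiv_def by simp
qed

lemma reps_nonempty:
  assumes "\<eta> \<in> bd_completion D" shows "\<exists>R. R \<in> reps \<eta>"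
proof (cases \<eta>)
  case (Inr C)
  then have "C \<in> qg_rays D // ray_equiv D" using assms unfolding bd_completion_def qg_boundary_def by auto
  then obtain T where "T \<in> qg_rays D" "C = ray_equiv D `` {T}" unfolding quotient_def by blast
  then show ?thesis using class_in_completion(2)[of T] Inr by auto
qed auto

text \<open>
  A finite visual distance comes with a chain of finite steps; at each intermediate point one
  passes from one representative to another, and these are linked as equivalent rays.
\<close>

lemma visual_dist_finite_imp_linked:
  assumes S: "finite S" "S \<noteq> {}" and eps: "0 < \<epsilon>"
    and fin: "visual_dist D S \<epsilon> \<eta> \<xi> < \<infinity>" and R: "R \<in> reps \<eta>" and Q: "Q \<in> reps \<xi>"
  shows "linked D R Q"
proof -
  from fin obtain n h where h: "h 0 = \<eta>" "h n = \<xi>" "\<forall>i\<le>n. h i \<in> bd_completion D"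
    and sum: "(\<Sum>i<n. rho_base D \<epsilon> S (h i) (h (Suc i))) < \<infinity>"
    unfolding visual_dist_def Inf_less_iff by blast
  have step: "\<exists>R\<in>reps (h i). \<exists>Q\<in>reps (h (Suc i)). linked D R Q" if "i < n" for i
  proof -
    have "rho_base D \<epsilon> S (h i) (h (Suc i)) \<le> (\<Sum>i<n. rho_base D \<epsilon> S (h i) (h (Suc i)))"
      using that by (intro member_le_sum) auto
    then have "rho_base D \<epsilon> S (h i) (h (Suc i)) < \<infinity>" using sum by (rule le_less_trans)
    moreover obtain s where "s \<in> S" using S(2) by blast
    moreover from this have "rho D \<epsilon> s (h i) (h (Suc i)) \<le> rho_base D \<epsilon> S (h i) (h (Suc i))"
      unfolding rho_base_def using S(1) by (intro Max_ge) auto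
    ultimately have "rho D \<epsilon> s (h i) (h (Suc i)) < \<infinity>" by simp
    then show ?thesis by (rule rho_finite_imp_linked[OF _ eps])
  qed
  have "\<forall>Q\<in>reps (h i). linked D R Q" if "i \<le> n" for i
    using that
  proof (induction i)
    case 0
    then show ?case using reps_linked[of "h 0" R] R h by auto
  next
    case (Suc i)
    obtain T U where TU: "T \<in> reps (h i)" "U \<in> reps (h (Suc i))" "linked D T U" using step[of i] Suc(2) by auto
    have in_Y: "h i \<in> bd_completion D" "h (Suc i) \<in> bd_completion D" using h(3) Suc(2) by auto
    have "linked D R T" using Suc TU(1) by simp
    then have RU: "linked D R U" by (rule linked_trans[OF _ TU(3) reps_monotone[OF in_Y(1) TU(1)]])
    show ?case
    proof
      fix V assume "V \<in> reps (h (Suc i))"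
      show "linked D R V"
        by (rule linked_trans[OF RU reps_linked[OF in_Y(2) TU(2)] reps_monotone[OF in_Y(2) TU(2)]]) fact
    qed
  qed
  from this[of n] h(2) Q show ?thesis by simp
qed

end

section \<open>The limit ray\<close>

lemma finite_near_bound:
  assumes "finite F" shows "\<exists>t. \<forall>v\<in>F. conn G y v \<longrightarrow> near G t y v"
  using assms
proof induction
  case (insert a F)
  then obtain t where t: "\<forall>v\<in>F. conn G y v \<longrightarrow> near G t y v" by blast
  obtain r where r: "conn G y a \<Longrightarrow> near G r y a" by (cases "conn G y a") (auto elim: conn_near)
  show ?case
  proof (intro exI[of _ "max t r"] ballI impI)
    fix v assume "v \<in> insert a F" "conn G y v"
    then have "near G t y v \<or> near G r y v" using t r by auto
    then show "near G (max t r) y v"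
      using near_mono[of G t y v "max t r"] near_mono[of G r y v "max t r"] by auto
  qed
qed simp

lemma linked_const_eventually:
  assumes "linked G (\<lambda>_. y) R" "ascending G R \<or> descending G R"
  shows "eventually (\<lambda>m. conn G y (R m)) sequentially"
  using assms(2)
proof
  assume asc: "ascending G R"
  obtain m0 where "conn G y (R m0)" using assms(1) unfolding linked_def by blast
  then have "conn G y (R m)" if "m0 \<le> m" for m
    using conn_trans[of G y "R m0" "R m"] asc that unfolding ascending_def by simp
  then show ?thesis unfolding eventually_sequentially by blast
next
  assume desc: "descending G R"
  have "conn G y (R m)" for m
  proof -
    obtain m' where "m \<le> m'" "conn G y (R m')" using assms(1) unfolding linked_def by blast
    then show ?thesis using conn_trans[of G y "R m'" "R m"] desc unfolding descending_def by simp
  qed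
  then show ?thesis by simp
qed

locale finite_out_thin_digraph = thin_digraph +
  assumes finite_out: "x \<in> verts D \<Longrightarrow> finite_out_degree D x"
begin

lemma finite_near: "finite {y. near D r x y}"
proof -
  have nat: "finite {y. near D (real n) x y}" for n
  proof (induction n)
    case 0
    have "y = x" if y: "near D 0 x y" for y
    proof -
      obtain P where P: "geodesic D x P y" using geodesic_exists[OF near_conn[OF y]] .
      have "length P = 1" using geodesic_length_le[OF P y] geodesic_basic(2)[OF P] by linarith
      then show ?thesis using geodesic_basic(3,4)[OF P] by simp
    qed
    then show ?case using finite_subset[of "{y. near D (real 0) x y}" "{x}"] by auto
  next
    case (Suc n)
    have "{y. near D (real (Suc n)) x y} \<subseteq>
      insert x (\<Union>z\<in>{z. near D (real n) x z}. {y \<in> verts D. ddist D z y = 1})" (is "_ \<subseteq> ?B")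
    proof
      fix y assume "y \<in> {y. near D (real (Suc n)) x y}"
      then have y: "near D (real (Suc n)) x y" by simp
      obtain P where P: "geodesic D x P y" using geodesic_exists[OF near_conn[OF y]] .
      have len: "length P \<le> Suc (Suc n)" using geodesic_length_le[OF P y] by simp
      show "y \<in> ?B"
      proof (cases "length P = 1")
        case True then show ?thesis using geodesic_basic(3,4)[OF P] by simp
      next
        case False
        define k where "k = length P - 2"
        have k: "k < length P" "Suc k = length P - 1" "k \<le> n"
          using False geodesic_basic(2)[OF P] len unfolding k_def by linarith+
        have "near D (real k) x (P ! k)"
          using geodesic_near[OF P, of 0 k] k(1) geodesic_basic(3)[OF P] by simp
        then have 1: "near D (real n) x (P ! k)" by (rule near_mono) (use k in simp)
        have g: "geodesic D (P ! k) (drop k P) y" using geodesic_drop[OF P k(1)] .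
        have l: "length (drop k P) - 1 = 1" using k by simp
        have "ereal (real (vwalk_length (drop k P))) = ddist D (P ! k) y"
          using g unfolding geodesic_def by blast
        then have "ddist D (P ! k) y = 1" using l by (simp add: one_ereal_def)
        moreover have "y \<in> verts D" using conn_verts[OF near_conn[OF y]] by blast
        ultimately show ?thesis using 1 by blast
      qed
    qed
    moreover have "finite ?B"
    proof (intro finite.insertI finite_UN_I Suc)
      fix z assume "z \<in> {z. near D (real n) x z}"
      then have "z \<in> verts D" using conn_verts[OF near_conn, of D "real n" x z] by simp
      from finite_out[OF this] show "finite {y \<in> verts D. ddist D z y = 1}"
        unfolding finite_out_degree_def .
    qed
    ultimately show ?case by (rule finite_subset)
  qed
  have "{y. near D r x y} \<subseteq> {y. near D (real (nat \<lceil>r\<rceil>)) x y}"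
    by (intro Collect_mono impI) (erule near_mono, linarith)
  then show ?thesis using nat by (rule finite_subset)
qed

text \<open>
  In-balls may be infinite, but a point reached from \<open>x0\<close> with bounded distance to \<open>w\<close> has bounded
  distance from \<open>x0\<close> by (B2). So the digraph is locally finite, in both directions, within the
  vertices that \<open>x0\<close> reaches.
\<close>

lemma finite_reachable_nbhd:
  assumes "finite F"
  shows "finite {q. conn D x0 q \<and> (\<exists>w\<in>F. near D C q w \<or> near D C w q)}"
proof -
  have "finite {q. conn D x0 q \<and> near D C q w}" for w
  proof (cases "conn D x0 w")
    case True
    then obtain r where r: "near D r x0 w" by (rule conn_near)
    have "near D (f (max r C)) x0 q" if "conn D x0 q" "near D C q w" for q
      by (rule near_of_common_target[OF near_mono[OF r] near_mono[OF that(2)] that(1)]) auto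
    then have "{q. conn D x0 q \<and> near D C q w} \<subseteq> {q. near D (f (max r C)) x0 q}" by auto
    then show ?thesis using finite_near by (rule finite_subset)
  next
    case False
    have e: "{q. conn D x0 q \<and> near D C q w} = {}"
      using False conn_trans[OF _ near_conn[of D C _ w], of x0] by auto
    show ?thesis unfolding e by (rule finite.emptyI)
  qed
  then have "finite (\<Union>w\<in>F. {q. conn D x0 q \<and> near D C q w} \<union> {q. near D C w q})"
    using assms finite_near by auto
  then show ?thesis by (rule rev_finite_subset) auto
qed

lemma escaping_geodesic_liminf:
  assumes link: "linked D R Q"
    and esc: "\<And>C v. \<exists>M. \<forall>n m W w. M \<le> n \<longrightarrow> M \<le> m \<longrightarrow> geodesic D (R n) W (Q m) \<longrightarrow> w \<in> set W \<longrightarrow> \<not> near D C w v"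
  shows "ereal C \<le> geodesic_liminf D s R Q"
proof (rule geodesic_liminf_ge)
  show "\<And>N. \<exists>n\<ge>N. \<exists>m\<ge>N. conn D (R n) (Q m)" using link unfolding linked_def by simp
  \<comment> \<open>The out-ball around \<open>s\<close> is finite, so it suffices to avoid each of its vertices.\<close>
  define E where "E C v M \<longleftrightarrow> (\<forall>n m W w. M \<le> n \<longrightarrow> M \<le> m \<longrightarrow> geodesic D (R n) W (Q m) \<longrightarrow> w \<in> set W
    \<longrightarrow> \<not> near D C w v)" for C v and M :: nat
  have E_mono: "E C v M'" if "E C v M" "M \<le> M'" for C v M M'
    using that order_trans[OF that(2)] unfolding E_def by blast
  have ex: "eventually (E C v) sequentially" for C v
  proof -
    obtain M where "E C v M" using esc[of C v] unfolding E_def by blast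
    then show ?thesis unfolding eventually_sequentially using E_mono by blast
  qed
  have "eventually (\<lambda>M. \<forall>v\<in>{v. near D C s v}. E 0 v M) sequentially"
    by (rule eventually_ball_finite[OF finite_near]) (use ex in blast)
  then have "eventually (\<lambda>M. E C s M \<and> (\<forall>v\<in>{v. near D C s v}. E 0 v M)) sequentially"
    using ex[of C s] by (rule eventually_conj[rotated])
  then obtain M where M: "E C s M" "\<And>v. near D C s v \<Longrightarrow> E 0 v M"
    unfolding eventually_sequentially by blast
  show "\<exists>M. \<forall>n m W w. M \<le> n \<longrightarrow> M \<le> m \<longrightarrow> geodesic D (R n) W (Q m) \<longrightarrow> w \<in> set W
      \<longrightarrow> \<not> near D C s w \<and> \<not> near D C w s"
  proof (intro exI[of _ M] allI impI conjI)
    fix n m W w assume a: "M \<le> n" "M \<le> m" "geodesic D (R n) W (Q m)" "w \<in> set W"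
    show "\<not> near D C w s" using M(1) a unfolding E_def by simp
    show "\<not> near D C s w"
    proof
      assume "near D C s w"
      from M(2)[OF this] a have "\<not> near D 0 w w" unfolding E_def by simp
      with near_refl[OF geodesic_mem(3)[OF a(3,4)]] show False by simp
    qed
  qed
qed

text \<open>
  Koenig's lemma for the quantifier "for infinitely many \<open>j\<close> and, for each of them, infinitely many
  \<open>m\<close>". It is preserved when finitely many possibilities for the next vertex are distinguished, so
  no subsequence in \<open>j\<close> or \<open>m\<close> has to be fixed. The double indexing treats vertices (where \<open>P j m\<close> does
  not depend on \<open>m\<close>) and boundary points alike.
\<close>

lemma exists_common_prefix:
  fixes P :: "nat \<Rightarrow> nat \<Rightarrow> 'a list"
  assumes geo: "\<And>j. eventually (\<lambda>m. geodesic D x0 (P j m) (R j m)) sequentially"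
    and long: "\<And>N. eventually (\<lambda>j. eventually (\<lambda>m. N < length (P j m)) sequentially) sequentially"
  shows "\<exists>G. \<forall>N. \<exists>\<^sub>F j in sequentially. \<exists>\<^sub>F m in sequentially.
      geodesic D x0 (P j m) (R j m) \<and> N < length (P j m) \<and> (\<forall>i\<le>N. P j m ! i = G i)"
proof -
  define \<Phi> where "\<Phi> n \<sigma> \<longleftrightarrow> length \<sigma> = Suc n \<and> (\<exists>\<^sub>F j in sequentially. \<exists>\<^sub>F m in sequentially.
      geodesic D x0 (P j m) (R j m) \<and> n < length (P j m) \<and> take (Suc n) (P j m) = \<sigma>)" for n \<sigma>
  have freq: "\<exists>\<^sub>F j in sequentially. \<exists>\<^sub>F m in sequentially. A j m \<and> B j m"
    if "\<exists>\<^sub>F j in sequentially. \<exists>\<^sub>F m in sequentially. A j m"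
      "eventually (\<lambda>j. eventually (B j) sequentially) sequentially" for A B :: "nat \<Rightarrow> nat \<Rightarrow> bool"
    by (rule frequently_rev_mp[OF that(1)], rule eventually_mono[OF that(2)])
       (auto elim: frequently_rev_mp eventually_mono)
  have "\<exists>g. \<forall>n. \<Phi> n (g n) \<and> take (Suc n) (g (Suc n)) = g n"
  proof (rule dependent_nat_choice)
    have "\<Phi> 0 [x0]"
      unfolding \<Phi>_def
    proof (intro conjI)
      have "eventually (\<lambda>m. geodesic D x0 (P j m) (R j m) \<and> 0 < length (P j m) \<and> take (Suc 0) (P j m) = [x0]) sequentially" for j
        using geo[of j]
      proof eventually_elim
        case (elim m)
        then show ?case using geodesic_basic(2,9)[OF elim] by (cases "P j m") auto
      qed
      note * = eventually_frequently[OF sequentially_bot this]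
      show "\<exists>\<^sub>F j in sequentially. \<exists>\<^sub>F m in sequentially.
          geodesic D x0 (P j m) (R j m) \<and> 0 < length (P j m) \<and> take (Suc 0) (P j m) = [x0]"
        by (rule eventually_frequently[OF sequentially_bot always_eventually], rule allI, rule *)
    qed simp
    then show "\<exists>\<sigma>. \<Phi> 0 \<sigma>" ..
  next
    fix \<sigma> n assume \<sigma>: "\<Phi> n \<sigma>"
    define F where "F = {y. near D 1 (\<sigma> ! n) y}"
    have fF: "finite F" unfolding F_def by (rule finite_near)
    have "\<exists>\<^sub>F j in sequentially. \<exists>\<^sub>F m in sequentially.
      (geodesic D x0 (P j m) (R j m) \<and> n < length (P j m) \<and> take (Suc n) (P j m) = \<sigma>) \<and> Suc n < length (P j m)"
      by (rule freq) (use \<sigma> long[of "Suc n"] in \<open>auto simp: \<Phi>_def\<close>)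
    then have "\<exists>\<^sub>F j in sequentially. \<exists>\<^sub>F m in sequentially. \<exists>y\<in>F.
      geodesic D x0 (P j m) (R j m) \<and> Suc n < length (P j m) \<and> take (Suc (Suc n)) (P j m) = \<sigma> @ [y]"
    proof (rule frequently_mono[rotated], intro allI impI)
      fix j
      assume "\<exists>\<^sub>F m in sequentially.
        (geodesic D x0 (P j m) (R j m) \<and> n < length (P j m) \<and> take (Suc n) (P j m) = \<sigma>) \<and> Suc n < length (P j m)"
      then show "\<exists>\<^sub>F m in sequentially. \<exists>y\<in>F.
        geodesic D x0 (P j m) (R j m) \<and> Suc n < length (P j m) \<and> take (Suc (Suc n)) (P j m) = \<sigma> @ [y]"
      proof (rule frequently_mono[rotated], intro allI impI)
        fix m assume a: "(geodesic D x0 (P j m) (R j m) \<and> n < length (P j m) \<and> take (Suc n) (P j m) = \<sigma>)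
          \<and> Suc n < length (P j m)"
        then have p: "geodesic D x0 (P j m) (R j m)" and l: "Suc n < length (P j m)"
          and t: "take (Suc n) (P j m) = \<sigma>" by auto
        have "near D 1 (P j m ! n) (P j m ! Suc n)" using geodesic_near[OF p, of n "Suc n"] l by simp
        moreover have "P j m ! n = \<sigma> ! n" using t by (metis lessI nth_take)
        ultimately have "P j m ! Suc n \<in> F" unfolding F_def by simp
        moreover have "take (Suc (Suc n)) (P j m) = \<sigma> @ [P j m ! Suc n]"
          using take_Suc_conv_app_nth[OF l] t by simp
        ultimately show "\<exists>y\<in>F. geodesic D x0 (P j m) (R j m) \<and> Suc n < length (P j m)
            \<and> take (Suc (Suc n)) (P j m) = \<sigma> @ [y]" using p l by blast
      qed
    qed
    then have "\<exists>\<^sub>F j in sequentially. \<exists>y\<in>F. \<exists>\<^sub>F m in sequentially.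
      geodesic D x0 (P j m) (R j m) \<and> Suc n < length (P j m) \<and> take (Suc (Suc n)) (P j m) = \<sigma> @ [y]"
      unfolding frequently_bex_finite_distrib[OF fF] .
    then obtain y where "\<exists>\<^sub>F j in sequentially. \<exists>\<^sub>F m in sequentially.
      geodesic D x0 (P j m) (R j m) \<and> Suc n < length (P j m) \<and> take (Suc (Suc n)) (P j m) = \<sigma> @ [y]"
      unfolding frequently_bex_finite_distrib[OF fF] by blast
    moreover have len: "length \<sigma> = Suc n" using \<sigma> unfolding \<Phi>_def by simp
    ultimately have "\<Phi> (Suc n) (\<sigma> @ [y])" unfolding \<Phi>_def by simp
    moreover have "take (Suc n) (\<sigma> @ [y]) = \<sigma>" using len by simp
    ultimately show "\<exists>\<tau>. \<Phi> (Suc n) \<tau> \<and> take (Suc n) \<tau> = \<sigma>" by blast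
  qed
  then obtain g where g: "\<And>n. \<Phi> n (g n)" "\<And>n. take (Suc n) (g (Suc n)) = g n" by blast
  have pre: "g n ! i = g i ! i" if "i \<le> n" for i n
    using that
  proof (induction n rule: dec_induct)
    case (step n)
    have "g (Suc n) ! i = take (Suc n) (g (Suc n)) ! i" using step by simp
    with step g(2) show ?case by simp
  qed simp
  have "\<exists>\<^sub>F j in sequentially. \<exists>\<^sub>F m in sequentially.
      geodesic D x0 (P j m) (R j m) \<and> N < length (P j m) \<and> (\<forall>i\<le>N. P j m ! i = g i ! i)" for N
  proof -
    have imp: "P j m ! i = g i ! i" if "take (Suc N) (P j m) = g N" "i \<le> N" for j m i
    proof -
      have "P j m ! i = take (Suc N) (P j m) ! i" using that(2) by simp
      then show ?thesis using that(1) pre[OF that(2)] by simp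
    qed
    have "\<exists>\<^sub>F j in sequentially. \<exists>\<^sub>F m in sequentially.
      geodesic D x0 (P j m) (R j m) \<and> N < length (P j m) \<and> take (Suc N) (P j m) = g N"
      using g(1)[of N] unfolding \<Phi>_def by blast
    then show ?thesis by (elim frequently_elim1) (auto simp: imp)
  qed
  then show ?thesis by (intro exI[of _ "\<lambda>n. g n ! n"] allI)
qed

end

text \<open>
  The situation produced by \<open>exists_common_prefix\<close>.
\<close>

locale limit_ray = finite_out_thin_digraph +
  fixes x0 :: 'a and P :: "nat \<Rightarrow> nat \<Rightarrow> 'a list" and R :: "nat \<Rightarrow> nat \<Rightarrow> 'a" and G :: "nat \<Rightarrow> 'a"
  assumes reps_geodesic: "eventually (\<lambda>m. geodesic D x0 (P j m) (R j m)) sequentially"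
    and prefixes: "\<exists>\<^sub>F j in sequentially. \<exists>\<^sub>F m in sequentially.
      geodesic D x0 (P j m) (R j m) \<and> N < length (P j m) \<and> (\<forall>i\<le>N. P j m ! i = G i)"
begin

definition agrees :: "nat \<Rightarrow> nat \<Rightarrow> nat \<Rightarrow> bool" where
  "agrees N j m \<longleftrightarrow> geodesic D x0 (P j m) (R j m) \<and> N < length (P j m) \<and> (\<forall>i\<le>N. P j m ! i = G i)"

lemma frequently_agrees: "\<exists>\<^sub>F j in sequentially. \<exists>\<^sub>F m in sequentially. agrees N j m"
  unfolding agrees_def by (rule prefixes)

lemma agrees_mono: "agrees N j m \<Longrightarrow> N' \<le> N \<Longrightarrow> agrees N' j m"
  unfolding agrees_def by auto

lemma exists_agrees: obtains j m where "agrees N j m"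
  using frequently_ex[OF frequently_agrees] frequently_ex by metis

lemma G_geodesic:
  assumes "i \<le> j" shows "geodesic D (G i) (map G [i..<Suc j]) (G j)"
proof -
  obtain a b where ab: "agrees j a b" by (rule exists_agrees)
  then have p: "geodesic D x0 (P a b) (R a b)" and l: "j < length (P a b)"
    and e: "\<And>k. k \<le> j \<Longrightarrow> P a b ! k = G k" unfolding agrees_def by auto
  have "take (Suc j - i) (drop i (P a b)) = map G [i..<Suc j]"
    using l assms e by (intro nth_equalityI) (auto simp del: upt_Suc)
  with geodesic_subpath[OF p assms l] show ?thesis using e assms by simp
qed

lemma G_starts_at_x0: "G 0 = x0"
proof -
  obtain a b where "agrees 0 a b" by (rule exists_agrees)
  then show ?thesis unfolding agrees_def using geodesic_basic(3) by fastforce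
qed

lemma G_minimal:
  assumes "near D r (G i) (G j)" "i \<le> j" shows "real j - real i \<le> r"
  using geodesic_length_le[OF G_geodesic[OF assms(2)]] geodesic_minimal[OF G_geodesic[OF assms(2)], of 0 "j - i" r]
    assms by (simp add: of_nat_diff del: upt_Suc)

lemma G_conn: "i \<le> j \<Longrightarrow> conn D (G i) (G j)"
  using geodesic_imp_conn[OF G_geodesic] .

lemma G_qg_ray: "qg_ray D G"
  unfolding qg_ray_def ray_def
proof (intro conjI allI)
  show "inj G"
  proof (rule injI)
    have *: "j \<le> i" if "G i = G j" "i \<le> j" for i j
    proof -
      have "near D 0 (G i) (G j)" using near_refl[of "G i" D 0] conn_verts[OF G_conn[OF order_refl, of i]] that by simp
      from G_minimal[OF this that(2)] show ?thesis by simp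
    qed
    fix i j assume eq: "G i = G j"
    show "i = j"
    proof (rule linorder_le_cases[of i j])
      assume "i \<le> j" then show ?thesis using *[OF eq] by simp
    next
      assume "j \<le> i" then show ?thesis using *[OF eq[symmetric]] by simp
    qed
  qed
  have "G i \<in> verts D" for i using conn_verts[OF G_conn[OF order_refl, of i]] by simp
  then show "range G \<subseteq> verts D" by (rule image_subsetI)
  show "(G i, G (Suc i)) \<in> arcs_ends D" for i
    using geodesic_basic(6)[OF G_geodesic[of i "Suc i"]] unfolding vwalk_def by simp
  have qg: "quasi_geodesic D 1 0 (map G [m..<Suc n])" if mn: "m \<le> n" for m n
    unfolding quasi_geodesic_def
  proof (intro conjI allI impI)
    show "vwalk (map G [m..<Suc n]) D" by (rule geodesic_basic(6)[OF G_geodesic[OF mn]])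
    fix i j assume ij: "i \<le> j \<and> j < length (map G [m..<Suc n])"
    let ?q = "map G [m + i..<Suc (m + j)]"
    have "ereal (real (vwalk_length ?q)) = ddist D (G (m + i)) (G (m + j))"
      using G_geodesic[of "m + i" "m + j"] ij unfolding geodesic_def by (simp del: upt_Suc vwalk_length_simp)
    moreover have "vwalk_length ?q = j - i" using ij by (simp del: upt_Suc)
    moreover have "m + i < Suc n" "m + j < Suc n" using ij by (simp_all del: upt_Suc) linarith+
    then have "map G [m..<Suc n] ! i = G (m + i)" "map G [m..<Suc n] ! j = G (m + j)"
      by (simp_all add: nth_map_upt del: upt_Suc)
    ultimately show "ereal (real (j - i)) \<le> ereal 1 * ddist D (map G [m..<Suc n] ! i) (map G [m..<Suc n] ! j) + ereal 0"
      by (simp del: upt_Suc)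
  qed
  show "\<exists>\<gamma>\<ge>1. \<exists>c\<ge>0. \<forall>m n. m \<le> n \<longrightarrow> quasi_geodesic D \<gamma> c (map G [m..<Suc n])"
    by (rule exI[of _ 1], rule conjI[OF order_refl], rule exI[of _ 0], rule conjI[OF order_refl])
       (intro allI impI qg)
qed

text \<open>
  A geodesic from \<open>y\<close> to a far \<open>R k m\<close> leaves the finite neighbourhood of a geodesic from \<open>x0\<close> to \<open>y\<close>
  after a number of steps that does not depend on \<open>k\<close> and \<open>m\<close>. There it gets close to \<open>P k m\<close>, at a
  bounded distance from \<open>x0\<close>, where \<open>P k m\<close> agrees with \<open>G\<close>.
\<close>

lemma reaches_limit_ray:
  assumes x0y: "conn D x0 y"
    and y: "\<And>k. K \<le> k \<Longrightarrow> eventually (\<lambda>m. conn D y (R k m)) sequentially"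
  shows "\<exists>i. conn D y (G i)"
proof -
  obtain T where T: "geodesic D x0 T y" using geodesic_exists[OF x0y] .
  obtain r where r: "near D r x0 y" using x0y by (rule conn_near)
  have "finite (\<Union>q\<in>set T. {v. near D \<delta> q v})" using finite_near by auto
  from finite_near_bound[OF this, of D y] obtain t0
    where t0: "\<forall>v\<in>\<Union>q\<in>set T. {v. near D \<delta> q v}. conn D y v \<longrightarrow> near D t0 y v" ..
  define t where "t = nat \<lceil>max 0 t0\<rceil> + 1"
  have t: "t0 < real t" unfolding t_def by linarith
  define N where "N = nat \<lceil>r + real t + \<delta>\<rceil>"
  have N: "r + real t + \<delta> \<le> real N" unfolding N_def by linarith
  have "\<exists>\<^sub>F j in sequentially. K \<le> j \<and> (\<exists>\<^sub>F m in sequentially. agrees N j m)"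
    by (rule frequently_rev_mp[OF frequently_agrees[of N]]) (auto simp: eventually_sequentially)
  then obtain k where k: "K \<le> k" "\<exists>\<^sub>F m in sequentially. agrees N k m" using frequently_ex by blast
  have "\<exists>\<^sub>F m in sequentially. conn D y (R k m) \<and> agrees N k m"
    by (rule frequently_rev_mp[OF k(2)], rule eventually_mono[OF y[OF k(1)]]) simp
  then obtain m where m: "conn D y (R k m)" "agrees N k m" using frequently_ex by blast
  from m(2) have p: "geodesic D x0 (P k m) (R k m)" "N < length (P k m)" "\<And>i. i \<le> N \<Longrightarrow> P k m ! i = G i"
    unfolding agrees_def by auto
  obtain U where U: "geodesic D y U (R k m)" using geodesic_exists[OF m(1)] .
  have lU: "t < length U"
  proof (rule ccontr)
    assume "\<not> t < length U"
    then have "near D (real t - 1) y (R k m)"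
      using near_mono[OF geodesic_length_near[OF U], of "real t - 1"] by simp
    from geodesic_length_le[OF p(1) near_trans[OF r this]] p(2) N delta_nonneg show False by linarith
  qed
  define v where "v = U ! t"
  have v: "v \<in> set U" using lU unfolding v_def by simp
  have yv: "near D (real t) y v"
    using geodesic_near[OF U, of 0 t] lU geodesic_basic(3)[OF U] unfolding v_def by simp
  from thin_triangle_point[OF U geodesic_betweenI2[OF T] geodesic_betweenI2[OF p(1)] v]
  show ?thesis
  proof (elim disjE bexE)
    fix q assume "q \<in> set T" "near D \<delta> q v"
    then have "near D t0 y v" using t0 near_conn[OF yv] by blast
    then have "near D t0 (U ! 0) (U ! t)" using geodesic_basic(3)[OF U] unfolding v_def by simp
    from geodesic_minimal[OF U _ lU this] t show ?thesis by simp
  next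
    fix q assume q: "q \<in> set (P k m)" "near D \<delta> v q"
    have yq: "near D (real t + \<delta>) y q" by (rule near_trans[OF yv q(2)])
    have x0q: "near D (real N) x0 q" by (rule near_trans_le[OF r yq]) (use N in simp)
    obtain i where i: "i < length (P k m)" "q = P k m ! i" using q(1) by (metis in_set_conv_nth)
    have "near D (real N) (P k m ! 0) (P k m ! i)" using x0q i(2) geodesic_basic(3)[OF p(1)] by simp
    from geodesic_minimal[OF p(1) _ i(1) this] have "i \<le> N" by simp
    then have "q = G i" using p(3) i(2) by simp
    then show ?thesis using near_conn[OF yq] by blast
  qed
qed

text \<open>
  All vertices within \<open>C\<close> of \<open>s\<close> in either direction that \<open>x0\<close> reaches form a finite set \<open>F\<close>. If a geodesic
  from \<open>R j m\<close> to \<open>G n\<close> met \<open>F\<close>, then a geodesic from some \<open>R j m'\<close> to \<open>G n\<close> would meet the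
  \<open>\<delta>\<close>-neighbourhood \<open>F1\<close> of \<open>F\<close>, where the geodesic \<open>P j m'\<close> follows \<open>G\<close> up to \<open>G N\<close>. By thinness of the
  triangle \<open>G N\<close>, \<open>R j m'\<close>, \<open>G n\<close> there would be a point of the finite set \<open>F2\<close> at distance at least
  \<open>N\<close> from \<open>x0\<close>.
\<close>

lemma geodesics_to_limit_far:
  assumes types: "\<And>j. (\<exists>x. R j = (\<lambda>_. x)) \<or> qg_ray D (R j) \<or> qg_anti_ray D (R j)"
  shows "\<exists>N. \<forall>j. (\<exists>\<^sub>F m in sequentially. agrees N j m) \<longrightarrow>
    (\<exists>M. \<forall>m n W w. M \<le> m \<longrightarrow> M \<le> n \<longrightarrow> geodesic D (R j m) W (G n) \<longrightarrow> w \<in> set W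
       \<longrightarrow> \<not> near D C s w \<and> \<not> near D C w s)"
proof -
  define nbhd where "nbhd r F = {q. conn D x0 q \<and> (\<exists>w\<in>F. near D r q w \<or> near D r w q)}" for r F
  have fin: "finite F \<Longrightarrow> finite (nbhd r F)" for r F unfolding nbhd_def by (rule finite_reachable_nbhd)
  define F where "F = nbhd C {s}"
  define F1 where "F1 = nbhd \<delta> F"
  define F2 where "F2 = nbhd \<delta> F1"
  have fins: "finite F" "finite F1" "finite F2" unfolding F_def F1_def F2_def by (simp_all add: fin)
  obtain t where t: "\<forall>q\<in>F2. conn D x0 q \<longrightarrow> near D t x0 q" using finite_near_bound[OF fins(3)] ..
  define N where "N = nat \<lceil>max 0 t\<rceil> + 1"
  have N: "t < real N" unfolding N_def by linarith
  have escape: "\<exists>M. \<forall>m n W w. M \<le> m \<longrightarrow> M \<le> n \<longrightarrow> geodesic D (R j m) W (G n) \<longrightarrow> w \<in> set W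
       \<longrightarrow> w \<notin> F" if freq: "\<exists>\<^sub>F m in sequentially. agrees N j m" for j
  proof -
    \<comment> \<open>Far out, the point \<open>R j m\<close> can be replaced by some \<open>R j m'\<close> with a geodesic from \<open>x0\<close> that follows \<open>G\<close>.\<close>
    have key: "\<exists>M. \<forall>m\<ge>M. \<exists>m'. agrees N j m' \<and> (R j m' = R j m \<or>
        (conn D (R j m') (R j m) \<and> (\<forall>W q. geodesic D (R j m') W (R j m) \<longrightarrow> q \<in> set W \<longrightarrow> q \<notin> F1)))"
      using types[of j]
    proof (elim disjE exE)
      fix x assume "R j = (\<lambda>_. x)"
      then show ?thesis using frequently_ex[OF freq] by auto
    next
      assume ray: "qg_ray D (R j)"
      have "eventually (\<lambda>m. \<forall>v\<in>F1. \<forall>n W w. m \<le> n \<longrightarrow> geodesic D (R j m) W (R j n) \<longrightarrow> w \<in> set W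
          \<longrightarrow> \<not> near D 0 v w) sequentially"
      proof (rule eventually_ball_finite[OF fins(2)], rule ballI)
        fix v
        from ray_geodesics_escape[OF ray, of 0 v]
        show "eventually (\<lambda>m. \<forall>n W w. m \<le> n \<longrightarrow> geodesic D (R j m) W (R j n) \<longrightarrow> w \<in> set W
          \<longrightarrow> \<not> near D 0 v w) sequentially" unfolding eventually_sequentially by (elim exE) blast
      qed
      from frequently_ex[OF frequently_rev_mp[OF freq eventually_mono[OF this,
          of "\<lambda>m. agrees N j m \<longrightarrow> agrees N j m \<and> (\<forall>v\<in>F1. \<forall>n W w. m \<le> n \<longrightarrow>
          geodesic D (R j m) W (R j n) \<longrightarrow> w \<in> set W \<longrightarrow> \<not> near D 0 v w)"]]]
      obtain m' where m': "agrees N j m'" "\<forall>v\<in>F1. \<forall>n W w. m' \<le> n \<longrightarrow>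
          geodesic D (R j m') W (R j n) \<longrightarrow> w \<in> set W \<longrightarrow> \<not> near D 0 v w" by blast
      show ?thesis
      proof (intro exI[of _ m'] allI impI conjI disjI2 m'(1))
        fix m assume m: "m' \<le> m"
        show "conn D (R j m') (R j m)" using ascending_qg_ray[OF ray] m unfolding ascending_def by simp
        fix W q assume W: "geodesic D (R j m') W (R j m)" "q \<in> set W"
        show "q \<notin> F1"
          using m'(2)[rule_format, of q m W q] m W near_refl[OF geodesic_mem(3)[OF W], of 0] by simp blast
      qed
    next
      assume anti: "qg_anti_ray D (R j)"
      have "eventually (\<lambda>m. \<forall>v\<in>F1. \<forall>n W w. m \<le> n \<longrightarrow> geodesic D (R j n) W (R j m) \<longrightarrow> w \<in> set W
          \<longrightarrow> \<not> near D 0 w v) sequentially"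
      proof (rule eventually_ball_finite[OF fins(2)], rule ballI)
        fix v
        from anti_ray_geodesics_escape[OF anti, of 0 v]
        show "eventually (\<lambda>m. \<forall>n W w. m \<le> n \<longrightarrow> geodesic D (R j n) W (R j m) \<longrightarrow> w \<in> set W
          \<longrightarrow> \<not> near D 0 w v) sequentially" unfolding eventually_sequentially by (elim exE) blast
      qed
      then obtain M where M: "\<forall>m\<ge>M. \<forall>v\<in>F1. \<forall>n W w. m \<le> n \<longrightarrow> geodesic D (R j n) W (R j m) \<longrightarrow> w \<in> set W
          \<longrightarrow> \<not> near D 0 w v" unfolding eventually_sequentially ..
      show ?thesis
      proof (rule exI[of _ M], intro allI impI)
        fix m assume m: "M \<le> m"
        obtain m' where m': "m \<le> m'" "agrees N j m'"
          using freq unfolding frequently_sequentially by blast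
        show "\<exists>m'. agrees N j m' \<and> (R j m' = R j m \<or>
          (conn D (R j m') (R j m) \<and> (\<forall>W q. geodesic D (R j m') W (R j m) \<longrightarrow> q \<in> set W \<longrightarrow> q \<notin> F1)))"
        proof (intro exI[of _ m'] conjI disjI2 allI impI m'(2))
          show "conn D (R j m') (R j m)" by (rule qg_anti_ray_conn[OF anti m'(1)])
          fix W q assume W: "geodesic D (R j m') W (R j m)" "q \<in> set W"
          show "q \<notin> F1" using M m m'(1) W near_refl[OF geodesic_mem(3)[OF W], of 0] by auto
        qed
      qed
    qed
    then obtain M1 where M1: "\<forall>m\<ge>M1. \<exists>m'. agrees N j m' \<and> (R j m' = R j m \<or>
        (conn D (R j m') (R j m) \<and> (\<forall>W q. geodesic D (R j m') W (R j m) \<longrightarrow> q \<in> set W \<longrightarrow> q \<notin> F1)))" ..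
    show ?thesis
    proof (intro exI[of _ "max M1 N"] allI impI notI)
      fix m n W w assume mn: "max M1 N \<le> m" "max M1 N \<le> n" and W: "geodesic D (R j m) W (G n)"
        and w: "w \<in> set W" and wF: "w \<in> F"
      obtain m' where m': "agrees N j m'" "R j m' = R j m \<or>
        (conn D (R j m') (R j m) \<and> (\<forall>W q. geodesic D (R j m') W (R j m) \<longrightarrow> q \<in> set W \<longrightarrow> q \<notin> F1))"
        using M1 mn(1) by auto
      from m'(1) have p: "geodesic D x0 (P j m') (R j m')" "N < length (P j m')" "P j m' ! N = G N"
        unfolding agrees_def by auto
      have x0m': "conn D x0 (R j m')" by (rule geodesic_imp_conn[OF p(1)])
      obtain W' q where W': "geodesic D (R j m') W' (G n)" "q \<in> set W'" "q \<in> F1"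
        using m'(2)
      proof (elim disjE conjE)
        assume eq: "R j m' = R j m"
        have "conn D x0 w" using conn_trans[OF x0m'] geodesic_mem(1)[OF W w] eq by simp
        moreover have "near D \<delta> w w" by (rule near_refl[OF geodesic_mem(3)[OF W w] delta_nonneg])
        ultimately have "w \<in> F1" using wF unfolding F1_def nbhd_def by blast
        with W w eq show ?thesis using that by simp
      next
        assume c: "conn D (R j m') (R j m)"
          and av: "\<forall>W q. geodesic D (R j m') W (R j m) \<longrightarrow> q \<in> set W \<longrightarrow> q \<notin> F1"
        obtain A where A: "geodesic D (R j m') A (R j m)" using geodesic_exists[OF c] .
        obtain W' where W': "geodesic D (R j m') W' (G n)"
          using geodesic_exists[OF conn_trans[OF c geodesic_imp_conn[OF W]]] .
        from thin_triangle_point[OF W geodesic_betweenI2[OF A] geodesic_betweenI2[OF W'] w] show ?thesis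
        proof (elim disjE bexE)
          fix q assume q: "q \<in> set A" "near D \<delta> q w"
          have "conn D x0 q" by (rule conn_trans[OF x0m' geodesic_mem(1)[OF A q(1)]])
          then have "q \<in> F1" using q(2) wF unfolding F1_def nbhd_def by blast
          with av A q(1) show ?thesis by blast
        next
          fix q assume q: "q \<in> set W'" "near D \<delta> w q"
          have "conn D x0 q" by (rule conn_trans[OF x0m' geodesic_mem(1)[OF W' q(1)]])
          then have "q \<in> F1" using q(2) wF unfolding F1_def nbhd_def by blast
          then show ?thesis by (rule that[OF W' q(1)])
        qed
      qed
      have P': "geodesic D (G N) (drop N (P j m')) (R j m')" using geodesic_drop[OF p(1,2)] p(3) by simp
      have Nn: "N \<le> n" using mn(2) by simp
      from thin_triangle_point[OF W'(1) geodesic_betweenI2[OF P'] geodesic_betweenI2[OF G_geodesic[OF Nn]] W'(2)]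
      show False
      proof (elim disjE bexE)
        fix q' assume q': "q' \<in> set (drop N (P j m'))" "near D \<delta> q' q"
        obtain k where "k < length (drop N (P j m'))" "q' = drop N (P j m') ! k"
          using q'(1) by (metis in_set_conv_nth)
        then have i: "N + k < length (P j m')" "q' = P j m' ! (N + k)" by auto
        have "conn D x0 q'"
          using geodesic_conn[OF p(1), of 0 "N + k"] i geodesic_basic(3)[OF p(1)] by simp
        moreover from this have "q' \<in> F2" using q'(2) W'(3) unfolding F2_def nbhd_def by blast
        ultimately have "near D t (P j m' ! 0) (P j m' ! (N + k))"
          using t i(2) geodesic_basic(3)[OF p(1)] by simp
        from geodesic_minimal[OF p(1) _ i(1) this] N show False by simp
      next
        fix q' assume q': "q' \<in> set (map G [N..<Suc n])" "near D \<delta> q q'"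
        then obtain i where i: "N \<le> i" "q' = G i" by (auto simp del: upt_Suc)
        have "conn D x0 q'" using G_conn[of 0 i] G_starts_at_x0 i(2) by simp
        moreover from this have "q' \<in> F2" using q'(2) W'(3) unfolding F2_def nbhd_def by blast
        ultimately have "near D t (G 0) (G i)" using t i(2) G_starts_at_x0 by simp
        from G_minimal[OF this] i(1) N show False by simp
      qed
    qed
  qed
  show ?thesis
  proof (rule exI[of _ N], intro allI impI)
    fix j assume freq: "\<exists>\<^sub>F m in sequentially. agrees N j m"
    obtain M where M: "\<forall>m n W w. M \<le> m \<longrightarrow> M \<le> n \<longrightarrow> geodesic D (R j m) W (G n) \<longrightarrow> w \<in> set W
       \<longrightarrow> w \<notin> F" using escape[OF freq] ..
    obtain M' where M': "\<forall>m\<ge>M'. geodesic D x0 (P j m) (R j m)"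
      using reps_geodesic[of j] unfolding eventually_sequentially ..
    show "\<exists>M. \<forall>m n W w. M \<le> m \<longrightarrow> M \<le> n \<longrightarrow> geodesic D (R j m) W (G n) \<longrightarrow> w \<in> set W
       \<longrightarrow> \<not> near D C s w \<and> \<not> near D C w s"
    proof (intro exI[of _ "max M M'"] allI impI)
      fix m n W w assume a: "max M M' \<le> m" "max M M' \<le> n" and W: "geodesic D (R j m) W (G n)"
        and w: "w \<in> set W"
      have "geodesic D x0 (P j m) (R j m)" using M' a(1) by simp
      from conn_trans[OF geodesic_imp_conn[OF this] geodesic_mem(1)[OF W w]] have "conn D x0 w" .
      moreover have "w \<notin> F" using M[rule_format, OF _ _ W w] a by simp
      ultimately show "\<not> near D C s w \<and> \<not> near D C w s" unfolding F_def nbhd_def by simp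
    qed
  qed
qed

end

section \<open>Sequential compactness\<close>

lemma rho_base_le:
  assumes S: "finite S" "S \<noteq> {}" and eps: "0 < \<epsilon>"
    and L: "\<And>s. s \<in> S \<Longrightarrow> \<exists>R\<in>reps \<eta>. \<exists>Q\<in>reps \<xi>. ereal C \<le> geodesic_liminf G s R Q"
  shows "rho_base G \<epsilon> S \<eta> \<xi> \<le> ennreal (exp (- (\<epsilon> * C)))"
proof -
  have "rho G \<epsilon> s \<eta> \<xi> \<le> ennreal (exp (- (\<epsilon> * C)))" if s: "s \<in> S" for s
  proof -
    obtain R Q where "R \<in> reps \<eta>" "Q \<in> reps \<xi>" "ereal C \<le> geodesic_liminf G s R Q" using L[OF s] by blast
    then show ?thesis by (rule rho_le[OF _ _ _ eps])
  qed
  then show ?thesis unfolding rho_base_def using S by (simp add: Max_le_iff)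
qed

lemma exists_exp_less:
  fixes e \<epsilon> :: real assumes "0 < e" "0 < \<epsilon>"
  obtains C where "exp (- (\<epsilon> * C)) < e"
proof (rule that[of "(1 - ln e) / \<epsilon>"])
  have "exp (- (\<epsilon> * ((1 - ln e) / \<epsilon>))) = exp (ln e - 1)" using assms(2) by simp
  also have "\<dots> < exp (ln e)" by simp
  also have "\<dots> = e" using assms(1) by simp
  finally show "exp (- (\<epsilon> * ((1 - ln e) / \<epsilon>))) < e" .
qed

lemma strict_mono_choice:
  assumes "\<And>t. \<exists>\<^sub>F j in sequentially. A t j"
  shows "\<exists>k :: nat \<Rightarrow> nat. strict_mono k \<and> (\<forall>t. A t (k t))"
proof -
  have ex: "\<exists>j>n. A t j" for t n
    using assms[of t] unfolding frequently_sequentially by (meson Suc_le_lessD)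
  have "\<exists>k. \<forall>t. A t (k t) \<and> k t < k (Suc t)"
    by (rule dependent_nat_choice) (use ex in blast)+
  then obtain k where k: "\<And>t. A t (k t)" "\<And>t. k t < k (Suc t)" by blast
  then show ?thesis by (intro exI[of _ k]) (simp add: strict_mono_Suc_iff)
qed

context finite_out_thin_digraph
begin

text \<open>
  A vertex or a ray reaches everything it is linked to from each of its members, and an anti-ray
  linked to a vertex or a ray reaches it from all but finitely many members. So only pairs of
  anti-rays can fail: there the member needed to reach \<open>R j m\<close> may depend on \<open>m\<close>.
\<close>

lemma reaches_tail_or_anti_rays:
  fixes x :: "nat \<Rightarrow> 'a bpoint"
  assumes Y: "\<And>i. x i \<in> bd_completion D" and R: "\<And>i. R i \<in> reps (x i)"
    and link: "\<And>i j. i < j \<Longrightarrow> linked D (R i) (R j)"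
  obtains (reaches) K M :: nat where "\<And>k m. K \<le> k \<Longrightarrow> M \<le> m \<Longrightarrow> linked D (\<lambda>_. R i m) (R k)"
    | (anti_rays) "\<And>j. i \<le> j \<Longrightarrow> qg_anti_ray D (R j)" "\<And>h j. i < j \<Longrightarrow> \<exists>m. \<not> conn D (R i h) (R j m)"
proof -
  have mono: "ascending D (R j) \<or> descending D (R j)" for j using reps_monotone[OF Y R] .
  have verts: "R j m \<in> verts D" for j m using reps_in_verts[OF Y R] .
  have anti: "qg_anti_ray D (R j)" if "\<not> ascending D (R j)" for j
    using Y[of j] R[of j]
  proof (cases rule: bd_completion_repsE)
    case (vertex v) then show ?thesis using that ascending_const[of v D] by simp
  next
    case ray then show ?thesis using that ascending_qg_ray by blast
  qed
  have up: "linked D (\<lambda>_. R j m) (R k)" if asc: "ascending D (R j)" and jk: "j < k" for j k m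
    unfolding linked_def
  proof
    fix N
    obtain n m' where n: "max N m \<le> n" "max N m \<le> m'" "conn D (R j n) (R k m')"
      using link[OF jk] unfolding linked_def by blast
    have "conn D (R j m) (R j n)" using asc n(1) unfolding ascending_def by simp
    from conn_trans[OF this n(3)] n(2) show "\<exists>n\<ge>N. \<exists>m'\<ge>N. conn D (R j m) (R k m')"
      by (intro exI[of _ N] conjI exI[of _ m']) auto
  qed
  have const: "ascending D (\<lambda>_. R j m)" for j m by (rule ascending_const[OF verts])
  have via: "linked D (\<lambda>_. R i m) (R k)"
    if h: "conn D (R i h) v" and v: "linked D (\<lambda>_. v) (R k)" and desc: "descending D (R i)" and hm: "h \<le> m" for h m v k
  proof -
    have "conn D (R i m) v" using conn_trans[OF _ h] desc hm unfolding descending_def by simp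
    then have "linked D (\<lambda>_. R i m) (\<lambda>_. v)" unfolding linked_def by auto
    then show ?thesis
      by (rule linked_trans[OF _ v]) (use conn_verts[OF h] in \<open>simp add: ascending_const\<close>)
  qed
  show ?thesis
  proof (cases "ascending D (R i)")
    case True
    show ?thesis by (rule reaches[of "Suc i" 0]) (rule up[OF True], simp)
  next
    case False
    then have desc: "descending D (R i)" using mono by blast
    show ?thesis
    proof (cases "\<exists>j>i. ascending D (R j)")
      case True
      then obtain j where j: "i < j" "ascending D (R j)" by blast
      obtain h v where h: "conn D (R i h) (R j v)" using link[OF j(1)] unfolding linked_def by blast
      show ?thesis
      proof (rule reaches[of "Suc j" h])
        fix k m assume "Suc j \<le> k" "h \<le> m"
        then show "linked D (\<lambda>_. R i m) (R k)" by (intro via[OF h up[OF j(2)] desc]) auto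
      qed
    next
      case nasc: False
      show ?thesis
      proof (cases "\<exists>j>i. \<exists>h. \<forall>m. conn D (R i h) (R j m)")
        case True
        then obtain j h where j: "i < j" "\<forall>m. conn D (R i h) (R j m)" by blast
        have hj: "linked D (\<lambda>_. R i h) (R j)" using j(2) unfolding linked_def by auto
        show ?thesis
        proof (rule reaches[of "Suc j" h])
          fix k m assume "Suc j \<le> k" and hm: "h \<le> m"
          then have "linked D (R j) (R k)" using link by simp
          then have "linked D (\<lambda>_. R i h) (R k)" by (rule linked_trans[OF hj _ mono])
          then show "linked D (\<lambda>_. R i m) (R k)" by (rule via[OF conn_refl[OF verts] _ desc hm])
        qed
      next
        case none: False
        show ?thesis
        proof (rule anti_rays)
          fix j assume "i \<le> j"
          then have "\<not> ascending D (R j)" using False nasc by (cases "i = j") auto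
          then show "qg_anti_ray D (R j)" by (rule anti)
        next
          fix h j assume "i < j"
          then show "\<exists>m. \<not> conn D (R i h) (R j m)" using none by blast
        qed
      qed
    qed
  qed
qed

lemma anti_ray_pair_liminf:
  assumes R0: "qg_anti_ray D R0" and R1: "qg_anti_ray D R1" and link: "linked D R0 R1"
    and no: "\<And>h. \<exists>m. \<not> conn D (R0 h) (R1 m)"
  shows "ereal C \<le> geodesic_liminf D s R1 R0"
proof (rule escaping_geodesic_liminf)
  have link': "\<exists>n\<ge>N. conn D (R0 n) (R1 m)" for N m
  proof -
    obtain n m' where "max N m \<le> n" "max N m \<le> m'" "conn D (R0 n) (R1 m')"
      using link unfolding linked_def by blast
    then show ?thesis using conn_trans[of D "R0 n" "R1 m'" "R1 m"] qg_anti_ray_conn[OF R1, of m m'] by auto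
  qed
  show "linked D R1 R0"
    unfolding linked_def
  proof
    fix N
    obtain m where m: "conn D (R1 m) (R0 N)" using anti_ray_reached_back[OF R0 R1 link' no] ..
    have "conn D (R1 (max m N)) (R0 N)" by (rule conn_trans[OF qg_anti_ray_conn[OF R1] m]) simp
    then show "\<exists>n\<ge>N. \<exists>m\<ge>N. conn D (R1 n) (R0 m)" by (intro exI[of _ "max m N"] conjI exI[of _ N]) auto
  qed
  show "\<exists>M. \<forall>n m W w. M \<le> n \<longrightarrow> M \<le> m \<longrightarrow> geodesic D (R1 n) W (R0 m) \<longrightarrow> w \<in> set W \<longrightarrow> \<not> near D C w v" for C v
    by (rule anti_ray_pair_geodesics_escape[OF R0 R1 link' no])
qed

lemma convergence_criterion:
  fixes x :: "nat \<Rightarrow> 'a bpoint"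
  assumes S: "finite S" "S \<noteq> {}" and eps: "0 < \<epsilon>" and Y: "\<And>k. x k \<in> bd_completion D" "l \<in> bd_completion D"
    and L: "\<And>C. eventually (\<lambda>k. \<forall>s\<in>S. \<exists>R\<in>reps (x k). \<exists>Q\<in>reps l. ereal C \<le> geodesic_liminf D s R Q) sequentially"
  shows "limitin (backward_topology (bd_completion D) (visual_dist D S \<epsilon>)) x l sequentially"
proof (rule limitin_backward_topology[of "visual_dist D S \<epsilon>" l x "bd_completion D",
      OF visual_dist_triangle visual_dist_refl[OF Y(2)] Y])
  fix e :: real assume "0 < e"
  then obtain C where C: "exp (- (\<epsilon> * C)) < e" using eps by (rule exists_exp_less)
  show "eventually (\<lambda>k. visual_dist D S \<epsilon> (x k) l < ennreal e) sequentially"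
    using L[of C]
  proof eventually_elim
    case (elim k)
    have "visual_dist D S \<epsilon> (x k) l \<le> rho_base D \<epsilon> S (x k) l"
      by (rule visual_dist_le_rho_base[OF Y])
    also have "\<dots> \<le> ennreal (exp (- (\<epsilon> * C)))"
      by (rule rho_base_le[OF S eps]) (use elim in blast)
    also have "\<dots> < ennreal e" using C by (simp add: ennreal_less_iff)
    finally show ?case .
  qed
qed

text \<open>
  Either infinitely many \<open>R j\<close> are constant with value in a fixed out-ball around \<open>x0\<close>, which is
  finite, and the sequence has a constant subsequence; or geodesics from \<open>x0\<close> to the \<open>R j m\<close> become long
  and have a limit ray, whose class is the limit.
\<close>

lemma convergent_subsequence_of_reachable:
  fixes x :: "nat \<Rightarrow> 'a bpoint"
  assumes S: "finite S" "S \<noteq> {}" and eps: "0 < \<epsilon>"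
    and Y: "\<And>j. x j \<in> bd_completion D" and R: "\<And>j. R j \<in> reps (x j)"
    and x0: "\<And>j. linked D (\<lambda>_. x0) (R j)"
    and tails: "\<And>i. \<exists>K M. \<forall>k m. K \<le> k \<longrightarrow> M \<le> m \<longrightarrow> linked D (\<lambda>_. R i m) (R k)"
  shows "\<exists>k l. strict_mono k \<and> limitin (backward_topology (bd_completion D) (visual_dist D S \<epsilon>)) (x \<circ> k) l sequentially"
proof (cases "\<forall>N. eventually (\<lambda>j. eventually (\<lambda>m. \<not> near D (real N) x0 (R j m)) sequentially) sequentially")
  case False
  then obtain N where "\<exists>\<^sub>F j in sequentially. \<not> eventually (\<lambda>m. \<not> near D (real N) x0 (R j m)) sequentially"
    unfolding frequently_def not_not by blast
  then have "\<exists>\<^sub>F j in sequentially. \<exists>v\<in>{v. near D (real N) x0 v}. x j = Inl v"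
  proof (rule frequently_mono[rotated], intro allI impI)
    fix j assume ne: "\<not> eventually (\<lambda>m. \<not> near D (real N) x0 (R j m)) sequentially"
    have "\<not> R j \<in> qg_rays D"
    proof
      assume "R j \<in> qg_rays D"
      from finite_near_qg_rays(1)[OF this, of "real N" x0]
      have "eventually (\<lambda>m. \<not> near D (real N) x0 (R j m)) cofinite" unfolding eventually_cofinite by simp
      with ne show False unfolding cofinite_eq_sequentially by simp
    qed
    with Y[of j] R[of j] obtain v where v: "R j = (\<lambda>_. v)" "x j = Inl v"
      by (cases rule: bd_completion_repsE) (auto simp: qg_rays_def)
    then have "near D (real N) x0 v" using ne by auto
    with v(2) show "\<exists>v\<in>{v. near D (real N) x0 v}. x j = Inl v" by simp
  qed
  from frequently_bex_finite[OF finite_near this]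
  obtain v where v: "\<exists>\<^sub>F j in sequentially. x j = Inl v" by blast
  obtain k :: "nat \<Rightarrow> nat" where k: "strict_mono k" "\<And>t. x (k t) = Inl v"
    using strict_mono_choice[of "\<lambda>_ j. x j = Inl v", OF v] by blast
  have vY: "Inl v \<in> bd_completion D" using Y[of "k 0"] k(2) by simp
  have "limitin (backward_topology (bd_completion D) (visual_dist D S \<epsilon>)) (\<lambda>t. Inl v) (Inl v) sequentially"
    by (rule limitin_backward_topology[of "visual_dist D S \<epsilon>" "Inl v" "\<lambda>_. Inl v" "bd_completion D",
          OF visual_dist_triangle visual_dist_refl[OF vY] vY vY])
       (simp add: visual_dist_refl[OF vY])
  moreover have "x \<circ> k = (\<lambda>t. Inl v)" using k(2) by auto
  ultimately have "limitin (backward_topology (bd_completion D) (visual_dist D S \<epsilon>)) (x \<circ> k) (Inl v) sequentially"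
    by (simp only:)
  with k(1) show ?thesis by blast
next
  case True
  have mono: "ascending D (R j) \<or> descending D (R j)" for j using reps_monotone[OF Y R] .
  have ev: "eventually (\<lambda>m. conn D x0 (R j m)) sequentially" for j
    by (rule linked_const_eventually[OF x0 mono])
  define P where "P j m = (SOME p. geodesic D x0 p (R j m))" for j m
  have P: "geodesic D x0 (P j m) (R j m)" if "conn D x0 (R j m)" for j m
    unfolding P_def by (rule geodesic_exists[OF that]) (rule someI)
  have geo: "eventually (\<lambda>m. geodesic D x0 (P j m) (R j m)) sequentially" for j
    using ev[of j] by eventually_elim (rule P)
  have long: "eventually (\<lambda>j. eventually (\<lambda>m. N < length (P j m)) sequentially) sequentially" for N
    using True[rule_format, of N]
  proof eventually_elim
    case (elim j)
    with geo[of j] show ?case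
    proof eventually_elim
      case (elim m)
      show ?case
      proof (rule ccontr)
        assume "\<not> N < length (P j m)"
        then have "near D (real N) x0 (R j m)"
          using near_mono[OF geodesic_length_near[OF elim(1)], of "real N"] by simp
        with elim(2) show False by simp
      qed
    qed
  qed
  obtain G where "\<forall>N. \<exists>\<^sub>F j in sequentially. \<exists>\<^sub>F m in sequentially.
      geodesic D x0 (P j m) (R j m) \<and> N < length (P j m) \<and> (\<forall>i\<le>N. P j m ! i = G i)"
    using exists_common_prefix[OF geo long] ..
  then interpret limit_ray D \<delta> f x0 P R G
    by unfold_locales (use geo in auto)
  obtain k :: "nat \<Rightarrow> nat" where k: "strict_mono k" "\<And>t. \<exists>\<^sub>F m in sequentially. agrees t (k t) m"
    using strict_mono_choice[of "\<lambda>t j. \<exists>\<^sub>F m in sequentially. agrees t j m", OF frequently_agrees] by blast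
  have Gq: "G \<in> qg_rays D" using G_qg_ray unfolding qg_rays_def by simp
  define l where "l = (Inr (ray_equiv D `` {G}) :: 'a bpoint)"
  have l: "l \<in> bd_completion D" "G \<in> reps l" unfolding l_def by (rule class_in_completion[OF Gq])+
  have types: "(\<exists>x. R j = (\<lambda>_. x)) \<or> qg_ray D (R j) \<or> qg_anti_ray D (R j)" for j
    using Y[of j] R[of j] by (cases rule: bd_completion_repsE) auto
  have RG: "\<exists>n\<ge>N. \<exists>m\<ge>N. conn D (R j n) (G m)" for j N
  proof -
    obtain K M where KM: "\<forall>k m. K \<le> k \<longrightarrow> M \<le> m \<longrightarrow> linked D (\<lambda>_. R j m) (R k)" using tails by blast
    obtain M' where M': "\<forall>m\<ge>M'. conn D x0 (R j m)" using ev[of j] unfolding eventually_sequentially ..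
    define n where "n = max N (max M M')"
    have "conn D x0 (R j n)" using M' unfolding n_def by simp
    moreover have "eventually (\<lambda>m. conn D (R j n) (R k m)) sequentially" if "K \<le> k" for k
      by (rule linked_const_eventually[OF _ mono]) (use KM that in \<open>simp add: n_def\<close>)
    ultimately obtain i where "conn D (R j n) (G i)" using reaches_limit_ray by blast
    from conn_trans[OF this G_conn] have "conn D (R j n) (G (max i N))" by simp
    moreover have "N \<le> n" unfolding n_def by simp
    ultimately show ?thesis by (intro exI[of _ n] conjI exI[of _ "max i N"]) auto
  qed
  have "limitin (backward_topology (bd_completion D) (visual_dist D S \<epsilon>)) (x \<circ> k) l sequentially"
  proof (rule convergence_criterion[OF S eps _ l(1)])
    fix C
    have "\<forall>s. \<exists>N. \<forall>j. (\<exists>\<^sub>F m in sequentially. agrees N j m) \<longrightarrow>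
      (\<exists>M. \<forall>m n W w. M \<le> m \<longrightarrow> M \<le> n \<longrightarrow> geodesic D (R j m) W (G n) \<longrightarrow> w \<in> set W
       \<longrightarrow> \<not> near D C s w \<and> \<not> near D C w s)"
      using geodesics_to_limit_far[OF types] by blast
    from choice[OF this] obtain N where N: "\<And>s j. \<exists>\<^sub>F m in sequentially. agrees (N s) j m \<Longrightarrow>
      (\<exists>M. \<forall>m n W w. M \<le> m \<longrightarrow> M \<le> n \<longrightarrow> geodesic D (R j m) W (G n) \<longrightarrow> w \<in> set W
       \<longrightarrow> \<not> near D C s w \<and> \<not> near D C w s)" by blast
    have "eventually (\<lambda>t. \<forall>s\<in>S. N s \<le> t) sequentially"
      by (intro eventually_ball_finite[OF S(1)] ballI eventually_ge_at_top)
    then show "eventually (\<lambda>t. \<forall>s\<in>S. \<exists>R\<in>reps ((x \<circ> k) t). \<exists>Q\<in>reps l. ereal C \<le> geodesic_liminf D s R Q) sequentially"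
    proof eventually_elim
      case (elim t)
      show ?case
      proof
        fix s assume "s \<in> S"
        with elim have "N s \<le> t" by blast
        have "\<exists>\<^sub>F m in sequentially. agrees (N s) (k t) m"
          using k(2)[of t] by (rule frequently_elim1) (rule agrees_mono[OF _ \<open>N s \<le> t\<close>])
        from N[OF this] have "ereal C \<le> geodesic_liminf D s (R (k t)) G"
          by (rule geodesic_liminf_ge[OF RG])
        then show "\<exists>R\<in>reps ((x \<circ> k) t). \<exists>Q\<in>reps l. ereal C \<le> geodesic_liminf D s R Q"
          using R[of "k t"] l(2) by auto
      qed
    qed
  qed (use Y in simp)
  with k(1) show ?thesis by blast
qed

text \<open>
  If the first alternative of \<open>reaches_tail_or_anti_rays\<close> holds for all \<open>i\<close>, a member of the first
  representative serves as \<open>x0\<close> in \<open>convergent_subsequence_of_reachable\<close>. Otherwise, all later points of the sequence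
  have distance 0 to the \<open>i\<close>-th one.
\<close>

theorem seq_f_compact_completion:
  assumes S: "finite S" "S \<noteq> {}" and eps: "0 < \<epsilon>"
  shows "seq_f_compact (bd_completion D) (visual_dist D S \<epsilon>)"
  unfolding seq_f_compact_def
proof (intro allI impI, elim conjE)
  fix x :: "nat \<Rightarrow> 'a bpoint"
  assume rx: "range x \<subseteq> bd_completion D" and fin: "\<forall>i j. i < j \<longrightarrow> visual_dist D S \<epsilon> (x i) (x j) < \<infinity>"
  have Y: "x i \<in> bd_completion D" for i using rx by auto
  have "\<forall>i. \<exists>R. R \<in> reps (x i)" using reps_nonempty[OF Y] by blast
  from choice[OF this] obtain R where R: "\<And>i. R i \<in> reps (x i)" by blast
  have link: "linked D (R i) (R j)" if "i < j" for i j
    by (rule visual_dist_finite_imp_linked[OF S eps _ R R]) (use fin that in blast)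
  show "\<exists>k l. strict_mono k \<and> limitin (backward_topology (bd_completion D) (visual_dist D S \<epsilon>)) (x \<circ> k) l sequentially"
  proof (cases "\<exists>i. \<forall>j\<ge>i. qg_anti_ray D (R j) \<and> (i < j \<longrightarrow> (\<forall>h. \<exists>m. \<not> conn D (R i h) (R j m)))")
    case True
    then obtain i where i: "\<And>j. i \<le> j \<Longrightarrow> qg_anti_ray D (R j)"
      "\<And>j h. i < j \<Longrightarrow> \<exists>m. \<not> conn D (R i h) (R j m)" by (meson less_imp_le)
    have "limitin (backward_topology (bd_completion D) (visual_dist D S \<epsilon>)) (x \<circ> id) (x i) sequentially"
    proof (rule convergence_criterion[OF S eps _ Y])
      fix C
      have "ereal C \<le> geodesic_liminf D s (R j) (R i)" if "i < j" for j s
        by (rule anti_ray_pair_liminf[OF i(1)[OF order_refl] i(1)[OF less_imp_le[OF that]] link[OF that] i(2)[OF that]])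
      then have "\<forall>s\<in>S. \<exists>Ra\<in>reps ((x \<circ> id) j). \<exists>Q\<in>reps (x i). ereal C \<le> geodesic_liminf D s Ra Q" if "i < j" for j
        using R[of j] R[of i] that by auto
      then show "eventually (\<lambda>j. \<forall>s\<in>S. \<exists>Ra\<in>reps ((x \<circ> id) j). \<exists>Q\<in>reps (x i). ereal C \<le> geodesic_liminf D s Ra Q) sequentially"
        by (rule eventually_mono[OF eventually_gt_at_top[of i]])
    qed (use Y in simp)
    then show ?thesis using strict_mono_id by blast
  next
    case not_anti: False
    have tails: "\<exists>K M. \<forall>k m. K \<le> k \<longrightarrow> M \<le> m \<longrightarrow> linked D (\<lambda>_. R i m) (R k)" for i
    proof (rule reaches_tail_or_anti_rays[where i = i, OF Y R link])
      fix K M assume "\<And>k m. K \<le> k \<Longrightarrow> M \<le> m \<Longrightarrow> linked D (\<lambda>_. R i m) (R k)"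
      then show ?thesis by blast
    next
      assume "\<And>j. i \<le> j \<Longrightarrow> qg_anti_ray D (R j)" "\<And>h j. i < j \<Longrightarrow> \<exists>m. \<not> conn D (R i h) (R j m)"
      with not_anti show ?thesis by blast
    qed
    obtain K0 M0 where 0: "\<forall>k m. K0 \<le> k \<longrightarrow> M0 \<le> m \<longrightarrow> linked D (\<lambda>_. R 0 m) (R k)" using tails by blast
    have "\<exists>k l. strict_mono k \<and>
      limitin (backward_topology (bd_completion D) (visual_dist D S \<epsilon>)) ((\<lambda>j. x (K0 + j)) \<circ> k) l sequentially"
    proof (rule convergent_subsequence_of_reachable[OF S eps Y R])
      show "linked D (\<lambda>_. R 0 M0) (R (K0 + j))" for j using 0 by simp
      show "\<exists>K M. \<forall>k m. K \<le> k \<longrightarrow> M \<le> m \<longrightarrow> linked D (\<lambda>_. R (K0 + i) m) (R (K0 + k))" for i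
        using tails[of "K0 + i"] by (meson trans_le_add2)
    qed
    then obtain k l where kl: "strict_mono k"
      "limitin (backward_topology (bd_completion D) (visual_dist D S \<epsilon>)) ((\<lambda>j. x (K0 + j)) \<circ> k) l sequentially" by blast
    have "strict_mono (\<lambda>t. K0 + k t)" using kl(1) unfolding strict_mono_def by simp
    moreover have "(\<lambda>j. x (K0 + j)) \<circ> k = x \<circ> (\<lambda>t. K0 + k t)" by (simp add: comp_def)
    ultimately show ?thesis using kl(2) by auto
  qed
qed

end

lemma seq_f_compact_of_hyperbolic:
  assumes "wf_digraph D" "0 \<le> \<delta>" "hyperbolic_digraph D \<delta>" "cond_B1 D f" "cond_B2 D f"
    and base: "is_base D S" and S: "finite S" and eps: "0 < \<epsilon>"
    and fin: "\<And>x. x \<in> verts D \<Longrightarrow> finite_out_degree D x"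
  shows "seq_f_compact (bd_completion D) (visual_dist D S \<epsilon>)"
proof -
  interpret wf_digraph D by fact
  interpret finite_out_thin_digraph D \<delta> f by unfold_locales (fact assms)+
  show ?thesis
  proof (cases "S = {}")
    case False
    then show ?thesis by (rule seq_f_compact_completion[OF S _ eps])
  next
    case True
    then have "verts D = {}" using base unfolding is_base_def by blast
    then have "bd_completion D = {}"
      using reps_in_verts[of _ D] reps_nonempty by (metis all_not_in_conv)
    then show ?thesis unfolding seq_f_compact_def by auto
  qed
qed

theorem theorem9p4:
  fixes D :: "('a,'b) pre_digraph" and S :: "'a set"
    and \<delta> \<epsilon> :: real and f :: "real \<Rightarrow> real"
  assumes "wf_digraph D"
    and "\<delta> \<ge> 0"
    and "hyperbolic_digraph D \<delta>"
    and "cond_B1 D f" and "cond_B2 D f"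
    and "is_base D S" and "finite S"
    and "\<epsilon> > 0"
    and "exp (2 * \<epsilon> * (6 * \<delta> + 2 * \<delta> * f (\<delta> + 1))) < sqrt 2"
  shows "((\<forall>x\<in>verts D. finite_out_degree D x) \<longrightarrow>
            seq_f_compact (bd_completion D) (visual_dist D S \<epsilon>)) \<and>
         ((\<forall>x\<in>verts D. finite_in_degree D x) \<longrightarrow>
            seq_b_compact (bd_completion D) (visual_dist D S \<epsilon>))"
proof (intro conjI impI)
  assume fin: "\<forall>x\<in>verts D. finite_out_degree D x"
  show "seq_f_compact (bd_completion D) (visual_dist D S \<epsilon>)"
    by (rule seq_f_compact_of_hyperbolic[OF assms(1-8)]) (use fin in blast)
next
  assume fin: "\<forall>x\<in>verts D. finite_in_degree D x"
  have "seq_f_compact (bd_completion (reversal D)) (visual_dist (reversal D) S \<epsilon>)"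
    by (rule seq_f_compact_of_hyperbolic[of "reversal D" \<delta> f])
       (use assms fin in \<open>simp_all add: wf_digraph_reversal hyperbolic_digraph_reversal cond_B1_reversal
          cond_B2_reversal is_base_reversal finite_out_degree_reversal\<close>)
  then show "seq_b_compact (bd_completion D) (visual_dist D S \<epsilon>)"
    unfolding seq_f_compact_reversal .
qed

end
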